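(* The unbounded linear operators $\mathcal{A}$ (in $C_T(\mathbb{R},X)$) and $\mathcal{A}^{\odot\star}$ (in $C_T(\mathbb{R},X^{\odot\star})$) are not closed but closable.
   Context: Setting. Fix a delay $0<h<\infty$ and integers $n\ge 1$, $k\ge 1$. Let $X=C([-h,0],\mathbb{R}^n)$ with the supremum norm, and write $x_t(\theta)=x(t+\theta)$, $\theta\in[-h,0]$. Let $F:X\to\mathbb{R}^n$ be $C^{k+1}$-smooth and let $\gamma:\mathbb{R}\to\mathbb{R}^n$ be a periodic solution, with minimal period $T>0$, of $\dot x(t)=F(x_t)$. Put $L(t)=DF(\gamma_t)\in\mathcal{L}(X,\mathbb{R}^n)$, which is $T$-periodic and $C^k$ in $t$. All spaces and operators are complexified without change of notation. $X^{\odot\star}=\mathbb{R}^n\times L^\infty([-h,0],\mathbb{R}^n)$. For $\tau\in\mathbb{R}$, $\mathcal{D}(A(\tau))=\{\varphi\in C^1([-h,0],\mathbb{R}^n):\varphi'(0)=L(\tau)\varphi\}$, $A(\tau)\varphi=\varphi'$; $\mathcal{D}(A^{\odot\star}(\tau))=\{(\alpha,\varphi)\in X^{\odot\star}:\varphi\text{ Lipschitz},\ \varphi(0)=\alpha\}$, $A^{\odot\star}(\tau)(\alpha,\varphi)=(L(\tau)\varphi,\varphi')$. For a complex Banach space $E$, $C_T(\mathbb{R},E)$ is the Banach space of continuous $T$-periodic functions $\mathbb{R}\to E$ with the supremum norm and $C_T^1(\mathbb{R},E)$ its subspace of $C^1$ functions. Define $\mathcal{D}(\mathcal{A})=\{\varphi\in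 C_T^1(\mathbb{R},X):\varphi(\tau)\in\mathcal{D}(A(\tau))\ \forall\tau\}$, $(\mathcal{A}\varphi)(\tau)=A(\tau)\varphi(\tau)-\dot\varphi(\tau)$; $\mathcal{D}(\mathcal{A}^{\odot\star})=\{\varphi^{\odot\star}\in C_T^1(\mathbb{R},X^{\odot\star}):\varphi^{\odot\star}(\tau)\in\mathcal{D}(A^{\odot\star}(\tau))\ \forall\tau\}$, $(\mathcal{A}^{\odot\star}\varphi^{\odot\star})(\tau)=A^{\odot\star}(\tau)\varphi^{\odot\star}(\tau)-\dot\varphi^{\odot\star}(\tau)$.
   Formalization: The domains of both operators are restricted to those functions for which τ ↦ A(τ)φ(τ) − φ̇(τ) (respectively its sun-star version) is continuous, since on the domains as displayed the image need not lie in C_T. *)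

theory Defs
  imports "HOL-Analysis.Analysis" "HOL-Probability.Essential_Supremum"
begin

section \<open>Complex normed spaces\<close>

class complex_normed_vector = real_normed_vector +
  fixes scaleC :: "complex \<Rightarrow> 'a \<Rightarrow> 'a"  (infixr "*\<^sub>C" 75)
  assumes scaleC_add_right: "c *\<^sub>C (x + y) = c *\<^sub>C x + c *\<^sub>C y"
    and scaleC_add_left: "(c + d) *\<^sub>C x = c *\<^sub>C x + d *\<^sub>C x"
    and scaleC_scaleC: "c *\<^sub>C d *\<^sub>C x = (c * d) *\<^sub>C x"
    and scaleC_of_real: "complex_of_real r *\<^sub>C x = r *\<^sub>R x"
    and norm_scaleC: "norm (c *\<^sub>C x) = cmod c * norm x"

lemma scaleC_one: "1 *\<^sub>C x = (x :: 'a :: complex_normed_vector)"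
  using scaleC_of_real[of 1 x] by simp

global_interpretation cvec: vector_space "scaleC :: complex \<Rightarrow> 'a \<Rightarrow> 'a::complex_normed_vector"
  by unfold_locales (simp_all add: scaleC_add_right scaleC_add_left scaleC_scaleC scaleC_one)

lemma scaleC_bounded_linear: "bounded_linear (\<lambda>x :: 'a :: complex_normed_vector. c *\<^sub>C x)"
proof (rule bounded_linear_intro[where K = "cmod c"])
  fix r :: real and x y :: 'a
  show "c *\<^sub>C (x + y) = c *\<^sub>C x + c *\<^sub>C y" by (rule scaleC_add_right)
  show "c *\<^sub>C r *\<^sub>R x = r *\<^sub>R c *\<^sub>C x"
    by (simp add: scaleC_of_real[symmetric] scaleC_scaleC mult.commute)
  show "norm (c *\<^sub>C x) \<le> norm x * cmod c" by (simp add: norm_scaleC mult.commute)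
qed

instantiation complex :: complex_normed_vector
begin
definition scaleC_complex :: "complex \<Rightarrow> complex \<Rightarrow> complex"
  where "scaleC_complex c x = c * x"
instance
  by standard (simp_all add: scaleC_complex_def algebra_simps norm_mult scaleR_conv_of_real)
end

instantiation vec :: (complex_normed_vector, finite) complex_normed_vector
begin
definition scaleC_vec :: "complex \<Rightarrow> 'a ^ 'b \<Rightarrow> 'a ^ 'b"
  where "scaleC_vec c x = (\<chi> i. c *\<^sub>C x $ i)"
instance
proof
  fix c :: complex and x :: "'a ^ 'b"
  show "norm (c *\<^sub>C x) = cmod c * norm x"
    by (simp add: norm_vec_def scaleC_vec_def norm_scaleC L2_set_right_distrib)
qed (simp_all add: scaleC_vec_def vec_eq_iff scaleC_add_right scaleC_add_left
      scaleC_scaleC scaleC_of_real)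
end

instantiation prod :: (complex_normed_vector, complex_normed_vector) complex_normed_vector
begin
definition scaleC_prod :: "complex \<Rightarrow> 'a \<times> 'b \<Rightarrow> 'a \<times> 'b"
  where "scaleC_prod c p = (c *\<^sub>C fst p, c *\<^sub>C snd p)"
instance
proof
  fix c :: complex and x :: "'a \<times> 'b"
  have "(cmod c * norm (fst x))\<^sup>2 + (cmod c * norm (snd x))\<^sup>2
      = (cmod c)\<^sup>2 * ((norm (fst x))\<^sup>2 + (norm (snd x))\<^sup>2)"
    by (simp add: power_mult_distrib distrib_left)
  then show "norm (c *\<^sub>C x) = cmod c * norm x"
    by (simp add: norm_prod_def scaleC_prod_def norm_scaleC real_sqrt_mult)
qed (simp_all add: scaleC_prod_def scaleC_add_right scaleC_add_left
      scaleC_scaleC scaleC_of_real scaleR_prod_def)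
end

instantiation bcontfun :: (topological_space, complex_normed_vector) complex_normed_vector
begin
definition scaleC_bcontfun :: "complex \<Rightarrow> ('a \<Rightarrow>\<^sub>C 'b) \<Rightarrow> ('a \<Rightarrow>\<^sub>C 'b)"
  where "scaleC_bcontfun c f = Bcontfun (\<lambda>x. c *\<^sub>C f x)"

lemma apply_scaleC_bcontfun [simp]: "apply_bcontfun (c *\<^sub>C f) x = c *\<^sub>C apply_bcontfun f x"
  for f :: "'a \<Rightarrow>\<^sub>C 'b"
proof -
  have "(\<lambda>x. c *\<^sub>C f x) \<in> bcontfun"
  proof (rule bcontfun_normI)
    show "continuous_on UNIV (\<lambda>x. c *\<^sub>C f x)"
      by (rule bounded_linear.continuous_on[OF scaleC_bounded_linear]) simp
    show "norm (c *\<^sub>C f x) \<le> cmod c * norm f" for x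
      by (simp add: norm_scaleC mult_left_mono norm_bounded)
  qed
  then show ?thesis by (simp add: scaleC_bcontfun_def Bcontfun_inverse)
qed

instance
proof
  fix c d :: complex and r :: real and f g :: "'a \<Rightarrow>\<^sub>C 'b"
  show "c *\<^sub>C (f + g) = c *\<^sub>C f + c *\<^sub>C g"
    "(c + d) *\<^sub>C f = c *\<^sub>C f + d *\<^sub>C f"
    "c *\<^sub>C d *\<^sub>C f = (c * d) *\<^sub>C f"
    "complex_of_real r *\<^sub>C f = r *\<^sub>R f"
    by (auto intro!: bcontfun_eqI
        simp: scaleC_add_right scaleC_add_left scaleC_scaleC scaleC_of_real)
  have le: "norm (c *\<^sub>C f) \<le> cmod c * norm f" for c and f :: "'a \<Rightarrow>\<^sub>C 'b"
    by (rule norm_bound) (simp add: norm_scaleC mult_left_mono norm_bounded)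
  show "norm (c *\<^sub>C f) = cmod c * norm f"
  proof (cases "c = 0")
    case True
    then show ?thesis using le[of c f] by simp
  next
    case False
    have "inverse c *\<^sub>C c *\<^sub>C f = f"
      using False by (auto intro!: bcontfun_eqI simp: scaleC_scaleC scaleC_one)
    then have "norm f \<le> inverse (cmod c) * norm (c *\<^sub>C f)"
      using le[of "inverse c" "c *\<^sub>C f"] by (simp only: norm_inverse)
    then have "cmod c * norm f \<le> norm (c *\<^sub>C f)"
      using False by (simp add: field_simps)
    with le[of c f] show ?thesis by simp
  qed
qed
end


section \<open>The space of essentially bounded functions\<close>

definition ess_bounded :: "(real \<Rightarrow> 'b::euclidean_space) \<Rightarrow> bool"
  where "ess_bounded f \<longleftrightarrow>
    f \<in> borel_measurable lebesgue \<and> (\<exists>C. AE x in lebesgue. norm (f x) \<le> C)"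

lemma ess_boundedI:
  "f \<in> borel_measurable lebesgue \<Longrightarrow> AE x in lebesgue. norm (f x) \<le> C \<Longrightarrow> ess_bounded f"
  by (auto simp: ess_bounded_def)

lemma ess_boundedE:
  assumes "ess_bounded f"
  obtains C where "f \<in> borel_measurable lebesgue" "AE x in lebesgue. norm (f x) \<le> C"
  using assms by (auto simp: ess_bounded_def)

definition ess_eq :: "(real \<Rightarrow> 'b::euclidean_space) \<Rightarrow> (real \<Rightarrow> 'b) \<Rightarrow> bool"
  where "ess_eq f g \<longleftrightarrow> ess_bounded f \<and> ess_bounded g \<and> (AE x in lebesgue. f x = g x)"

lemma ess_bounded_zero: "ess_bounded (\<lambda>_. 0)"
  by (rule ess_boundedI[of _ 0]) auto

lemma part_equivp_ess_eq: "part_equivp ess_eq"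
proof (rule part_equivpI)
  show "\<exists>f. ess_eq f (f :: real \<Rightarrow> 'b :: euclidean_space)"
    by (rule exI[of _ "\<lambda>_. 0"]) (simp add: ess_eq_def ess_bounded_zero)
  show "symp (ess_eq :: (real \<Rightarrow> 'b :: euclidean_space) \<Rightarrow> _)"
    by (auto simp: symp_def ess_eq_def elim: eventually_mono)
  show "transp (ess_eq :: (real \<Rightarrow> 'b :: euclidean_space) \<Rightarrow> _)"
  proof (rule transpI)
    fix f g k :: "real \<Rightarrow> 'b :: euclidean_space"
    assume fg: "ess_eq f g" and gk: "ess_eq g k"
    from fg gk have "AE x in lebesgue. f x = g x" "AE x in lebesgue. g x = k x"
      by (auto simp: ess_eq_def)
    then have "AE x in lebesgue. f x = k x" by eventually_elim simp
    with fg gk show "ess_eq f k" by (simp add: ess_eq_def)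
  qed
qed

text \<open>\<open>'b linf\<close> is \<open>L\<^sup>\<infinity>(\<real>, 'b)\<close>; the space over a compact interval appears below as the
  subspace of the classes that vanish almost everywhere off the interval.\<close>

quotient_type (overloaded) 'b linf = "real \<Rightarrow> 'b :: euclidean_space" / partial: ess_eq
  by (rule part_equivp_ess_eq)

lemma ess_bounded_rep: "ess_bounded (rep_linf f)"
  using Quotient3_rep_reflp[OF Quotient3_linf] by (auto simp: ess_eq_def)

lemma linf_eq_iff: "f = g \<longleftrightarrow> (AE x in lebesgue. rep_linf f x = rep_linf g x)"
  by (metis Quotient3_rel_rep[OF Quotient3_linf] ess_eq_def ess_bounded_rep)

lemma rep_abs_linf: "ess_bounded f \<Longrightarrow> AE x in lebesgue. rep_linf (abs_linf f) x = f x"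
  using Quotient3_rep_abs[OF Quotient3_linf, of f] by (simp add: ess_eq_def)

lemma ess_bounded_add:
  assumes "ess_bounded f" "ess_bounded g"
  shows "ess_bounded (\<lambda>x. f x + g x)"
proof -
  obtain C D where [measurable]: "f \<in> borel_measurable lebesgue" "g \<in> borel_measurable lebesgue"
    and C: "AE x in lebesgue. norm (f x) \<le> C" and D: "AE x in lebesgue. norm (g x) \<le> D"
    using assms by (auto elim!: ess_boundedE)
  from C D have "AE x in lebesgue. norm (f x + g x) \<le> C + D"
    by eventually_elim (simp add: norm_triangle_mono)
  then show ?thesis by (intro ess_boundedI[of _ "C + D"]) simp_all
qed

lemma ess_bounded_bounded_linear:
  assumes "ess_bounded f" "bounded_linear L"
  shows "ess_bounded (\<lambda>x. L (f x) :: 'b :: euclidean_space)"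
proof -
  obtain C where f: "f \<in> borel_measurable lebesgue" and C: "AE x in lebesgue. norm (f x) \<le> C"
    using assms by (auto elim!: ess_boundedE)
  have "L \<in> borel_measurable borel"
    by (intro borel_measurable_continuous_onI linear_continuous_on assms)
  with f have m: "(\<lambda>x. L (f x)) \<in> borel_measurable lebesgue" by (rule measurable_compose)
  obtain K where K: "K > 0" "\<And>x. norm (L x) \<le> norm x * K"
    using bounded_linear.pos_bounded[OF assms(2)] by blast
  from C have "AE x in lebesgue. norm (L (f x)) \<le> C * K"
    by eventually_elim (meson K less_imp_le mult_right_mono order_trans)
  with m show ?thesis by (rule ess_boundedI)
qed

instantiation linf :: (euclidean_space) real_vector
begin

definition zero_linf :: "'a linf" where "zero_linf = abs_linf (\<lambda>_. 0)"
definition plus_linf :: "'a linf \<Rightarrow> 'a linf \<Rightarrow> 'a linf"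
  where "plus_linf f g = abs_linf (\<lambda>x. rep_linf f x + rep_linf g x)"
definition scaleR_linf :: "real \<Rightarrow> 'a linf \<Rightarrow> 'a linf"
  where "scaleR_linf r f = abs_linf (\<lambda>x. r *\<^sub>R rep_linf f x)"
definition uminus_linf :: "'a linf \<Rightarrow> 'a linf"
  where "uminus_linf f = abs_linf (\<lambda>x. - rep_linf f x)"
definition minus_linf :: "'a linf \<Rightarrow> 'a linf \<Rightarrow> 'a linf"
  where "minus_linf f g = f + - g"

lemma rep_zero_linf: "AE x in lebesgue. rep_linf (0 :: 'a linf) x = 0"
  unfolding zero_linf_def by (rule rep_abs_linf[OF ess_bounded_zero])

lemma rep_plus_linf:
  "AE x in lebesgue. rep_linf (f + g) x = rep_linf f x + rep_linf g x" for f :: "'a linf"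
  unfolding plus_linf_def by (intro rep_abs_linf ess_bounded_add ess_bounded_rep)

lemma rep_scaleR_linf:
  "AE x in lebesgue. rep_linf (r *\<^sub>R f) x = r *\<^sub>R rep_linf f x" for f :: "'a linf"
  unfolding scaleR_linf_def
  by (rule rep_abs_linf[OF ess_bounded_bounded_linear[OF ess_bounded_rep bounded_linear_scaleR_right]])

lemma rep_uminus_linf:
  "AE x in lebesgue. rep_linf (- f) x = - rep_linf f x" for f :: "'a linf"
  unfolding uminus_linf_def
  by (rule rep_abs_linf[OF ess_bounded_bounded_linear[OF ess_bounded_rep
          bounded_linear_minus[OF bounded_linear_ident]]])

instance
proof
  fix f g k :: "'a linf" and a b :: real
  show "f + g + k = f + (g + k)"
    unfolding linf_eq_iff
    using rep_plus_linf[of "f + g" k] rep_plus_linf[of f g] rep_plus_linf[of f "g + k"]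
      rep_plus_linf[of g k]
    by eventually_elim simp
  show "f + g = g + f"
    unfolding linf_eq_iff using rep_plus_linf[of f g] rep_plus_linf[of g f]
    by eventually_elim simp
  show "0 + f = f"
    unfolding linf_eq_iff using rep_plus_linf[of 0 f] rep_zero_linf by eventually_elim simp
  show "- f + f = 0"
    unfolding linf_eq_iff using rep_plus_linf[of "- f" f] rep_uminus_linf[of f] rep_zero_linf
    by eventually_elim simp
  show "f - g = f + - g" by (rule minus_linf_def)
  show "a *\<^sub>R (f + g) = a *\<^sub>R f + a *\<^sub>R g"
    unfolding linf_eq_iff
    using rep_scaleR_linf[of a "f + g"] rep_plus_linf[of f g]
      rep_plus_linf[of "a *\<^sub>R f" "a *\<^sub>R g"] rep_scaleR_linf[of a f] rep_scaleR_linf[of a g]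
    by eventually_elim (simp add: scaleR_add_right)
  show "(a + b) *\<^sub>R f = a *\<^sub>R f + b *\<^sub>R f"
    unfolding linf_eq_iff
    using rep_scaleR_linf[of "a + b" f] rep_plus_linf[of "a *\<^sub>R f" "b *\<^sub>R f"]
      rep_scaleR_linf[of a f] rep_scaleR_linf[of b f]
    by eventually_elim (simp add: scaleR_add_left)
  show "a *\<^sub>R b *\<^sub>R f = (a * b) *\<^sub>R f"
    unfolding linf_eq_iff
    using rep_scaleR_linf[of a "b *\<^sub>R f"] rep_scaleR_linf[of b f] rep_scaleR_linf[of "a * b" f]
    by eventually_elim simp
  show "1 *\<^sub>R f = f"
    unfolding linf_eq_iff using rep_scaleR_linf[of 1 f] by eventually_elim simp
qed

end

instantiation linf :: (euclidean_space) real_normed_vector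
begin

definition norm_linf :: "'a linf \<Rightarrow> real"
  where "norm_linf f = real_of_ereal (esssup lebesgue (\<lambda>x. ereal (norm (rep_linf f x))))"
definition sgn_linf :: "'a linf \<Rightarrow> 'a linf" where "sgn_linf f = f /\<^sub>R norm f"
definition dist_linf :: "'a linf \<Rightarrow> 'a linf \<Rightarrow> real" where "dist_linf f g = norm (f - g)"
definition uniformity_linf :: "('a linf \<times> 'a linf) filter"
  where "uniformity_linf = (INF e\<in>{0 <..}. principal {(x, y). dist x y < e})"
definition open_linf :: "'a linf set \<Rightarrow> bool"
  where "open_linf S = (\<forall>x\<in>S. \<forall>\<^sub>F (x', y) in uniformity. x' = x \<longrightarrow> y \<in> S)"

lemma norm_linf_esssup:
  "ereal (norm f) = esssup lebesgue (\<lambda>x. ereal (norm (rep_linf f x)))" for f :: "'a linf"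
proof -
  let ?e = "esssup lebesgue (\<lambda>x. ereal (norm (rep_linf f x)))"
  obtain C where m: "rep_linf f \<in> borel_measurable lebesgue"
    and C: "AE x in lebesgue. norm (rep_linf f x) \<le> C"
    using ess_bounded_rep[of f] by (auto elim!: ess_boundedE)
  from m have "?e \<le> ereal C" using C by (intro esssup_I) simp_all
  moreover have "0 \<le> ?e"
  proof -
    have "esssup lebesgue (\<lambda>_ :: real. 0 :: ereal) = 0"
      by (rule esssup_const) simp
    moreover have "esssup lebesgue (\<lambda>_ :: real. 0 :: ereal) \<le> ?e"
      by (rule esssup_mono) simp_all
    ultimately show ?thesis by simp
  qed
  ultimately show ?thesis
    unfolding norm_linf_def by (cases ?e) auto
qed

lemma AE_norm_linf: "AE x in lebesgue. norm (rep_linf f x) \<le> norm f" for f :: "'a linf"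
  using esssup_AE[of "\<lambda>x. ereal (norm (rep_linf f x))" lebesgue]
  unfolding norm_linf_esssup[symmetric] by simp

lemma norm_linf_leI:
  fixes f :: "'a linf"
  assumes "AE x in lebesgue. norm (rep_linf f x) \<le> C"
  shows "norm f \<le> C"
proof -
  have "rep_linf f \<in> borel_measurable lebesgue"
    using ess_bounded_rep[of f] by (auto elim!: ess_boundedE)
  then have "ereal (norm f) \<le> ereal C"
    unfolding norm_linf_esssup using assms by (intro esssup_I) simp_all
  then show ?thesis by simp
qed

lemma norm_linf_nonneg: "0 \<le> norm f" for f :: "'a linf"
proof (rule ccontr)
  assume "\<not> 0 \<le> norm f"
  then have "norm f < 0" by simp
  have "AE x :: real in lebesgue. False"
    using AE_norm_linf[of f] 
  proof eventually_elim
    case (elim x)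
    with \<open>norm f < 0\<close> norm_ge_zero[of "rep_linf f x"] show False by linarith
  qed
  then have "ae_filter (lebesgue :: real measure) = bot" by (simp add: trivial_limit_def)
  then show False unfolding ae_filter_eq_bot_iff by simp
qed

instance
proof
  fix f g :: "'a linf" and a :: real
  show "dist f g = norm (f - g)" by (rule dist_linf_def)
  show "sgn f = f /\<^sub>R norm f" by (rule sgn_linf_def)
  show "uniformity = (INF e\<in>{0 <..}. principal {(x, y :: 'a linf). dist x y < e})"
    by (rule uniformity_linf_def)
  show "open U = (\<forall>x\<in>U. \<forall>\<^sub>F (x', y) in uniformity. x' = x \<longrightarrow> y \<in> U)" for U :: "'a linf set"
    by (rule open_linf_def)
  show "norm f = 0 \<longleftrightarrow> f = 0"
  proof
    assume f: "norm f = 0"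
    show "f = 0"
      unfolding linf_eq_iff using AE_norm_linf[of f] rep_zero_linf
      by eventually_elim (simp add: f)
  next
    assume "f = 0"
    have "norm (0 :: 'a linf) \<le> 0"
      using rep_zero_linf by (intro norm_linf_leI) (auto elim: eventually_mono)
    with \<open>f = 0\<close> norm_linf_nonneg[of f] show "norm f = 0" by simp
  qed
  show "norm (f + g) \<le> norm f + norm g"
    using rep_plus_linf[of f g] AE_norm_linf[of f] AE_norm_linf[of g]
    by (intro norm_linf_leI, eventually_elim) (simp add: norm_triangle_mono)
  have le: "norm (a *\<^sub>R f) \<le> \<bar>a\<bar> * norm f" for a and f :: "'a linf"
    using rep_scaleR_linf[of a f] AE_norm_linf[of f]
    by (intro norm_linf_leI, eventually_elim) (simp add: mult_left_mono)
  show "norm (a *\<^sub>R f) = \<bar>a\<bar> * norm f"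
  proof (cases "a = 0")
    case True
    then show ?thesis using le[of a f] norm_linf_nonneg[of "a *\<^sub>R f"] by simp
  next
    case False
    have "inverse a *\<^sub>R a *\<^sub>R f = f"
      unfolding linf_eq_iff
      using rep_scaleR_linf[of "inverse a" "a *\<^sub>R f"] rep_scaleR_linf[of a f]
      by eventually_elim (simp add: False)
    then have "norm f \<le> \<bar>inverse a\<bar> * norm (a *\<^sub>R f)"
      using le[of "inverse a" "a *\<^sub>R f"] by simp
    then have "\<bar>a\<bar> * norm f \<le> norm (a *\<^sub>R f)" using False by (simp add: field_simps)
    with le[of a f] show ?thesis by simp
  qed
qed

end

class complex_euclidean_space = complex_normed_vector + euclidean_space

instance complex :: complex_euclidean_space ..
instance vec :: (complex_euclidean_space, finite) complex_euclidean_space ..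

instantiation linf :: (complex_euclidean_space) complex_normed_vector
begin

definition scaleC_linf :: "complex \<Rightarrow> 'a linf \<Rightarrow> 'a linf"
  where "scaleC_linf c f = abs_linf (\<lambda>x. c *\<^sub>C rep_linf f x)"

lemma rep_scaleC_linf:
  "AE x in lebesgue. rep_linf (c *\<^sub>C f) x = c *\<^sub>C rep_linf f x" for f :: "'a linf"
  unfolding scaleC_linf_def
  by (rule rep_abs_linf[OF ess_bounded_bounded_linear[OF ess_bounded_rep scaleC_bounded_linear]])

instance
proof
  fix f g :: "'a linf" and c d :: complex and r :: real
  show "c *\<^sub>C (f + g) = c *\<^sub>C f + c *\<^sub>C g"
    unfolding linf_eq_iff
    using rep_scaleC_linf[of c "f + g"] rep_plus_linf[of f g]
      rep_plus_linf[of "c *\<^sub>C f" "c *\<^sub>C g"] rep_scaleC_linf[of c f] rep_scaleC_linf[of c g]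
    by eventually_elim (simp add: scaleC_add_right)
  show "(c + d) *\<^sub>C f = c *\<^sub>C f + d *\<^sub>C f"
    unfolding linf_eq_iff
    using rep_scaleC_linf[of "c + d" f] rep_plus_linf[of "c *\<^sub>C f" "d *\<^sub>C f"]
      rep_scaleC_linf[of c f] rep_scaleC_linf[of d f]
    by eventually_elim (simp add: scaleC_add_left)
  have assoc: "c *\<^sub>C d *\<^sub>C f = (c * d) *\<^sub>C f" for c d and f :: "'a linf"
    unfolding linf_eq_iff
    using rep_scaleC_linf[of c "d *\<^sub>C f"] rep_scaleC_linf[of d f] rep_scaleC_linf[of "c * d" f]
    by eventually_elim (simp add: scaleC_scaleC)
  then show "c *\<^sub>C d *\<^sub>C f = (c * d) *\<^sub>C f" .
  have real: "complex_of_real r *\<^sub>C f = r *\<^sub>R f" for r and f :: "'a linf"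
    unfolding linf_eq_iff
    using rep_scaleC_linf[of "complex_of_real r" f] rep_scaleR_linf[of r f]
    by eventually_elim (simp add: scaleC_of_real)
  then show "complex_of_real r *\<^sub>C f = r *\<^sub>R f" .
  have le: "norm (c *\<^sub>C f) \<le> cmod c * norm f" for c and f :: "'a linf"
    using rep_scaleC_linf[of c f] AE_norm_linf[of f]
    by (intro norm_linf_leI, eventually_elim) (simp add: mult_left_mono norm_scaleC)
  show "norm (c *\<^sub>C f) = cmod c * norm f"
  proof (cases "c = 0")
    case True
    then show ?thesis using le[of c f] by simp
  next
    case False
    then have "inverse c *\<^sub>C c *\<^sub>C f = f"
      using assoc[of "inverse c" c f] real[of 1 f] by simp
    then have "norm f \<le> inverse (cmod c) * norm (c *\<^sub>C f)"
      using le[of "inverse c" "c *\<^sub>C f"] by (simp only: norm_inverse)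
    then have "cmod c * norm f \<le> norm (c *\<^sub>C f)"
      using False by (simp add: field_simps)
    with le[of c f] show ?thesis by simp
  qed
qed

end


section \<open>Unbounded operators\<close>

text \<open>An unbounded linear operator in a closed subspace \<open>E\<close> of a normed space is identified with
  its graph.\<close>

definition linear_operator_in :: "'a::complex_normed_vector set \<Rightarrow> ('a \<times> 'a) set \<Rightarrow> bool"
  where "linear_operator_in E G \<longleftrightarrow> G \<subseteq> E \<times> E \<and> cvec.subspace G \<and> single_valued G"

definition closed_operator_in :: "'a::complex_normed_vector set \<Rightarrow> ('a \<times> 'a) set \<Rightarrow> bool"
  where "closed_operator_in E G \<longleftrightarrow> closedin (top_of_set (E \<times> E)) G"

definition closable_operator_in :: "'a::complex_normed_vector set \<Rightarrow> ('a \<times> 'a) set \<Rightarrow> bool"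
  where "closable_operator_in E G \<longleftrightarrow>
    (\<exists>H. linear_operator_in E H \<and> closed_operator_in E H \<and> G \<subseteq> H)"


section \<open>Smooth maps on a subspace of a normed space\<close>

definition bounded_multilinear_on ::
    "'a::real_normed_vector set \<Rightarrow> nat \<Rightarrow> ('a list \<Rightarrow> 'b::real_normed_vector) \<Rightarrow> bool"
  where "bounded_multilinear_on S j M \<longleftrightarrow>
    (\<forall>vs\<in>lists S. length vs = j \<longrightarrow> (\<forall>i<j. \<forall>v\<in>S. \<forall>w\<in>S. \<forall>a b.
      M (vs[i := a *\<^sub>R v + b *\<^sub>R w]) = a *\<^sub>R M (vs[i := v]) + b *\<^sub>R M (vs[i := w]))) \<and>
    (\<exists>C. \<forall>vs\<in>lists S. length vs = j \<longrightarrow> norm (M vs) \<le> C * prod_list (map norm vs))"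

text \<open>\<open>D j x [v\<^sub>1, \<dots>, v\<^sub>j]\<close> is the \<open>j\<close>-th Frechet derivative at \<open>x\<close> in the directions
  \<open>v\<^sub>1, \<dots>, v\<^sub>j\<close>: the map \<open>D (j + 1)\<close> is the Frechet derivative of \<open>D j\<close>, and the top one is
  continuous, both with respect to the operator norm of multilinear maps on the linear subspace
  \<open>S\<close>. Nothing is required of \<open>F\<close> outside \<open>S\<close>.\<close>

definition C_smooth_on ::
    "nat \<Rightarrow> 'a::real_normed_vector set \<Rightarrow> ('a \<Rightarrow> 'b::real_normed_vector) \<Rightarrow> bool"
  where "C_smooth_on m S F \<longleftrightarrow> (\<exists>D :: nat \<Rightarrow> 'a \<Rightarrow> 'a list \<Rightarrow> 'b.
    (\<forall>x\<in>S. D 0 x [] = F x) \<and>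
    (\<forall>j\<le>m. \<forall>x\<in>S. bounded_multilinear_on S j (D j x)) \<and>
    (\<forall>j<m. \<forall>x\<in>S. \<forall>\<epsilon>>0. \<exists>\<delta>>0. \<forall>y\<in>S. norm (y - x) < \<delta> \<longrightarrow>
      (\<forall>vs\<in>lists S. length vs = j \<longrightarrow>
        norm (D j y vs - D j x vs - D (Suc j) x ((y - x) # vs))
          \<le> \<epsilon> * norm (y - x) * prod_list (map norm vs))) \<and>
    (\<forall>x\<in>S. \<forall>\<epsilon>>0. \<exists>\<delta>>0. \<forall>y\<in>S. norm (y - x) < \<delta> \<longrightarrow>
      (\<forall>vs\<in>lists S. length vs = m \<longrightarrow>
        norm (D m y vs - D m x vs) \<le> \<epsilon> * prod_list (map norm vs))))"


section \<open>The delay equation\<close>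

text \<open>\<open>C([-h, 0], 'b)\<close> with the supremum norm: a function on \<open>[-h, 0]\<close> is represented by its
  extension to the real line that is constant on each of the half-lines to the left of \<open>-h\<close> and to
  the right of \<open>0\<close>; this is an isometry.\<close>

definition Xspace :: "real \<Rightarrow> (real \<Rightarrow>\<^sub>C 'b::real_normed_vector) set"
  where "Xspace h = {\<phi> :: real \<Rightarrow>\<^sub>C 'b. \<forall>\<theta>. \<phi> \<theta> = \<phi> (clamp (- h) 0 \<theta>)}"

definition history :: "real \<Rightarrow> (real \<Rightarrow> 'b::real_normed_vector) \<Rightarrow> real \<Rightarrow> (real \<Rightarrow>\<^sub>C 'b)"
  where "history h x t = Bcontfun (\<lambda>\<theta>. x (t + clamp (- h) 0 \<theta>))"

definition solves_delay_eq ::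
    "real \<Rightarrow> ((real \<Rightarrow>\<^sub>C (real^'n)) \<Rightarrow> real^'n) \<Rightarrow> (real \<Rightarrow> real^'n) \<Rightarrow> bool"
  where "solves_delay_eq h F x \<longleftrightarrow>
    (\<forall>t. (x has_vector_derivative F (history h x t)) (at t))"

definition minimal_period :: "(real \<Rightarrow> 'b) \<Rightarrow> real \<Rightarrow> bool"
  where "minimal_period x T \<longleftrightarrow> 0 < T \<and> (\<forall>t. x (t + T) = x t) \<and>
    (\<forall>S. 0 < S \<and> S < T \<longrightarrow> \<not> (\<forall>t. x (t + S) = x t))"

definition complexification ::
    "((real \<Rightarrow>\<^sub>C (real^'n)) \<Rightarrow> real^'n) \<Rightarrow> (real \<Rightarrow>\<^sub>C (complex^'n)) \<Rightarrow> complex^'n"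
  where "complexification M \<phi> =
    (\<chi> i. Complex (M (Bcontfun (\<lambda>\<theta>. \<chi> j. Re (\<phi> \<theta> $ j))) $ i)
                  (M (Bcontfun (\<lambda>\<theta>. \<chi> j. Im (\<phi> \<theta> $ j))) $ i))"

text \<open>\<open>L(\<tau>) = DF(\<gamma>\<^sub>\<tau>)\<close>. The derivative within the subspace \<open>Xspace h\<close> is determined on
  \<open>Xspace h\<close> only, and only its values there are ever used.\<close>

definition linearization ::
    "real \<Rightarrow> ((real \<Rightarrow>\<^sub>C (real^'n)) \<Rightarrow> real^'n) \<Rightarrow> (real \<Rightarrow> real^'n) \<Rightarrow> real
      \<Rightarrow> (real \<Rightarrow>\<^sub>C (complex^'n)) \<Rightarrow> complex^'n"
  where "linearization h F \<gamma> \<tau> =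
    complexification (frechet_derivative F (at (history h \<gamma> \<tau>) within Xspace h))"


section \<open>The generators\<close>

definition Linf_space :: "real \<Rightarrow> 'b::euclidean_space linf set"
  where "Linf_space h = {f. AE \<theta> in lebesgue. \<theta> \<notin> {-h..0} \<longrightarrow> rep_linf f \<theta> = 0}"

text \<open>The norm on the product type is equivalent to the usual maximum or sum norms.\<close>

definition Xsunstar :: "real \<Rightarrow> ((complex^'n) \<times> (complex^'n) linf) set"
  where "Xsunstar h = UNIV \<times> Linf_space h"

text \<open>In the two graphs below, \<open>L\<close> is to be read as \<open>L(\<tau>)\<close>.\<close>

definition A_op ::
    "real \<Rightarrow> ((real \<Rightarrow>\<^sub>C (complex^'n)) \<Rightarrow> complex^'n) \<Rightarrow>
      ((real \<Rightarrow>\<^sub>C (complex^'n)) \<times> (real \<Rightarrow>\<^sub>C (complex^'n))) set"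
  where "A_op h L = {(\<phi>, \<psi>). \<phi> \<in> Xspace h \<and> \<psi> \<in> Xspace h \<and>
    (\<forall>\<theta>\<in>{-h..0}. (apply_bcontfun \<phi> has_vector_derivative \<psi> \<theta>) (at \<theta> within {-h..0})) \<and> \<psi> 0 = L \<phi>}"

text \<open>\<open>A\<^sup>\<odot>\<^sup>\<star>(\<tau>)\<close>: here \<open>u\<close> is the Lipschitz representative of the class \<open>f\<close>, and
  the class \<open>g\<close> is its almost everywhere defined derivative. Since a Lipschitz function on an
  interval is differentiable almost everywhere with essentially bounded derivative, the existence
  of \<open>g\<close> puts no restriction on \<open>f\<close>.\<close>

definition A_sunstar_op ::
    "real \<Rightarrow> ((real \<Rightarrow>\<^sub>C (complex^'n)) \<Rightarrow> complex^'n) \<Rightarrow>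
      (((complex^'n) \<times> (complex^'n) linf) \<times> ((complex^'n) \<times> (complex^'n) linf)) set"
  where "A_sunstar_op h L = {((\<alpha>, f), (\<beta>, g)). f \<in> Linf_space h \<and> g \<in> Linf_space h \<and>
    (\<exists>u\<in>Xspace h. (\<exists>C. C-lipschitz_on {-h..0} (apply_bcontfun u)) \<and>
      (AE \<theta> in lebesgue. \<theta> \<in> {-h..0} \<longrightarrow> rep_linf f \<theta> = u \<theta>) \<and>
      u 0 = \<alpha> \<and> \<beta> = L u \<and>
      (AE \<theta> in lebesgue. \<theta> \<in> {-h..0} \<longrightarrow>
        (apply_bcontfun u has_vector_derivative rep_linf g \<theta>) (at \<theta> within {-h..0})))}"


section \<open>The operators on periodic functions\<close>

definition C_per :: "real \<Rightarrow> 'e::complex_normed_vector set \<Rightarrow> (real \<Rightarrow>\<^sub>C 'e) set"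
  where "C_per T E = {\<phi> :: real \<Rightarrow>\<^sub>C 'e. (\<forall>\<tau>. \<phi> (\<tau> + T) = \<phi> \<tau>) \<and> (\<forall>\<tau>. \<phi> \<tau> \<in> E)}"

definition C1_per :: "real \<Rightarrow> 'e::complex_normed_vector set \<Rightarrow> (real \<Rightarrow>\<^sub>C 'e) set"
  where "C1_per T E = {\<phi> \<in> C_per T E. apply_bcontfun \<phi> C1_differentiable_on UNIV}"

text \<open>The graph of the operator \<open>(\<A> \<phi>)(\<tau>) = A(\<tau>) \<phi>(\<tau>) - \<phi>'(\<tau>)\<close> in \<open>C\<^sub>T(\<real>, E)\<close>, for a
  family of operators \<open>A(\<tau>)\<close> in \<open>E\<close> given by their graphs. As the operator takes values in
  \<open>C\<^sub>T(\<real>, E)\<close>, its domain consists of those \<open>\<phi> \<in> C\<^sub>T\<^sup>1(\<real>, E)\<close> with \<open>\<phi>(\<tau>) \<in> D(A(\<tau>))\<close> for which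
  \<open>\<tau> \<mapsto> A(\<tau>) \<phi>(\<tau>) - \<phi>'(\<tau>)\<close> is continuous.\<close>

definition periodic_op ::
    "real \<Rightarrow> 'e::complex_normed_vector set \<Rightarrow> (real \<Rightarrow> ('e \<times> 'e) set) \<Rightarrow>
      ((real \<Rightarrow>\<^sub>C 'e) \<times> (real \<Rightarrow>\<^sub>C 'e)) set"
  where "periodic_op T E A = {(\<phi>, \<psi>). \<phi> \<in> C1_per T E \<and> \<psi> \<in> C_per T E \<and>
    (\<forall>\<tau>. (\<phi> \<tau>, \<psi> \<tau> + vector_derivative (apply_bcontfun \<phi>) (at \<tau>)) \<in> A \<tau>)}"

end

theory Submission
  imports Defs "HOL-Library.Periodic_Fun" "HOL-Real_Asymp.Real_Asymp"
begin

text \<open>Both operators are transport: \<open>\<A>\<close> maps \<open>\<phi>(\<tau>, \<theta>)\<close> to its \<open>\<theta>\<close>-derivative minus its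
  \<open>\<tau>\<close>-derivative, subject to the boundary condition that the \<open>\<theta>\<close>-derivative at \<open>\<theta> = 0\<close> is
  \<open>L(\<tau>) \<phi>(\<tau>)\<close>. The sun-star operator does the same, with the boundary condition moved into
  its action on the first component.

  They are not closed because the domain asks for both partial derivatives, while the operator controls
  only the derivative along the lines \<open>\<tau> + \<theta> = const\<close>. The function \<open>\<theta> g(\<tau> + \<theta>)\<close> has the image
  \<open>g(\<tau> + \<theta>)\<close>, which makes sense for any continuous \<open>g\<close>. To meet the boundary condition one
  adds \<open>exp (\<rho> * \<theta>)\<close> times the integral of \<open>r\<close> from \<open>\<tau>\<close> to \<open>\<tau> + \<theta>\<close>, with a continuous
  periodic \<open>r\<close>. This term is continuously differentiable for every continuous \<open>r\<close>, and small for large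
  \<open>\<rho>\<close>, so the boundary condition is a fixed point equation for \<open>r\<close> with a contraction
  (\<open>boundary_solution_exists\<close>), and its solution depends Lipschitz continuously on \<open>g\<close>
  (\<open>boundary_solution_stable\<close>). Smooth \<open>g\<close> yield elements of the graph
  (\<open>smooth_wave_in_A_per\<close>). Letting them converge to the square root of \<open>\<bar>sin (\<pi> s / T)\<bar>\<close> gives a limit
  that is not Lipschitz in \<open>\<theta>\<close> (\<open>wave_not_lipschitz\<close>), as membership in either domain would
  require (\<open>A_per_limit\<close>).

  They are closable because there are many bounded functionals \<open>P\<close> for which \<open>P (A(\<tau>) x)\<close> is bounded by a
  multiple of the norm of \<open>x\<close>. For \<open>(\<phi>, \<psi>)\<close> in the graph the integral of \<open>P \<circ> \<psi>\<close> over a bounded interval is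
  then bounded by a multiple of the norm of \<open>\<phi>\<close>, so it vanishes for every \<open>\<psi>\<close> that is a limit of
  images of a null sequence; if the \<open>P\<close> separate points, \<open>\<psi> = 0\<close> (\<open>periodic_op_closable\<close>). For the
  sun-star operator one takes the first component, on which \<open>A(\<tau>)\<close> acts by \<open>L(\<tau>)\<close>, and the integrals
  of the second component over subintervals, which for a derivative are differences of values
  (\<open>lipschitz_FTC\<close>). The embedding \<open>u \<mapsto> (u 0, u)\<close> maps the graph of \<open>\<A>\<close> into that of the sun-star operator
  (\<open>emb_periodic_op\<close>), and the composition of these functionals with it serves for \<open>\<A>\<close>.\<close>

section \<open>Composing bounded continuous functions with bounded linear maps\<close>

definition map_bcontfun :: "('a::real_normed_vector \<Rightarrow> 'b::real_normed_vector) \<Rightarrow>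
    ('c::topological_space \<Rightarrow>\<^sub>C 'a) \<Rightarrow> ('c \<Rightarrow>\<^sub>C 'b)"
  where "map_bcontfun f \<phi> = Bcontfun (\<lambda>x. f (\<phi> x))"

lemma map_bcontfun_apply:
  assumes "bounded_linear f"
  shows "apply_bcontfun (map_bcontfun f \<phi>) x = f (\<phi> x)"
proof -
  obtain K where K: "\<And>x. norm (f x) \<le> norm x * K" "K > 0"
    using bounded_linear.pos_bounded[OF assms] by blast
  have "(\<lambda>x. f (\<phi> x)) \<in> bcontfun"
  proof (rule bcontfun_normI)
    show "continuous_on UNIV (\<lambda>x. f (\<phi> x))"
      by (rule bounded_linear.continuous_on[OF assms]) simp
    show "norm (f (\<phi> x)) \<le> norm \<phi> * K" for x
      using K(1)[of "\<phi> x"] mult_right_mono[OF norm_bounded[of \<phi> x], of K] K(2) by linarith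
  qed
  then show ?thesis by (simp add: map_bcontfun_def Bcontfun_inverse)
qed

lemma bounded_linear_map_bcontfun:
  assumes "bounded_linear f"
  shows "bounded_linear (map_bcontfun f :: ('c::topological_space \<Rightarrow>\<^sub>C 'a::real_normed_vector) \<Rightarrow> 'c \<Rightarrow>\<^sub>C 'b::real_normed_vector)"
proof -
  interpret f: bounded_linear f by fact
  obtain K where K: "\<And>x. norm (f x) \<le> norm x * K" "K > 0"
    using f.pos_bounded by blast
  show ?thesis
  proof (rule bounded_linear_intro[where K = K])
    fix x y :: "'c \<Rightarrow>\<^sub>C 'a" and r :: real
    show "map_bcontfun f (x + y) = map_bcontfun f x + map_bcontfun f y" "map_bcontfun f (r *\<^sub>R x) = r *\<^sub>R map_bcontfun f x"
      by (auto intro!: bcontfun_eqI simp: map_bcontfun_apply[OF assms] f.add f.scaleR)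
    show "norm (map_bcontfun f x) \<le> norm x * K"
    proof (rule norm_bound)
      fix t
      show "norm (apply_bcontfun (map_bcontfun f x) t) \<le> norm x * K"
        using K(1)[of "x t"] mult_right_mono[OF norm_bounded[of x t], of K] K(2)
        unfolding map_bcontfun_apply[OF assms] by linarith
    qed
  qed
qed

section \<open>Closability of the operators on periodic functions\<close>

lemma onorm_scaleR_left_le:
  assumes "norm v \<le> B" shows "onorm (\<lambda>x::real. x *\<^sub>R v) \<le> B"
  by (rule onorm_le) (use assms in \<open>simp add: mult_left_mono mult.commute[of B]\<close>)

lemma csubspace_closure:
  assumes "cvec.subspace (S :: 'a::complex_normed_vector set)"
  shows "cvec.subspace (closure S)"
  unfolding cvec.subspace_def
proof (intro conjI ballI allI)
  show "0 \<in> closure S"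
    using assms closure_subset by (auto simp: cvec.subspace_def)
next
  fix x y assume "x \<in> closure S" "y \<in> closure S"
  then obtain f g where "\<And>n. f n \<in> S" "f \<longlonglongrightarrow> x" "\<And>n. g n \<in> S" "g \<longlonglongrightarrow> y"
    by (metis closure_sequential)
  with assms show "x + y \<in> closure S"
    unfolding closure_sequential
    by (intro exI[of _ "\<lambda>n. f n + g n"]) (auto intro!: tendsto_add simp: cvec.subspace_def)
next
  fix c x assume "x \<in> closure S"
  then obtain f where "\<And>n. f n \<in> S" "f \<longlonglongrightarrow> x"
    by (metis closure_sequential)
  with assms show "c *\<^sub>C x \<in> closure S"
    unfolding closure_sequential
    by (intro exI[of _ "\<lambda>n. c *\<^sub>C f n"])
       (auto intro!: bounded_linear.tendsto[OF scaleC_bounded_linear] simp: cvec.subspace_def)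
qed

lemma csubspace_Times:
  "cvec.subspace A \<Longrightarrow> cvec.subspace B \<Longrightarrow>
    cvec.subspace (A \<times> B :: ('a::complex_normed_vector \<times> 'b::complex_normed_vector) set)"
  by (auto simp: cvec.subspace_def scaleC_prod_def zero_prod_def)

text \<open>The bound of \<open>b i y\<close> by a multiple of the norm of \<open>x\<close> is a closed condition, so it passes from the
  graph to its closure. At \<open>x = 0\<close> it makes every \<open>b i\<close> vanish on \<open>y\<close>, and the functionals separate:
  the closure of the graph is again a graph.\<close>

lemma closable_operator_inI:
  fixes G :: "('a::complex_normed_vector \<times> 'a) set"
    and b :: "'i \<Rightarrow> 'a \<Rightarrow> 'b::real_normed_vector"
  assumes E: "cvec.subspace E" and G: "cvec.subspace G" "G \<subseteq> E \<times> E"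
    and cont: "\<And>i. i \<in> I \<Longrightarrow> continuous_on UNIV (b i)"
    and est: "\<And>i. i \<in> I \<Longrightarrow> \<exists>K. \<forall>x y. (x, y) \<in> G \<longrightarrow> norm (b i y) \<le> K * norm x"
    and sep: "\<And>y. y \<in> E \<Longrightarrow> (\<And>i. i \<in> I \<Longrightarrow> b i y = 0) \<Longrightarrow> y = 0"
  shows "closable_operator_in E G"
proof -
  define H where "H = (E \<times> E) \<inter> closure G"
  have H: "cvec.subspace H"
    unfolding H_def by (intro cvec.subspace_inter csubspace_closure csubspace_Times E G)
  have single: "y = 0" if "(0, y) \<in> H" for y
  proof (rule sep)
    show "y \<in> E" using that by (simp add: H_def)
    fix i assume i: "i \<in> I"
    obtain K where K: "\<And>x y. (x, y) \<in> G \<Longrightarrow> norm (b i y) \<le> K * norm x"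
      using est[OF i] by blast
    have cl: "closed {p. norm (b i (snd p)) \<le> K * norm (fst p)}"
      by (intro closed_Collect_le continuous_intros continuous_on_compose2[OF cont[OF i]]) auto
    have "closure G \<subseteq> {p. norm (b i (snd p)) \<le> K * norm (fst p)}"
      by (rule closure_minimal) (use K cl in auto)
    with that show "b i y = 0" by (auto simp: H_def)
  qed
  have "single_valued H"
  proof (rule single_valuedI)
    fix x y z assume "(x, y) \<in> H" "(x, z) \<in> H"
    then have "(x, y) - (x, z) \<in> H" using cvec.subspace_diff[OF H] by blast
    with single[of "y - z"] show "y = z" by simp
  qed
  then show ?thesis
    unfolding closable_operator_in_def linear_operator_in_def closed_operator_in_def
    using H G(2) closure_subset[of G]
    by (intro exI[of _ H]) (auto simp: H_def closedin_closed)
qed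

lemma csubspace_C_per:
  assumes "cvec.subspace E" shows "cvec.subspace (C_per T E)"
  using assms by (auto simp: cvec.subspace_def C_per_def)

lemma C1_per_derivative:
  assumes "\<phi> \<in> C1_per T E"
  shows "(apply_bcontfun \<phi> has_vector_derivative vector_derivative \<phi> (at t)) (at t)"
    and "continuous_on UNIV (\<lambda>t. vector_derivative \<phi> (at t))"
  using assms
  by (auto simp: C1_per_def C1_differentiable_on_eq vector_derivative_works[symmetric])

lemma C1_perI:
  assumes "\<phi> \<in> C_per T E"
    and "\<And>t. (apply_bcontfun \<phi> has_vector_derivative D t) (at t)" "continuous_on UNIV D"
  shows "\<phi> \<in> C1_per T E"
  using assms by (auto simp: C1_per_def C1_differentiable_on_def)

lemma periodic_op_iff:
  "(\<phi>, \<psi>) \<in> periodic_op T E A \<longleftrightarrow> \<phi> \<in> C_per T E \<and> \<psi> \<in> C_per T E \<and>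
    (\<exists>D. continuous_on UNIV D \<and> (\<forall>\<tau>. (apply_bcontfun \<phi> has_vector_derivative D \<tau>) (at \<tau>) \<and>
      (\<phi> \<tau>, \<psi> \<tau> + D \<tau>) \<in> A \<tau>))" (is "?l \<longleftrightarrow> ?r")
proof
  assume ?l
  then have "\<phi> \<in> C1_per T E" "\<psi> \<in> C_per T E"
    "\<And>\<tau>. (\<phi> \<tau>, \<psi> \<tau> + vector_derivative \<phi> (at \<tau>)) \<in> A \<tau>"
    by (auto simp: periodic_op_def)
  with C1_per_derivative[of \<phi> T E] show ?r
    by (auto simp: C1_per_def intro!: exI[of _ "\<lambda>t. vector_derivative \<phi> (at t)"])
next
  assume r: ?r
  then obtain D where D: "continuous_on UNIV D"
    "\<And>\<tau>. (apply_bcontfun \<phi> has_vector_derivative D \<tau>) (at \<tau>)" "\<And>\<tau>. (\<phi> \<tau>, \<psi> \<tau> + D \<tau>) \<in> A \<tau>"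
    by blast
  have "vector_derivative \<phi> (at \<tau>) = D \<tau>" for \<tau>
    using D(2) by (rule vector_derivative_at)
  then show ?l using r D C1_perI[of \<phi> T E D] by (auto simp: periodic_op_def)
qed

lemma csubspace_periodic_op:
  assumes E: "cvec.subspace E" and A: "\<And>\<tau>. cvec.subspace (A \<tau>)"
  shows "cvec.subspace (periodic_op T E A)"
proof -
  note C = csubspace_C_per[OF E, of T]
  show ?thesis
    unfolding cvec.subspace_def
  proof (intro conjI ballI allI)
    have "(0, 0) \<in> periodic_op T E A"
      unfolding periodic_op_iff using cvec.subspace_0[OF C] cvec.subspace_0[OF A]
      by (auto intro!: exI[of _ "\<lambda>_. 0"] derivative_eq_intros simp: zero_prod_def)
    then show "0 \<in> periodic_op T E A" by (simp add: zero_prod_def)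
  next
    fix p q assume pq: "p \<in> periodic_op T E A" "q \<in> periodic_op T E A"
    obtain \<phi> \<psi> \<phi>' \<psi>' where eq: "p = (\<phi>, \<psi>)" "q = (\<phi>', \<psi>')" by force
    from pq obtain D D' where D: "continuous_on UNIV D"
      "\<And>\<tau>. (apply_bcontfun \<phi> has_vector_derivative D \<tau>) (at \<tau>)" "\<And>\<tau>. (\<phi> \<tau>, \<psi> \<tau> + D \<tau>) \<in> A \<tau>"
      and D': "continuous_on UNIV D'"
      "\<And>\<tau>. (apply_bcontfun \<phi>' has_vector_derivative D' \<tau>) (at \<tau>)" "\<And>\<tau>. (\<phi>' \<tau>, \<psi>' \<tau> + D' \<tau>) \<in> A \<tau>"
      and in_C: "\<phi> \<in> C_per T E" "\<psi> \<in> C_per T E" "\<phi>' \<in> C_per T E" "\<psi>' \<in> C_per T E"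
      unfolding eq periodic_op_iff by blast
    have "(\<phi> \<tau> + \<phi>' \<tau>, (\<psi> \<tau> + \<psi>' \<tau>) + (D \<tau> + D' \<tau>)) \<in> A \<tau>" for \<tau>
      using cvec.subspace_add[OF A D(3) D'(3), of \<tau>] by (simp add: algebra_simps)
    then show "p + q \<in> periodic_op T E A"
      unfolding eq add_Pair periodic_op_iff
      using in_C D(1,2) D'(1,2) cvec.subspace_add[OF C]
      by (auto intro!: exI[of _ "\<lambda>t. D t + D' t"] continuous_intros has_vector_derivative_add)
  next
    fix p c assume p: "p \<in> periodic_op T E A"
    obtain \<phi> \<psi> where eq: "p = (\<phi>, \<psi>)" by force
    from p obtain D where D: "continuous_on UNIV D"
      "\<And>\<tau>. (apply_bcontfun \<phi> has_vector_derivative D \<tau>) (at \<tau>)" "\<And>\<tau>. (\<phi> \<tau>, \<psi> \<tau> + D \<tau>) \<in> A \<tau>"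
      and in_C: "\<phi> \<in> C_per T E" "\<psi> \<in> C_per T E"
      unfolding eq periodic_op_iff by blast
    have "(c *\<^sub>C \<phi> \<tau>, c *\<^sub>C \<psi> \<tau> + c *\<^sub>C D \<tau>) \<in> A \<tau>" for \<tau>
      using cvec.subspace_scale[OF A D(3), of c] by (simp add: scaleC_prod_def scaleC_add_right)
    moreover have "apply_bcontfun (c *\<^sub>C \<phi>) = (\<lambda>t. c *\<^sub>C \<phi> t)" by (rule ext) simp
    ultimately show "c *\<^sub>C p \<in> periodic_op T E A"
      unfolding eq scaleC_prod_def fst_conv snd_conv periodic_op_iff
      using in_C D(1,2) cvec.subspace_scale[OF C]
      by (auto intro!: exI[of _ "\<lambda>t. c *\<^sub>C D t"]
          bounded_linear.has_vector_derivative[OF scaleC_bounded_linear]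
          bounded_linear.continuous_on[OF scaleC_bounded_linear])
  qed
qed

text \<open>For \<open>(\<phi>, \<psi>)\<close> in the graph, \<open>P (\<psi> \<tau>)\<close> is the difference of \<open>P (A(\<tau>) (\<phi> \<tau>))\<close> and
  the derivative of \<open>P \<circ> \<phi>\<close>. The first term is bounded by hypothesis although \<open>A(\<tau>)\<close> is
  unbounded, and the second one integrates to boundary values.\<close>

lemma periodic_op_functional_estimate:
  fixes P :: "'e::complex_normed_vector \<Rightarrow> 'v::banach"
  assumes P: "bounded_linear P" and K: "\<And>\<tau> x y. (x, y) \<in> A \<tau> \<Longrightarrow> norm (P y) \<le> K * norm x"
    and mem: "(\<phi>, \<psi>) \<in> periodic_op T E A" and ab: "a \<le> b" and K0: "0 \<le> K"
  shows "norm (integral {a..b} (\<lambda>\<tau>. P (\<psi> \<tau>)))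
    \<le> (onorm P * 2 + K * (b - a)) * norm \<phi>"
proof -
  obtain D where D: "\<And>\<tau>. (apply_bcontfun \<phi> has_vector_derivative D \<tau>) (at \<tau>)"
    "\<And>\<tau>. (\<phi> \<tau>, \<psi> \<tau> + D \<tau>) \<in> A \<tau>"
    using mem unfolding periodic_op_iff by blast
  define q where "q \<tau> = integral {a..\<tau>} (\<lambda>\<tau>. P (\<psi> \<tau>)) + P (\<phi> \<tau>)" for \<tau>
  have q: "(q has_vector_derivative P (\<psi> \<tau> + D \<tau>)) (at \<tau> within {a..b})" if "\<tau> \<in> {a..b}" for \<tau>
    unfolding q_def linear_add[OF bounded_linear.linear[OF P]]
    by (intro has_vector_derivative_add integral_has_vector_derivative that
        bounded_linear.has_vector_derivative[OF P] bounded_linear.continuous_on[OF P]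
        has_vector_derivative_at_within[OF D(1)]) simp
  have "norm (q b - q a) \<le> (K * norm \<phi>) * norm (b - a)"
  proof (rule differentiable_bound[of "{a..b}" q "\<lambda>\<tau> t. t *\<^sub>R P (\<psi> \<tau> + D \<tau>)"])
    fix \<tau> assume "\<tau> \<in> {a..b}"
    then show "(q has_derivative (\<lambda>t. t *\<^sub>R P (\<psi> \<tau> + D \<tau>))) (at \<tau> within {a..b})"
      using q by (simp add: has_vector_derivative_def)
    have "norm (P (\<psi> \<tau> + D \<tau>)) \<le> K * norm \<phi>"
      using K[OF D(2)[of \<tau>]] mult_left_mono[OF norm_bounded[of \<phi> \<tau>] K0] by linarith
    then show "onorm (\<lambda>t. t *\<^sub>R P (\<psi> \<tau> + D \<tau>)) \<le> K * norm \<phi>"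
      by (rule onorm_scaleR_left_le)
  qed (use ab in auto)
  moreover have "integral {a..b} (\<lambda>\<tau>. P (\<psi> \<tau>)) = (q b - q a) - P (\<phi> b) + P (\<phi> a)"
    by (simp add: q_def)
  moreover have "norm (P (\<phi> \<tau>)) \<le> onorm P * norm \<phi>" for \<tau>
    using onorm[OF P, of "\<phi> \<tau>"] mult_left_mono[OF norm_bounded[of \<phi> \<tau>] onorm_pos_le[OF P]]
    by linarith
  then have "norm (P (\<phi> a)) \<le> onorm P * norm \<phi>" "norm (P (\<phi> b)) \<le> onorm P * norm \<phi>" by blast+
  moreover have "norm ((q b - q a) - P (\<phi> b) + P (\<phi> a))
      \<le> norm (q b - q a) + norm (P (\<phi> b)) + norm (P (\<phi> a))"
    by (meson norm_triangle_ineq norm_triangle_ineq4 add_right_mono order_trans)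
  ultimately have "norm (integral {a..b} (\<lambda>\<tau>. P (\<psi> \<tau>)))
      \<le> (K * norm \<phi>) * norm (b - a) + onorm P * norm \<phi> + onorm P * norm \<phi>"
    by (simp only:)
  then show ?thesis using ab by (simp add: algebra_simps)
qed

lemma integral_zero_imp_zero:
  fixes f :: "real \<Rightarrow> 'v::banach"
  assumes f: "continuous_on UNIV f" and z: "\<And>a b. a \<le> b \<Longrightarrow> integral {a..b} f = 0"
  shows "f x = 0"
proof -
  have "((\<lambda>u. integral {x..u} f) has_vector_derivative f x) (at x within {x..x + 1})"
    by (rule integral_has_vector_derivative) (auto intro: continuous_on_subset[OF f])
  then have "((\<lambda>u. 0) has_vector_derivative f x) (at x within {x..x + 1})"
    by (rule has_vector_derivative_transform[rotated 2]) (auto simp: z)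
  moreover have "((\<lambda>u. 0) has_vector_derivative (0 :: 'v)) (at x within {x..x + 1})"
    by (auto intro!: derivative_eq_intros)
  ultimately show ?thesis
    by (intro vector_derivative_unique_within_closed_interval[of x "x + 1" x "\<lambda>u. 0"]) auto
qed

text \<open>The functionals in \<open>Ps\<close> play the part of elements of the domain of the adjoint of every \<open>A(\<tau>)\<close>,
  with a bound that is uniform in \<open>\<tau>\<close>. If there are enough of them to separate points, the
  means of \<open>P \<circ> \<psi>\<close> over intervals separate points of the space of periodic functions.\<close>

lemma periodic_op_closable:
  fixes Ps :: "('e::complex_normed_vector \<Rightarrow> 'v::banach) set"
  assumes E: "cvec.subspace E" and A: "\<And>\<tau>. cvec.subspace (A \<tau>)"
    and lin: "\<And>P. P \<in> Ps \<Longrightarrow> bounded_linear P"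
    and est: "\<And>P. P \<in> Ps \<Longrightarrow> \<exists>K. \<forall>\<tau> x y. (x, y) \<in> A \<tau> \<longrightarrow> norm (P y) \<le> K * norm x"
    and sep: "\<And>y. y \<in> E \<Longrightarrow> (\<And>P. P \<in> Ps \<Longrightarrow> P y = 0) \<Longrightarrow> y = 0"
  shows "closable_operator_in (C_per T E) (periodic_op T E A)"
proof (rule closable_operator_inI[where I = "{(P, a, b). P \<in> Ps \<and> a \<le> (b::real)}"
      and b = "\<lambda>(P, a, b) \<psi>. integral {a..b} (\<lambda>\<tau>. P (apply_bcontfun \<psi> \<tau>))"])
  show "cvec.subspace (C_per T E)" "cvec.subspace (periodic_op T E A)"
    using E A by (simp_all add: csubspace_C_per csubspace_periodic_op)
  show "periodic_op T E A \<subseteq> C_per T E \<times> C_per T E"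
    by (auto simp: periodic_op_iff)
next
  fix i :: "('e \<Rightarrow> 'v) \<times> real \<times> real" assume "i \<in> {(P, a, b). P \<in> Ps \<and> a \<le> b}"
  then obtain P a b where i: "i = (P, a, b)" "P \<in> Ps" "a \<le> b" by auto
  note P = lin[OF i(2)]
  have int: "(\<lambda>\<tau>. P (apply_bcontfun \<psi> \<tau>)) integrable_on {a..b}" for \<psi> :: "real \<Rightarrow>\<^sub>C 'e"
    by (intro integrable_continuous_interval bounded_linear.continuous_on[OF P]) simp
  have bl: "bounded_linear (\<lambda>\<psi> :: real \<Rightarrow>\<^sub>C 'e. integral {a..b} (\<lambda>\<tau>. P (apply_bcontfun \<psi> \<tau>)))"
  proof (rule bounded_linear_intro[where K = "onorm P * (b - a)"])
    fix x y :: "real \<Rightarrow>\<^sub>C 'e" and r :: real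
    show "integral {a..b} (\<lambda>\<tau>. P ((x + y) \<tau>)) = integral {a..b} (\<lambda>\<tau>. P (x \<tau>)) + integral {a..b} (\<lambda>\<tau>. P (y \<tau>))"
      by (simp add: linear_add[OF bounded_linear.linear[OF P]] integral_add int)
    show "integral {a..b} (\<lambda>\<tau>. P ((r *\<^sub>R x) \<tau>)) = r *\<^sub>R integral {a..b} (\<lambda>\<tau>. P (x \<tau>))"
      by (simp add: linear_scale[OF bounded_linear.linear[OF P]])
    have "norm (integral {a..b} (\<lambda>\<tau>. P (x \<tau>))) \<le> (onorm P * norm x) * (b - a)"
    proof (rule integral_bound[OF i(3)])
      show "continuous_on {a..b} (\<lambda>\<tau>. P (x \<tau>))"
        by (intro bounded_linear.continuous_on[OF P]) simp
      show "norm (P (x t)) \<le> onorm P * norm x" for t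
        using onorm[OF P, of "x t"] mult_left_mono[OF norm_bounded[of x t] onorm_pos_le[OF P]]
        by linarith
    qed
    then show "norm (integral {a..b} (\<lambda>\<tau>. P (x \<tau>))) \<le> norm x * (onorm P * (b - a))"
      by (simp add: mult_ac)
  qed
  then show "continuous_on UNIV ((\<lambda>(P, a, b) \<psi>. integral {a..b} (\<lambda>\<tau>. P (apply_bcontfun \<psi> \<tau>))) i)"
    by (simp add: i(1) linear_continuous_on)
  obtain K where "\<And>\<tau> x y. (x, y) \<in> A \<tau> \<Longrightarrow> norm (P y) \<le> K * norm x"
    using est[OF i(2)] by blast
  then have K: "norm (P y) \<le> max K 0 * norm x" if "(x, y) \<in> A \<tau>" for \<tau> x y
    by (meson that max.cobounded1 mult_right_mono norm_ge_zero order_trans)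
  show "\<exists>K. \<forall>x y. (x, y) \<in> periodic_op T E A \<longrightarrow>
      norm ((\<lambda>(P, a, b) \<psi>. integral {a..b} (\<lambda>\<tau>. P (apply_bcontfun \<psi> \<tau>))) i y) \<le> K * norm x"
    unfolding i(1) split using periodic_op_functional_estimate[OF P K _ i(3)]
    by (intro exI[of _ "onorm P * 2 + max K 0 * (b - a)"]) auto
next
  fix \<psi> :: "real \<Rightarrow>\<^sub>C 'e" assume \<psi>: "\<psi> \<in> C_per T E"
    and z: "\<And>i. i \<in> {(P, a, b). P \<in> Ps \<and> a \<le> b} \<Longrightarrow>
      (\<lambda>(P, a, b) \<psi>. integral {a..b} (\<lambda>\<tau>. P (apply_bcontfun \<psi> \<tau>))) i \<psi> = 0"
  show "\<psi> = 0"
  proof (rule bcontfun_eqI)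
    fix \<tau>
    have "\<psi> \<tau> = 0"
    proof (rule sep)
      show "\<psi> \<tau> \<in> E" using \<psi> by (simp add: C_per_def)
      fix P assume P: "P \<in> Ps"
      show "P (\<psi> \<tau>) = 0"
      proof (rule integral_zero_imp_zero[of "\<lambda>\<tau>. P (\<psi> \<tau>)"])
        show "continuous_on UNIV (\<lambda>\<tau>. P (\<psi> \<tau>))"
          by (intro bounded_linear.continuous_on[OF lin[OF P]]) simp
      qed (use z P in force)
    qed
    then show "\<psi> \<tau> = apply_bcontfun 0 \<tau>" by simp
  qed
qed

section \<open>Complex linearity of the spaces and of the generators\<close>

lemma clamp_real: "a \<le> b \<Longrightarrow> clamp a b x = max a (min x b)" for x :: real
  by (simp add: clamp_def max_def min_def)

lemma Xspace_eqI:
  assumes h: "0 < h" and u: "u \<in> Xspace h" "v \<in> Xspace h"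
    and eq: "\<And>\<theta>. \<theta> \<in> {-h..0} \<Longrightarrow> apply_bcontfun u \<theta> = apply_bcontfun v \<theta>"
  shows "u = v"
proof (rule bcontfun_eqI)
  fix \<theta>
  have "clamp (- h) 0 \<theta> \<in> {-h..0}" using h by (auto simp: clamp_real)
  then show "apply_bcontfun u \<theta> = apply_bcontfun v \<theta>"
    using u eq unfolding Xspace_def by (metis (mono_tags, lifting) mem_Collect_eq)
qed

lemma csubspace_Xspace: "cvec.subspace (Xspace h :: (real \<Rightarrow>\<^sub>C 'b::complex_normed_vector) set)"
  unfolding cvec.subspace_def Xspace_def
  by (auto; metis)

lemma csubspace_Linf_space:
  "cvec.subspace (Linf_space h :: ('b::complex_euclidean_space) linf set)"
  unfolding cvec.subspace_def Linf_space_def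
proof (intro conjI ballI allI CollectI)
  show "AE \<theta> in lebesgue. \<theta> \<notin> {-h..0} \<longrightarrow> rep_linf (0 :: 'b linf) \<theta> = 0"
    using rep_zero_linf[where 'a = 'b] by eventually_elim simp
next
  fix f g :: "'b linf"
  assume "f \<in> {f. AE \<theta> in lebesgue. \<theta> \<notin> {-h..0} \<longrightarrow> rep_linf f \<theta> = 0}"
    "g \<in> {f. AE \<theta> in lebesgue. \<theta> \<notin> {-h..0} \<longrightarrow> rep_linf f \<theta> = 0}"
  then have "AE \<theta> in lebesgue. \<theta> \<notin> {-h..0} \<longrightarrow> rep_linf f \<theta> = 0"
    "AE \<theta> in lebesgue. \<theta> \<notin> {-h..0} \<longrightarrow> rep_linf g \<theta> = 0" by auto
  then show "AE \<theta> in lebesgue. \<theta> \<notin> {-h..0} \<longrightarrow> rep_linf (f + g) \<theta> = 0"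
    using rep_plus_linf[of f g] by eventually_elim auto
next
  fix f :: "'b linf" and c :: complex
  assume "f \<in> {f. AE \<theta> in lebesgue. \<theta> \<notin> {-h..0} \<longrightarrow> rep_linf f \<theta> = 0}"
  then have "AE \<theta> in lebesgue. \<theta> \<notin> {-h..0} \<longrightarrow> rep_linf f \<theta> = 0" by auto
  then show "AE \<theta> in lebesgue. \<theta> \<notin> {-h..0} \<longrightarrow> rep_linf (c *\<^sub>C f) \<theta> = 0"
    using rep_scaleC_linf[of c f] by eventually_elim auto
qed

lemma csubspace_Xsunstar: "cvec.subspace (Xsunstar h :: ((complex^'n) \<times> (complex^'n) linf) set)"
  unfolding Xsunstar_def by (intro csubspace_Times csubspace_Linf_space cvec.subspace_UNIV)

lemma csubspace_A_op:
  fixes L :: "(real \<Rightarrow>\<^sub>C (complex^'n)) \<Rightarrow> complex^'n"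
  assumes add: "\<And>u v. u \<in> Xspace h \<Longrightarrow> v \<in> Xspace h \<Longrightarrow> L (u + v) = L u + L v"
    and scale: "\<And>c u. u \<in> Xspace h \<Longrightarrow> L (c *\<^sub>C u) = c *\<^sub>C L u"
  shows "cvec.subspace (A_op h L)"
proof -
  note X = csubspace_Xspace[where 'b = "complex^'n", of h]
  have L0: "L 0 = 0" using scale[of 0 0] cvec.subspace_0[OF X] by simp
  have ap: "apply_bcontfun (c *\<^sub>C u) = (\<lambda>t. c *\<^sub>C u t)" for c and u :: "real \<Rightarrow>\<^sub>C (complex^'n)"
    by (rule ext) simp
  show ?thesis
    unfolding cvec.subspace_def A_op_def
    using cvec.subspace_0[OF X] cvec.subspace_add[OF X] cvec.subspace_scale[OF X]
    by (auto simp: zero_prod_def scaleC_prod_def L0 add scale ap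
        intro!: derivative_eq_intros bounded_linear.has_vector_derivative[OF scaleC_bounded_linear])
qed

lemma csubspace_A_sunstar_op:
  fixes L :: "(real \<Rightarrow>\<^sub>C (complex^'n)) \<Rightarrow> complex^'n"
  assumes add: "\<And>u v. u \<in> Xspace h \<Longrightarrow> v \<in> Xspace h \<Longrightarrow> L (u + v) = L u + L v"
    and scale: "\<And>c u. u \<in> Xspace h \<Longrightarrow> L (c *\<^sub>C u) = c *\<^sub>C L u"
  shows "cvec.subspace (A_sunstar_op h L)"
proof -
  note X = csubspace_Xspace[where 'b = "complex^'n", of h]
  note Li = csubspace_Linf_space[where 'b = "complex^'n", of h]
  have L0: "L 0 = 0" using scale[of 0 0] cvec.subspace_0[OF X] by simp
  show ?thesis
    unfolding cvec.subspace_def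
  proof (intro conjI ballI allI)
    have "((0, 0), (0, 0)) \<in> A_sunstar_op h L"
      unfolding A_sunstar_op_def
      using cvec.subspace_0[OF X] cvec.subspace_0[OF Li] rep_zero_linf[where 'a = "complex^'n"]
      by (auto intro!: bexI[of _ 0] exI[of _ 0] lipschitz_intros simp: L0
          intro: has_vector_derivative_const elim!: eventually_mono)
    then show "0 \<in> A_sunstar_op h L" by (simp add: zero_prod_def)
  next
    fix p q assume pq: "p \<in> A_sunstar_op h L" "q \<in> A_sunstar_op h L"
    obtain \<alpha> f \<beta> g \<alpha>' f' \<beta>' g' where eq: "p = ((\<alpha>, f), (\<beta>, g))" "q = ((\<alpha>', f'), (\<beta>', g'))"
      by (metis surj_pair)
    obtain u C where u: "u \<in> Xspace h" "C-lipschitz_on {-h..0} (apply_bcontfun u)"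
      "u 0 = \<alpha>" "\<beta> = L u" "f \<in> Linf_space h" "g \<in> Linf_space h"
      and f: "AE \<theta> in lebesgue. \<theta> \<in> {-h..0} \<longrightarrow> rep_linf f \<theta> = u \<theta>"
      and g: "AE \<theta> in lebesgue. \<theta> \<in> {-h..0} \<longrightarrow>
        (apply_bcontfun u has_vector_derivative rep_linf g \<theta>) (at \<theta> within {-h..0})"
      using pq(1) unfolding eq A_sunstar_op_def by auto
    obtain u' C' where u': "u' \<in> Xspace h" "C'-lipschitz_on {-h..0} (apply_bcontfun u')"
      "u' 0 = \<alpha>'" "\<beta>' = L u'" "f' \<in> Linf_space h" "g' \<in> Linf_space h"
      and f': "AE \<theta> in lebesgue. \<theta> \<in> {-h..0} \<longrightarrow> rep_linf f' \<theta> = u' \<theta>"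
      and g': "AE \<theta> in lebesgue. \<theta> \<in> {-h..0} \<longrightarrow>
        (apply_bcontfun u' has_vector_derivative rep_linf g' \<theta>) (at \<theta> within {-h..0})"
      using pq(2) unfolding eq A_sunstar_op_def by auto
    have "AE \<theta> in lebesgue. \<theta> \<in> {-h..0} \<longrightarrow> rep_linf (f + f') \<theta> = (u + u') \<theta>"
      using f f' rep_plus_linf[of f f'] by eventually_elim auto
    moreover have "AE \<theta> in lebesgue. \<theta> \<in> {-h..0} \<longrightarrow>
        (apply_bcontfun (u + u') has_vector_derivative rep_linf (g + g') \<theta>) (at \<theta> within {-h..0})"
      using g g' rep_plus_linf[of g g']
      by eventually_elim (auto intro!: has_vector_derivative_add)
    moreover have "(C + C')-lipschitz_on {-h..0} (apply_bcontfun (u + u'))"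
      using lipschitz_on_add[OF u(2) u'(2)] by simp
    ultimately show "p + q \<in> A_sunstar_op h L"
      unfolding eq add_Pair A_sunstar_op_def
      using u u' cvec.subspace_add[OF X u(1) u'(1)] cvec.subspace_add[OF Li u(5) u'(5)]
        cvec.subspace_add[OF Li u(6) u'(6)] add[OF u(1) u'(1)]
      by (auto intro!: bexI[of _ "u + u'"])
  next
    fix p c assume p: "p \<in> A_sunstar_op h L"
    obtain \<alpha> f \<beta> g where eq: "p = ((\<alpha>, f), (\<beta>, g))" by (metis surj_pair)
    obtain u C where u: "u \<in> Xspace h" "C-lipschitz_on {-h..0} (apply_bcontfun u)"
      "u 0 = \<alpha>" "\<beta> = L u" "f \<in> Linf_space h" "g \<in> Linf_space h"
      and f: "AE \<theta> in lebesgue. \<theta> \<in> {-h..0} \<longrightarrow> rep_linf f \<theta> = u \<theta>"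
      and g: "AE \<theta> in lebesgue. \<theta> \<in> {-h..0} \<longrightarrow>
        (apply_bcontfun u has_vector_derivative rep_linf g \<theta>) (at \<theta> within {-h..0})"
      using p unfolding eq A_sunstar_op_def by auto
    have ap: "apply_bcontfun (c *\<^sub>C u) = (\<lambda>t. c *\<^sub>C u t)" by (rule ext) simp
    have "AE \<theta> in lebesgue. \<theta> \<in> {-h..0} \<longrightarrow> rep_linf (c *\<^sub>C f) \<theta> = (c *\<^sub>C u) \<theta>"
      using f rep_scaleC_linf[of c f] by eventually_elim auto
    moreover have "AE \<theta> in lebesgue. \<theta> \<in> {-h..0} \<longrightarrow>
        (apply_bcontfun (c *\<^sub>C u) has_vector_derivative rep_linf (c *\<^sub>C g) \<theta>) (at \<theta> within {-h..0})"
      using g rep_scaleC_linf[of c g] unfolding ap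
      by eventually_elim
        (auto intro!: bounded_linear.has_vector_derivative[OF scaleC_bounded_linear])
    moreover have "(cmod c * C)-lipschitz_on {-h..0} (apply_bcontfun (c *\<^sub>C u))"
    proof (rule lipschitz_onI)
      show "0 \<le> cmod c * C" using lipschitz_on_nonneg[OF u(2)] by simp
      fix x y assume "x \<in> {-h..0}" "y \<in> {-h..0}"
      then show "dist ((c *\<^sub>C u) x) ((c *\<^sub>C u) y) \<le> cmod c * C * dist x y"
        using mult_left_mono[OF lipschitz_onD[OF u(2)], of x y "cmod c"]
        by (simp add: dist_norm cvec.scale_right_diff_distrib[symmetric] norm_scaleC mult.assoc)
    qed
    ultimately show "c *\<^sub>C p \<in> A_sunstar_op h L"
      unfolding eq scaleC_prod_def fst_conv snd_conv A_sunstar_op_def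
      using u cvec.subspace_scale[OF X u(1), of c] cvec.subspace_scale[OF Li u(5), of c]
        cvec.subspace_scale[OF Li u(6), of c] scale[OF u(1)]
      by (auto intro!: bexI[of _ "c *\<^sub>C u"])
  qed
qed

section \<open>The fundamental theorem of calculus for Lipschitz functions\<close>

lemma has_vector_derivative_sequentially:
  assumes "(u has_vector_derivative D) (at t)"
  shows "(\<lambda>k. real (Suc k) *\<^sub>R (u (t + inverse (real (Suc k))) - u t)) \<longlonglongrightarrow> D"
proof -
  have *: "((\<lambda>s. norm (u (t + s) - u t - s *\<^sub>R D) / norm s) \<longlongrightarrow> 0) (at 0)"
    using assms by (simp add: has_vector_derivative_def has_derivative_at)
  have "filterlim (\<lambda>k. inverse (real (Suc k))) (at 0) sequentially"
    using LIMSEQ_inverse_real_of_nat by (auto simp: filterlim_at)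
  from filterlim_compose[OF * this]
  have "(\<lambda>k. norm (u (t + inverse (real (Suc k))) - u t - inverse (real (Suc k)) *\<^sub>R D)
      / norm (inverse (real (Suc k)))) \<longlonglongrightarrow> 0" .
  moreover have "norm (u (t + inverse (real (Suc k))) - u t - inverse (real (Suc k)) *\<^sub>R D)
      / norm (inverse (real (Suc k)))
      = norm (real (Suc k) *\<^sub>R (u (t + inverse (real (Suc k))) - u t) - D)" for k
  proof -
    have "real (Suc k) *\<^sub>R (u (t + inverse (real (Suc k))) - u t) - D
      = real (Suc k) *\<^sub>R (u (t + inverse (real (Suc k))) - u t - inverse (real (Suc k)) *\<^sub>R D)"
      by (simp add: scaleR_diff_right)
    also have "norm \<dots> = norm (u (t + inverse (real (Suc k))) - u t - inverse (real (Suc k)) *\<^sub>R D)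
      / norm (inverse (real (Suc k)))"
      by (simp add: divide_inverse)
    finally show ?thesis by simp
  qed
  ultimately show ?thesis
    by (simp add: tendsto_norm_zero_iff LIM_zero_iff)
qed

lemma continuous_antiderivative:
  fixes f :: "real \<Rightarrow> 'v::euclidean_space"
  assumes "continuous_on UNIV f"
  obtains U where "\<And>t. (U has_vector_derivative f t) (at t)"
proof -
  have "\<exists>U. \<forall>x :: real. - \<infinity> < ereal x \<longrightarrow> ereal x < \<infinity> \<longrightarrow> (U has_vector_derivative f x) (at x)"
    by (rule einterval_antiderivative) (use assms in \<open>auto simp: continuous_on_eq_continuous_at\<close>)
  then show ?thesis using that by auto
qed

text \<open>The difference quotients of \<open>u\<close> are bounded by the Lipschitz constant, so their integrals
  converge to the integral of the derivative. The integral of a difference quotient of \<open>u\<close> is the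
  difference of two difference quotients of a primitive \<open>U\<close>, which tend to \<open>u y\<close> and \<open>u x\<close>.\<close>

lemma lipschitz_FTC:
  fixes u :: "real \<Rightarrow> 'v::euclidean_space"
  assumes lip: "C-lipschitz_on UNIV u" and N: "negligible N" and xy: "x \<le> y"
    and der: "\<And>t. t \<in> {x..y} - N \<Longrightarrow> (u has_vector_derivative g t) (at t)"
  shows "(g has_integral u y - u x) {x..y}"
proof -
  obtain U where U: "\<And>t. (U has_vector_derivative u t) (at t)"
    using continuous_antiderivative[of u] lipschitz_on_continuous_on[OF lip] by blast
  let ?d = "\<lambda>k. inverse (real (Suc k))"
  define f where "f k t = real (Suc k) *\<^sub>R (u (t + ?d k) - u t)" for k t
  define V where "V k t = real (Suc k) *\<^sub>R (U (t + ?d k) - U t)" for k t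
  have "((\<lambda>s. U (s + c)) has_vector_derivative u (t + c)) (at t)" for t c
  proof -
    have "((\<lambda>s. s + c) has_vector_derivative 1) (at t)"
      by (auto intro!: derivative_eq_intros simp: has_vector_derivative_def)
    from vector_diff_chain_at[OF this U] show ?thesis by (simp add: o_def)
  qed
  then have "(V k has_vector_derivative f k t) (at t within A)" for k t A
    unfolding V_def f_def
    by (intro has_vector_derivative_at_within[of _ _ t A]
        bounded_linear.has_vector_derivative[OF bounded_linear_scaleR_right]
        has_vector_derivative_diff U)
  then have int: "(f k has_integral V k y - V k x) {x..y}" for k
    by (intro fundamental_theorem_of_calculus xy) auto
  have spike: "(f k has_integral z) ({x..y} - N) \<longleftrightarrow> (f k has_integral z) {x..y}" for k z
    by (rule has_integral_spike_set_eq; rule negligible_subset[OF N]) auto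
  have int': "(f k has_integral V k y - V k x) ({x..y} - N)" for k
    using int by (simp add: spike)
  have bnd: "norm (f k t) \<le> C" for k t
  proof -
    have "norm (u (t + ?d k) - u t) \<le> C * ?d k"
      using lipschitz_onD[OF lip, of "t + ?d k" t] by (simp add: dist_norm)
    then have "real (Suc k) * norm (u (t + ?d k) - u t) \<le> real (Suc k) * (C * ?d k)"
      by (intro mult_left_mono) auto
    also have "\<dots> = C" by simp
    finally show ?thesis by (simp add: f_def)
  qed
  have const: "(\<lambda>_. C) integrable_on ({x..y} - N)"
    using integrable_spike_set[of "\<lambda>_. C" "{x..y}" "{x..y} - N"]
    by (auto intro!: negligible_subset[OF N])
  have conv: "(\<lambda>k. f k t) \<longlonglongrightarrow> g t" if "t \<in> {x..y} - N" for t
    unfolding f_def by (rule has_vector_derivative_sequentially[OF der[OF that]])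
  have dc: "g integrable_on ({x..y} - N)"
      "(\<lambda>k. integral ({x..y} - N) (f k)) \<longlonglongrightarrow> integral ({x..y} - N) g"
    using dominated_convergence[OF has_integral_integrable[OF int'] const bnd conv] by blast+
  have "(\<lambda>k. V k y - V k x) \<longlonglongrightarrow> u y - u x"
    unfolding V_def by (intro tendsto_diff has_vector_derivative_sequentially U)
  moreover have "integral ({x..y} - N) (f k) = V k y - V k x" for k
    using int' by (rule integral_unique)
  ultimately have "integral ({x..y} - N) g = u y - u x"
    using LIMSEQ_unique dc(2) by simp
  then have "(g has_integral u y - u x) ({x..y} - N)"
    using dc(1) by (metis integrable_integral)
  then show ?thesis
    by (subst (asm) has_integral_spike_set_eq[of _ "{x..y}"])
       (auto intro: negligible_subset[OF N])
qed

section \<open>Functionals on the space of essentially bounded functions\<close>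

lemma linf_integrable: "rep_linf f integrable_on {x..y}"
proof -
  have "set_integrable lebesgue {x..y} (rep_linf f)"
    unfolding set_integrable_def
  proof (rule integrableI_bounded_set_indicator[where B = "norm f"])
    show "rep_linf f \<in> borel_measurable lebesgue"
      using ess_bounded_rep[of f] by (auto simp: ess_bounded_def)
    show "AE t in lebesgue. t \<in> {x..y} \<longrightarrow> norm (rep_linf f t) \<le> norm f"
      using AE_norm_linf[of f] by eventually_elim simp
  qed (auto simp: emeasure_lborel_Icc_eq)
  then show ?thesis by (rule set_lebesgue_integral_eq_integral)
qed

lemma AE_integral_cong:
  assumes "AE t in lebesgue. f t = g t"
  shows "integral S f = integral S g"
proof -
  obtain N where N: "negligible N" "{t. f t \<noteq> g t} \<subseteq> N"
    using assms unfolding eventually_ae_filter_negligible by auto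
  show ?thesis by (rule integral_spike[OF N(1)]) (use N(2) in force)
qed

lemma linf_integral_bounded_linear:
  assumes "x \<le> y"
  shows "bounded_linear (\<lambda>f :: ('v::euclidean_space) linf. integral {x..y} (rep_linf f))"
proof (rule bounded_linear_intro[where K = "y - x"])
  fix f g :: "'v linf" and r :: real
  show "integral {x..y} (rep_linf (f + g)) = integral {x..y} (rep_linf f) + integral {x..y} (rep_linf g)"
    by (simp add: AE_integral_cong[OF rep_plus_linf] integral_add linf_integrable)
  show "integral {x..y} (rep_linf (r *\<^sub>R f)) = r *\<^sub>R integral {x..y} (rep_linf f)"
    by (simp add: AE_integral_cong[OF rep_scaleR_linf])
  obtain N where N: "negligible N" "{t. \<not> norm (rep_linf f t) \<le> norm f} \<subseteq> N"
    using AE_norm_linf[of f] unfolding eventually_ae_filter_negligible by auto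
  define r where "r t = (if t \<in> N then 0 else rep_linf f t)" for t
  have "(r has_integral integral {x..y} (rep_linf f)) {x..y}"
    by (rule has_integral_spike[OF N(1) _ integrable_integral[OF linf_integrable]])
       (auto simp: r_def)
  then have "norm (integral {x..y} (rep_linf f)) \<le> norm f * measure lborel {x..y}"
    by (rule has_integral_bound_real[rotated 2, of _ _ _ _ "{}"])
       (use N(2) in \<open>auto simp: r_def\<close>)
  then show "norm (integral {x..y} (rep_linf f)) \<le> norm f * (y - x)"
    using assms by simp
qed

text \<open>By the Lebesgue differentiation theorem almost every value of \<open>f\<close> is a limit of means over short
  intervals.\<close>

lemma linf_zeroI:
  fixes f :: "('v::euclidean_space) linf"
  assumes f: "f \<in> Linf_space h"
    and z: "\<And>x y. - h \<le> x \<Longrightarrow> x \<le> y \<Longrightarrow> y \<le> 0 \<Longrightarrow> integral {x..y} (rep_linf f) = 0"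
  shows "f = 0"
proof -
  obtain N where N: "negligible N"
    "\<And>t e. \<lbrakk>t \<notin> N; 0 < e\<rbrakk> \<Longrightarrow> \<exists>d>0. \<forall>s. 0 < s \<and> s < d \<longrightarrow>
       norm (integral (cbox t (t + s *\<^sub>R One)) (rep_linf f) /\<^sub>R s ^ DIM(real) - rep_linf f t) < e"
    using integrable_ccontinuous_explicit[of "rep_linf f"] linf_integrable[of f]
    by (metis cbox_interval)
  have inner: "rep_linf f t = 0" if t: "t \<notin> N" "- h \<le> t" "t < 0" for t
  proof (rule ccontr)
    assume "rep_linf f t \<noteq> 0"
    then obtain d where d: "d > 0" "\<And>s. 0 < s \<Longrightarrow> s < d \<Longrightarrow>
       norm (integral (cbox t (t + s *\<^sub>R One)) (rep_linf f) /\<^sub>R s ^ DIM(real) - rep_linf f t)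
         < norm (rep_linf f t)"
      using N(2)[OF t(1), of "norm (rep_linf f t)"] by auto
    \<comment> \<open>Short enough for the mean to be near the value at \<open>t\<close>, and for the interval to stay in \<open>[-h, 0]\<close>.\<close>
    define s where "s = min (d / 2) (- t)"
    have s: "0 < s" "s < d" "t + s \<le> 0" using t d(1) by (auto simp: s_def)
    then have "integral {t..t + s} (rep_linf f) = 0"
      using t by (intro z) auto
    with d(2)[OF s(1,2)] show False by simp
  qed
  have "AE t in lebesgue. t \<notin> N \<and> t \<noteq> 0"
    unfolding eventually_ae_filter_negligible
    using N(1) by (intro exI[of _ "insert 0 N"]) auto
  then have "AE t in lebesgue. rep_linf f t = rep_linf 0 t"
    using f[unfolded Linf_space_def, THEN CollectD] rep_zero_linf[where 'a = 'v]
  proof eventually_elim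
    case (elim t)
    then show ?case using inner[of t] by (cases "t \<in> {-h..0}") auto
  qed
  then show ?thesis by (simp add: linf_eq_iff)
qed

section \<open>Closability of the two generators\<close>

text \<open>This turns statements about a class in \<open>L\<^sup>\<infinity>\<close> that has a continuous representative into pointwise
  statements on the whole closed interval.\<close>

lemma AE_le_imp_le:
  fixes f :: "real \<Rightarrow> real"
  assumes f: "continuous_on UNIV f" and ab: "a < b"
    and ae: "AE t in lebesgue. t \<in> {a..b} \<longrightarrow> f t \<le> c" and t: "t \<in> {a..b}"
  shows "f t \<le> c"
proof (rule ccontr)
  assume "\<not> f t \<le> c"
  obtain N where N: "negligible N" "{t. \<not> (t \<in> {a..b} \<longrightarrow> f t \<le> c)} \<subseteq> N"
    using ae unfolding eventually_ae_filter_negligible by auto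
  have op: "open {s. c < f s}"
    by (intro open_Collect_less f continuous_on_const)
  have "t \<in> {s. c < f s} \<inter> closure {a<..<b}" using ab t \<open>\<not> f t \<le> c\<close> by simp
  then have "{s. c < f s} \<inter> {a<..<b} \<noteq> {}"
    using open_Int_closure_eq_empty[OF op, of "{a<..<b}"] by blast
  moreover have "negligible ({s. c < f s} \<inter> {a<..<b})"
    by (rule negligible_subset[OF N(1)]) (use N(2) in force)
  ultimately show False
    using open_not_negligible op by (metis open_Int open_greaterThanLessThan)
qed

text \<open>All that closability needs to know about an element of the domain: the representative \<open>u\<close> is
  controlled by the norm of its class, hence so are the value \<open>L u\<close> and the integrals of the
  derivative \<open>g\<close>, although \<open>g\<close> itself is not.\<close>

lemma A_sunstar_opE:
  fixes L :: "(real \<Rightarrow>\<^sub>C (complex^'n)) \<Rightarrow> complex^'n"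
  assumes h: "0 < h" and mem: "((\<alpha>, f), (\<beta>, g)) \<in> A_sunstar_op h L"
  obtains u where "u \<in> Xspace h" "norm u \<le> norm f" "\<beta> = L u"
    "\<And>x y. - h \<le> x \<Longrightarrow> x \<le> y \<Longrightarrow> y \<le> 0 \<Longrightarrow> integral {x..y} (rep_linf g) = u y - u x"
proof -
  obtain u C where u: "u \<in> Xspace h" "C-lipschitz_on {-h..0} (apply_bcontfun u)" "\<beta> = L u"
    and f: "AE \<theta> in lebesgue. \<theta> \<in> {-h..0} \<longrightarrow> rep_linf f \<theta> = u \<theta>"
    and g: "AE \<theta> in lebesgue. \<theta> \<in> {-h..0} \<longrightarrow>
        (apply_bcontfun u has_vector_derivative rep_linf g \<theta>) (at \<theta> within {-h..0})"
    using mem unfolding A_sunstar_op_def by auto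
  have clamp: "clamp (- h) 0 \<theta> \<in> {-h..0}" for \<theta> using h by (auto simp: clamp_real)
  have u_clamp: "u \<theta> = u (clamp (- h) 0 \<theta>)" for \<theta> using u(1) by (auto simp: Xspace_def)
  have "AE \<theta> in lebesgue. \<theta> \<in> {-h..0} \<longrightarrow> norm (u \<theta>) \<le> norm f"
    using f AE_norm_linf[of f] by eventually_elim auto
  then have "norm (u \<theta>) \<le> norm f" if "\<theta> \<in> {-h..0}" for \<theta>
    using h by (intro AE_le_imp_le[OF _ _ _ that] continuous_intros) auto
  then have norm: "norm u \<le> norm f"
    using clamp u_clamp by (metis norm_bound)
  \<comment> \<open>The constant extension to the real line keeps the Lipschitz constant.\<close>
  have lip: "C-lipschitz_on UNIV (apply_bcontfun u)"
  proof (rule lipschitz_onI)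
    fix s t :: real
    have "dist (u s) (u t) \<le> C * dist (clamp (- h) 0 s) (clamp (- h) 0 t)"
      using lipschitz_onD[OF u(2) clamp clamp] u_clamp by metis
    also have "\<dots> \<le> C * dist s t"
      by (intro mult_left_mono dist_clamps_le_dist_args lipschitz_on_nonneg[OF u(2)])
    finally show "dist (u s) (u t) \<le> C * dist s t" .
  qed (rule lipschitz_on_nonneg[OF u(2)])
  obtain N where N: "negligible N" "{\<theta>. \<not> (\<theta> \<in> {-h..0} \<longrightarrow>
      (apply_bcontfun u has_vector_derivative rep_linf g \<theta>) (at \<theta> within {-h..0}))} \<subseteq> N"
    using g unfolding eventually_ae_filter_negligible by auto
  have int: "integral {x..y} (rep_linf g) = u y - u x" if xy: "- h \<le> x" "x \<le> y" "y \<le> 0" for x y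
  proof (rule integral_unique, rule lipschitz_FTC[OF lip _ xy(2)])
    show "negligible (N \<union> {-h, 0})" using N(1) by simp
    fix t assume t: "t \<in> {x..y} - (N \<union> {-h, 0})"
    then have "at t within {-h..0} = at t"
      using xy by (intro at_within_Icc_at) auto
    moreover have "t \<in> {-h..0}" "t \<notin> N" using t xy by auto
    then have "(apply_bcontfun u has_vector_derivative rep_linf g t) (at t within {-h..0})"
      using N(2) by (auto simp only: subset_iff mem_Collect_eq)
    ultimately show "(apply_bcontfun u has_vector_derivative rep_linf g t) (at t)"
      by simp
  qed
  show ?thesis by (rule that[OF u(1) norm u(3) int])
qed

text \<open>The canonical embedding of \<open>X\<close> into the sun-star dual space; the class is that of the extension by
  zero, as the elements of \<^term>\<open>Linf_space h\<close> vanish off the interval.\<close>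

definition emb :: "real \<Rightarrow> (real \<Rightarrow>\<^sub>C 'v) \<Rightarrow> 'v \<times> ('v::euclidean_space) linf"
  where "emb h u = (u 0, abs_linf (\<lambda>\<theta>. indicator {-h..0} \<theta> *\<^sub>R u \<theta>))"

lemma ess_bounded_emb: "ess_bounded (\<lambda>\<theta>. indicator {-h..0} \<theta> *\<^sub>R apply_bcontfun u \<theta>)"
proof (rule ess_boundedI[where C = "norm u"])
  have "apply_bcontfun u \<in> borel_measurable lebesgue"
    by (intro measurable_completion) (simp add: borel_measurable_continuous_onI)
  then show "(\<lambda>\<theta>. indicator {-h..0} \<theta> *\<^sub>R u \<theta>) \<in> borel_measurable lebesgue"
    by (intro borel_measurable_scaleR borel_measurable_indicator) auto
  show "AE \<theta> in lebesgue. norm (indicator {-h..0} \<theta> *\<^sub>R u \<theta>) \<le> norm u"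
    by (rule AE_I2) (auto simp: indicator_def norm_bounded)
qed

lemma rep_emb:
  "AE \<theta> in lebesgue. rep_linf (snd (emb h u)) \<theta> = indicator {-h..0} \<theta> *\<^sub>R apply_bcontfun u \<theta>"
  unfolding emb_def snd_conv by (rule rep_abs_linf[OF ess_bounded_emb])

lemma bounded_linear_emb: "bounded_linear (emb h)"
proof (rule bounded_linear_intro[where K = 2])
  fix u v :: "real \<Rightarrow>\<^sub>C 'a" and r :: real
  have "snd (emb h (u + v)) = snd (emb h u) + snd (emb h v)"
    unfolding linf_eq_iff
    using rep_emb[of h "u + v"] rep_emb[of h u] rep_emb[of h v]
      rep_plus_linf[of "snd (emb h u)" "snd (emb h v)"]
    by eventually_elim (simp add: scaleR_add_right)
  then show "emb h (u + v) = emb h u + emb h v"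
    by (simp add: prod_eq_iff) (simp add: emb_def)
  have "snd (emb h (r *\<^sub>R u)) = r *\<^sub>R snd (emb h u)"
    unfolding linf_eq_iff
    using rep_emb[of h "r *\<^sub>R u"] rep_emb[of h u] rep_scaleR_linf[of r "snd (emb h u)"]
    by eventually_elim simp
  then show "emb h (r *\<^sub>R u) = r *\<^sub>R emb h u"
    by (simp add: prod_eq_iff) (simp add: emb_def)
  have "AE \<theta> in lebesgue. norm (rep_linf (snd (emb h u)) \<theta>) \<le> norm u"
    using rep_emb[of h u] by eventually_elim (auto simp: indicator_def norm_bounded)
  then have "norm (snd (emb h u)) \<le> norm u" by (rule norm_linf_leI)
  moreover have "norm (fst (emb h u)) \<le> norm u" by (simp add: emb_def norm_bounded)
  ultimately show "norm (emb h u) \<le> norm u * 2"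
    using norm_Pair_le[of "fst (emb h u)" "snd (emb h u)"] by simp
qed

lemma emb_in_Xsunstar: "emb h u \<in> Xsunstar h"
proof -
  have "AE \<theta> in lebesgue. \<theta> \<notin> {-h..0} \<longrightarrow> rep_linf (snd (emb h u)) \<theta> = 0"
    using rep_emb[of h u] by eventually_elim simp
  then show ?thesis by (simp add: Xsunstar_def Linf_space_def mem_Times_iff)
qed

lemma Xspace_AE_eqI:
  assumes h: "0 < h" and u: "u \<in> Xspace h" "v \<in> Xspace h"
    and ae: "AE \<theta> in lebesgue. \<theta> \<in> {-h..0} \<longrightarrow> apply_bcontfun u \<theta> = apply_bcontfun v \<theta>"
  shows "u = v"
proof (rule Xspace_eqI[OF h u])
  fix \<theta> assume \<theta>: "\<theta> \<in> {-h..0}"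
  have "AE \<theta> in lebesgue. \<theta> \<in> {-h..0} \<longrightarrow> norm (u \<theta> - v \<theta>) \<le> 0"
    using ae by eventually_elim auto
  then have "norm (u \<theta> - v \<theta>) \<le> 0"
    using h by (intro AE_le_imp_le[OF _ _ _ \<theta>] continuous_intros) auto
  then show "u \<theta> = v \<theta>" by simp
qed

text \<open>The boundary condition \<open>y 0 = L x\<close> of \<open>A\<close> becomes the first component of the action of the sun-star
  operator, which has no boundary condition. This is why one sequence of functions in \<open>X\<close> shows that
  neither operator is closed, and why the functionals found for the sun-star operator also serve
  for \<open>A\<close>.\<close>

lemma emb_A_op:
  assumes h: "0 < h" and mem: "(x, y) \<in> A_op h L"
  shows "(emb h x, emb h y) \<in> A_sunstar_op h L"
proof -
  from mem have x: "x \<in> Xspace h" and y: "y 0 = L x"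
    and der: "\<And>\<theta>. \<theta> \<in> {-h..0} \<Longrightarrow> (apply_bcontfun x has_vector_derivative y \<theta>) (at \<theta> within {-h..0})"
    by (auto simp: A_op_def)
  have lip: "(norm y)-lipschitz_on {-h..0} (apply_bcontfun x)"
  proof (rule lipschitz_onI)
    fix s t assume st: "s \<in> {-h..0}" "t \<in> {-h..0}"
    have "norm (x s - x t) \<le> norm y * norm (s - t)"
    proof (rule differentiable_bound[OF _ _ _ st])
      fix \<theta> assume "\<theta> \<in> {-h..0}"
      then show "(apply_bcontfun x has_derivative (\<lambda>r. r *\<^sub>R y \<theta>)) (at \<theta> within {-h..0})"
        using der by (simp add: has_vector_derivative_def)
      show "onorm (\<lambda>r. r *\<^sub>R y \<theta>) \<le> norm y"
        by (rule onorm_scaleR_left_le[OF norm_bounded])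
    qed simp
    then show "dist (x s) (x t) \<le> norm y * dist s t" by (simp add: dist_norm)
  qed simp
  have "AE \<theta> in lebesgue. \<theta> \<in> {-h..0} \<longrightarrow> rep_linf (snd (emb h x)) \<theta> = x \<theta>"
    using rep_emb[of h x] by eventually_elim simp
  moreover have "AE \<theta> in lebesgue. \<theta> \<in> {-h..0} \<longrightarrow>
      (apply_bcontfun x has_vector_derivative rep_linf (snd (emb h y)) \<theta>) (at \<theta> within {-h..0})"
    using rep_emb[of h y] by eventually_elim (auto intro: der)
  ultimately have "((fst (emb h x), snd (emb h x)), (fst (emb h y), snd (emb h y))) \<in> A_sunstar_op h L"
    unfolding A_sunstar_op_def
    using x y lip emb_in_Xsunstar[of h x] emb_in_Xsunstar[of h y]
    by (auto simp: Xsunstar_def mem_Times_iff emb_def intro!: bexI[of _ x])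
  then show ?thesis by simp
qed

lemma periodic_op_subset: "periodic_op T E A \<subseteq> C_per T E \<times> C_per T E"
  by (auto simp: periodic_op_def C1_per_def)

lemma emb_C_per: "\<phi> \<in> C_per T E \<Longrightarrow> map_bcontfun (emb h) \<phi> \<in> C_per T (Xsunstar h)"
  by (auto simp: C_per_def map_bcontfun_apply[OF bounded_linear_emb] emb_in_Xsunstar)

lemma emb_periodic_op:
  assumes h: "0 < h" and mem: "(\<phi>, \<psi>) \<in> periodic_op T (Xspace h) (\<lambda>\<tau>. A_op h (L \<tau>))"
  shows "(map_bcontfun (emb h) \<phi>, map_bcontfun (emb h) \<psi>) \<in> periodic_op T (Xsunstar h) (\<lambda>\<tau>. A_sunstar_op h (L \<tau>))"
proof -
  note bl = bounded_linear_emb[of h]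
  from mem obtain D where D: "continuous_on UNIV D"
      "\<And>\<tau>. (apply_bcontfun \<phi> has_vector_derivative D \<tau>) (at \<tau>)"
      "\<And>\<tau>. (\<phi> \<tau>, \<psi> \<tau> + D \<tau>) \<in> A_op h (L \<tau>)"
    and C: "\<phi> \<in> C_per T (Xspace h)" "\<psi> \<in> C_per T (Xspace h)"
    unfolding periodic_op_iff by blast
  have ap: "apply_bcontfun (map_bcontfun (emb h) \<phi>) = (\<lambda>t. emb h (\<phi> t))"
    by (rule ext) (rule map_bcontfun_apply[OF bl])
  show ?thesis
    unfolding periodic_op_iff ap map_bcontfun_apply[OF bl]
  proof (intro conjI emb_C_per[OF C(1)] emb_C_per[OF C(2)] exI[of _ "\<lambda>\<tau>. emb h (D \<tau>)"] allI)
    show "continuous_on UNIV (\<lambda>\<tau>. emb h (D \<tau>))"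
      by (rule bounded_linear.continuous_on[OF bl D(1)])
    fix \<tau>
    show "((\<lambda>t. emb h (\<phi> t)) has_vector_derivative emb h (D \<tau>)) (at \<tau>)"
      by (rule bounded_linear.has_vector_derivative[OF bl D(2)])
    show "(emb h (\<phi> \<tau>), emb h (\<psi> \<tau>) + emb h (D \<tau>)) \<in> A_sunstar_op h (L \<tau>)"
      using emb_A_op[OF h D(3), of \<tau>] by (simp add: linear_add[OF bounded_linear.linear[OF bl]])
  qed
qed

text \<open>The properties of the family \<open>L(\<tau>) = DF(\<gamma>\<^sub>\<tau>)\<close> on which everything rests. Values of \<open>L \<tau>\<close> off
  \<^term>\<open>Xspace h\<close> are left free, as the derivative of \<open>F\<close> within \<^term>\<open>Xspace h\<close> is determined only there.\<close>

locale delay_family =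
  fixes h T :: real and L :: "real \<Rightarrow> (real \<Rightarrow>\<^sub>C (complex^'n)) \<Rightarrow> complex^'n"
  assumes h: "0 < h" and T: "0 < T"
    and L_add: "u \<in> Xspace h \<Longrightarrow> v \<in> Xspace h \<Longrightarrow> L \<tau> (u + v) = L \<tau> u + L \<tau> v"
    and L_scale: "u \<in> Xspace h \<Longrightarrow> L \<tau> (c *\<^sub>C u) = c *\<^sub>C L \<tau> u"
    and L_bounded: "\<exists>C. \<forall>\<tau>. \<forall>u\<in>Xspace h. norm (L \<tau> u) \<le> C * norm u"
    and L_continuous: "\<phi> \<in> C_per T (Xspace h) \<Longrightarrow> continuous_on UNIV (\<lambda>\<tau>. L \<tau> (apply_bcontfun \<phi> \<tau>))"
    and L_periodic: "u \<in> Xspace h \<Longrightarrow> L (\<tau> + T) u = L \<tau> u"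
begin

abbreviation A_per where "A_per \<equiv> periodic_op T (Xspace h) (\<lambda>\<tau>. A_op h (L \<tau>))"

abbreviation A_per_sunstar where
  "A_per_sunstar \<equiv> periodic_op T (Xsunstar h) (\<lambda>\<tau>. A_sunstar_op h (L \<tau>))"

text \<open>The two components are tested separately. On the first one \<open>A\<^sup>\<odot>\<^sup>\<star>(\<tau>)\<close> acts by \<open>L(\<tau>)\<close>, which
  is bounded in the norm of the representative. On the second one it is differentiation, and an integral
  over a subinterval undoes it.\<close>

definition sunstar_functionals :: "((complex^'n) \<times> (complex^'n) linf \<Rightarrow> complex^'n) set" where
  "sunstar_functionals = insert fst
    {P. \<exists>x y. - h \<le> x \<and> x \<le> y \<and> y \<le> 0 \<and> P = (\<lambda>p. integral {x..y} (rep_linf (snd p)))}"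

lemma sunstar_functionals_bounded_linear:
  assumes "P \<in> sunstar_functionals" shows "bounded_linear P"
  using assms
  by (auto simp: sunstar_functionals_def bounded_linear_fst
      intro: bounded_linear_compose[OF linf_integral_bounded_linear bounded_linear_snd])

lemma sunstar_functionals_separate:
  assumes "p \<in> Xsunstar h" "\<And>P. P \<in> sunstar_functionals \<Longrightarrow> P p = 0"
  shows "p = 0"
proof -
  have "fst p = 0" using assms(2) by (simp add: sunstar_functionals_def)
  moreover have "snd p = 0"
    using assms by (intro linf_zeroI[of _ h]) (auto simp: Xsunstar_def sunstar_functionals_def)
  ultimately show ?thesis by (simp add: prod_eq_iff)
qed

lemma sunstar_functionals_estimate:
  assumes P: "P \<in> sunstar_functionals"
  shows "\<exists>K\<ge>0. \<forall>\<tau> p q. (p, q) \<in> A_sunstar_op h (L \<tau>) \<longrightarrow> norm (P q) \<le> K * norm p"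
proof -
  obtain C where C: "\<And>\<tau> u. u \<in> Xspace h \<Longrightarrow> norm (L \<tau> u) \<le> C * norm u"
    using L_bounded by blast
  have "norm (P q) \<le> max C 2 * norm p" if pq: "(p, q) \<in> A_sunstar_op h (L \<tau>)" for \<tau> p q
  proof -
    obtain \<alpha> f \<beta> g where eq: "p = (\<alpha>, f)" "q = (\<beta>, g)" by force
    obtain u where u: "u \<in> Xspace h" "norm u \<le> norm f" "\<beta> = L \<tau> u"
      "\<And>x y. - h \<le> x \<Longrightarrow> x \<le> y \<Longrightarrow> y \<le> 0 \<Longrightarrow> integral {x..y} (rep_linf g) = u y - u x"
      using A_sunstar_opE[OF h pq[unfolded eq]] by blast
    have up: "norm u \<le> norm p"
      using u(2) norm_snd_le[of f \<alpha>] by (simp add: eq)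
    have "norm (P q) \<le> max C 2 * norm u"
    proof (cases "P = fst")
      case True
      then show ?thesis
        using C[OF u(1), of \<tau>] mult_right_mono[of C "max C 2" "norm u"] by (simp add: eq u(3))
    next
      case False
      then obtain x y where "- h \<le> x" "x \<le> y" "y \<le> 0" "P = (\<lambda>p. integral {x..y} (rep_linf (snd p)))"
        using P by (auto simp: sunstar_functionals_def)
      then have "norm (P q) \<le> norm (u y) + norm (u x)"
        by (simp add: eq u(4) norm_triangle_ineq4)
      also have "\<dots> \<le> 2 * norm u"
        using norm_bounded[of u x] norm_bounded[of u y] by simp
      also have "\<dots> \<le> max C 2 * norm u" by (intro mult_right_mono) auto
      finally show ?thesis .
    qed
    also have "\<dots> \<le> max C 2 * norm p" by (intro mult_left_mono up) auto
    finally show ?thesis .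
  qed
  then show ?thesis by (intro exI[of _ "max C 2"]) auto
qed

lemma csubspace_A: "cvec.subspace (A_op h (L \<tau>))"
  by (rule csubspace_A_op[OF L_add L_scale])

lemma csubspace_A_sunstar: "cvec.subspace (A_sunstar_op h (L \<tau>))"
  by (rule csubspace_A_sunstar_op[OF L_add L_scale])

lemma A_per_sunstar_closable: "closable_operator_in (C_per T (Xsunstar h)) A_per_sunstar"
proof (rule periodic_op_closable[where Ps = sunstar_functionals])
  show "cvec.subspace (A_sunstar_op h (L \<tau>))" for \<tau>
    by (rule csubspace_A_sunstar)
  show "\<exists>K. \<forall>\<tau> x y. (x, y) \<in> A_sunstar_op h (L \<tau>) \<longrightarrow> norm (P y) \<le> K * norm x"
    if "P \<in> sunstar_functionals" for P
    using sunstar_functionals_estimate[OF that] by blast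
  show "p = 0" if "p \<in> Xsunstar h" "\<And>P. P \<in> sunstar_functionals \<Longrightarrow> P p = 0" for p
    using that by (rule sunstar_functionals_separate)
qed (rule csubspace_Xsunstar, rule sunstar_functionals_bounded_linear)

lemma A_per_closable: "closable_operator_in (C_per T (Xspace h)) A_per"
proof (rule periodic_op_closable[where Ps = "(\<lambda>P u. P (emb h u)) ` sunstar_functionals"])
  show "cvec.subspace (Xspace h)" by (rule csubspace_Xspace)
  show "cvec.subspace (A_op h (L \<tau>))" for \<tau>
    by (rule csubspace_A)
next
  fix P assume "P \<in> (\<lambda>P u. P (emb h u)) ` sunstar_functionals"
  then obtain Q where Q: "Q \<in> sunstar_functionals" "P = (\<lambda>u. Q (emb h u))" by auto
  show "bounded_linear P"
    unfolding Q(2)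
    by (rule bounded_linear_compose[OF sunstar_functionals_bounded_linear[OF Q(1)] bounded_linear_emb])
  obtain K where K: "0 \<le> K"
    "\<And>\<tau> p q. (p, q) \<in> A_sunstar_op h (L \<tau>) \<Longrightarrow> norm (Q q) \<le> K * norm p"
    using sunstar_functionals_estimate[OF Q(1)] by blast
  obtain K' where K': "\<And>u :: real \<Rightarrow>\<^sub>C (complex^'n). norm (emb h u) \<le> norm u * K'"
    using bounded_linear.pos_bounded[OF bounded_linear_emb] by blast
  have "norm (P y) \<le> (K * K') * norm x" if "(x, y) \<in> A_op h (L \<tau>)" for \<tau> x y
  proof -
    have "norm (P y) \<le> K * norm (emb h x)"
      unfolding Q(2) by (rule K(2)[OF emb_A_op[OF h that]])
    also have "\<dots> \<le> K * (norm x * K')" by (rule mult_left_mono[OF K' K(1)])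
    finally show ?thesis by (simp add: mult_ac)
  qed
  then show "\<exists>K. \<forall>\<tau> x y. (x, y) \<in> A_op h (L \<tau>) \<longrightarrow> norm (P y) \<le> K * norm x" by blast
next
  fix u :: "real \<Rightarrow>\<^sub>C (complex^'n)"
  assume u: "u \<in> Xspace h"
    and z: "\<And>P. P \<in> (\<lambda>P u. P (emb h u)) ` sunstar_functionals \<Longrightarrow> P u = 0"
  have "emb h u = 0"
    by (rule sunstar_functionals_separate[OF emb_in_Xsunstar]) (rule z, rule imageI)
  then have snd0: "snd (emb h u) = 0" by simp
  have "AE \<theta> in lebesgue. \<theta> \<in> {-h..0} \<longrightarrow> u \<theta> = apply_bcontfun 0 \<theta>"
    using rep_emb[of h u] rep_zero_linf[where 'a = "complex^'n"]
    unfolding snd0 by eventually_elim (auto simp: indicator_def)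
  then show "u = 0"
    by (rule Xspace_AE_eqI[OF h u cvec.subspace_0[OF csubspace_Xspace]])
qed

lemma A_per_linear: "linear_operator_in (C_per T (Xspace h)) A_per"
  unfolding linear_operator_in_def
proof (intro conjI)
  show "A_per \<subseteq> C_per T (Xspace h) \<times> C_per T (Xspace h)"
    by (rule periodic_op_subset)
  show "cvec.subspace A_per"
    by (rule csubspace_periodic_op[OF csubspace_Xspace csubspace_A])
  show "single_valued A_per"
    using A_per_closable unfolding closable_operator_in_def linear_operator_in_def
    by (elim exE conjE) (rule single_valued_subset)
qed

lemma A_per_sunstar_linear: "linear_operator_in (C_per T (Xsunstar h)) A_per_sunstar"
  unfolding linear_operator_in_def
proof (intro conjI)
  show "A_per_sunstar \<subseteq> C_per T (Xsunstar h) \<times> C_per T (Xsunstar h)"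
    by (rule periodic_op_subset)
  show "cvec.subspace A_per_sunstar"
    by (rule csubspace_periodic_op[OF csubspace_Xsunstar csubspace_A_sunstar])
  show "single_valued A_per_sunstar"
    using A_per_sunstar_closable unfolding closable_operator_in_def linear_operator_in_def
    by (elim exE conjE) (rule single_valued_subset)
qed

end

section \<open>Functions of two variables as curves of segments\<close>

text \<open>A function of \<open>\<tau>\<close> and \<open>\<theta>\<close> on the whole plane is viewed as a curve in \<^term>\<open>Xspace h\<close>; clamping
  discards what happens for \<open>\<theta>\<close> outside \<open>[-h, 0]\<close>. Working on the plane spares one-sided
  derivatives in \<open>\<theta>\<close>.\<close>

definition segment_curve :: "real \<Rightarrow> (real \<Rightarrow> real \<Rightarrow> 'v::real_normed_vector) \<Rightarrow> real \<Rightarrow> (real \<Rightarrow>\<^sub>C 'v)"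
  where "segment_curve h f \<tau> = Bcontfun (\<lambda>\<theta>. f \<tau> (clamp (- h) 0 \<theta>))"

lemma segment_curve_apply:
  assumes h: "0 < h" and f: "continuous_on UNIV (\<lambda>(\<tau>, \<theta>). f \<tau> \<theta>)"
  shows "apply_bcontfun (segment_curve h f \<tau>) \<theta> = f \<tau> (clamp (- h) 0 \<theta>)"
proof -
  have c: "continuous_on A (f \<tau>)" for A
    using continuous_on_compose2[OF f continuous_on_Pair[OF continuous_on_const continuous_on_id]]
    by fastforce
  have "(\<lambda>\<theta>. f \<tau> (clamp (- h) 0 \<theta>)) \<in> bcontfun"
    unfolding bcontfun_def
    using clamp_continuous_on[OF c] clamp_bounded[OF compact_imp_bounded[OF compact_continuous_image[OF c compact_cbox]]]
    by blast
  then show ?thesis by (simp add: segment_curve_def Bcontfun_inverse)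
qed

lemma segment_curve_in_Xspace:
  assumes "0 < h" "continuous_on UNIV (\<lambda>(\<tau>, \<theta>). f \<tau> \<theta>)"
  shows "segment_curve h f \<tau> \<in> Xspace h"
  using assms by (auto simp: Xspace_def segment_curve_apply clamp_real)

lemma segment_curve_continuous:
  assumes h: "0 < h" and f: "continuous_on UNIV (\<lambda>(\<tau>, \<theta>). f \<tau> \<theta>)"
  shows "continuous_on UNIV (segment_curve h f)"
  unfolding continuous_on_def
proof (intro ballI tendstoI)
  fix \<tau> :: real and e :: real assume e: "0 < e"
  have "continuous_on (UNIV \<times> {-h..0}) (\<lambda>(\<tau>, \<theta>). f \<tau> \<theta>)"
    by (rule continuous_on_subset[OF f]) simp
  then obtain S where S: "\<tau> \<in> S" "open S"
    and S_dist: "\<forall>\<sigma>\<in>S \<inter> UNIV. \<forall>\<theta>\<in>{-h..0}. dist (case (\<sigma>, \<theta>) of (\<tau>, \<theta>) \<Rightarrow> f \<tau> \<theta>)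
      (case (\<tau>, \<theta>) of (\<tau>, \<theta>) \<Rightarrow> f \<tau> \<theta>) \<le> e / 2"
    by (rule continuous_on_prod_compactE[OF _ compact_Icc UNIV_I half_gt_zero[OF e]])
  have "dist (segment_curve h f \<sigma>) (segment_curve h f \<tau>) < e" if "\<sigma> \<in> S" for \<sigma>
  proof -
    have "dist (segment_curve h f \<sigma>) (segment_curve h f \<tau>) \<le> e / 2"
    proof (rule dist_bound)
      fix \<theta>
      have "clamp (- h) 0 \<theta> \<in> {-h..0}" using h by (auto simp: clamp_real)
      then show "dist (segment_curve h f \<sigma> \<theta>) (segment_curve h f \<tau> \<theta>) \<le> e / 2"
        using S_dist that by (simp add: segment_curve_apply[OF h f])
    qed
    then show ?thesis using e by simp
  qed
  then show "\<forall>\<^sub>F \<sigma> in at \<tau> within UNIV. dist (segment_curve h f \<sigma>) (segment_curve h f \<tau>) < e"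
    unfolding eventually_at_topological using S(1,2) by blast
qed

text \<open>Pointwise differentiability in \<open>\<tau>\<close> becomes differentiability in the supremum norm because, by
  compactness of \<open>[-h, 0]\<close>, the derivative \<open>f'\<close> is continuous in \<open>\<tau>\<close> uniformly in \<open>\<theta>\<close>.\<close>

lemma segment_curve_derivative:
  assumes h: "0 < h" and f: "continuous_on UNIV (\<lambda>(\<tau>, \<theta>). f \<tau> \<theta>)"
    and f': "continuous_on UNIV (\<lambda>(\<tau>, \<theta>). f' \<tau> \<theta>)"
    and der: "\<And>\<tau> \<theta>. ((\<lambda>\<tau>. f \<tau> \<theta>) has_vector_derivative f' \<tau> \<theta>) (at \<tau>)"
  shows "(segment_curve h f has_vector_derivative segment_curve h f' \<tau>) (at \<tau>)"
  unfolding has_vector_derivative_def has_derivative_within_alt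
proof (intro conjI allI impI bounded_linear_scaleR_left)
  fix e :: real assume e: "0 < e"
  obtain d where d: "d > 0"
    "\<And>\<sigma>. dist \<sigma> \<tau> < d \<Longrightarrow> dist (segment_curve h f' \<sigma>) (segment_curve h f' \<tau>) < e"
    using segment_curve_continuous[OF h f'] e unfolding continuous_on_iff by (metis UNIV_I)
  have "norm (segment_curve h f \<sigma> - segment_curve h f \<tau> - (\<sigma> - \<tau>) *\<^sub>R segment_curve h f' \<tau>)
      \<le> e * norm (\<sigma> - \<tau>)" if \<sigma>: "norm (\<sigma> - \<tau>) < d" for \<sigma>
  proof (rule norm_bound)
    fix \<theta>
    let ?c = "clamp (- h) 0 \<theta>"
    have "norm (f \<sigma> ?c - f \<tau> ?c - (\<sigma> - \<tau>) *\<^sub>R f' \<tau> ?c) \<le> norm (\<sigma> - \<tau>) * e"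
    proof (rule vector_differentiable_bound_linearization[where S = "ball \<tau> d"
          and f = "\<lambda>\<tau>. f \<tau> ?c" and f' = "\<lambda>\<tau>. f' \<tau> ?c" and ?x0.0 = \<tau> and B = e])
      show "((\<lambda>\<tau>. f \<tau> ?c) has_vector_derivative f' x ?c) (at x within ball \<tau> d)" for x
        by (rule has_vector_derivative_at_within[OF der])
      show "closed_segment \<tau> \<sigma> \<subseteq> ball \<tau> d"
        using \<sigma> d(1) by (intro closed_segment_subset) (auto simp: dist_norm norm_minus_commute)
      show "norm (f' x ?c - f' \<tau> ?c) \<le> e" if "x \<in> ball \<tau> d" for x
        using dist_bounded[of "segment_curve h f' x" \<theta> "segment_curve h f' \<tau>"] d(2)[of x] that
        by (simp add: segment_curve_apply[OF h f'] dist_norm[symmetric] dist_commute)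
    qed (use d(1) in simp)
    then show "norm (apply_bcontfun (segment_curve h f \<sigma> - segment_curve h f \<tau>
        - (\<sigma> - \<tau>) *\<^sub>R segment_curve h f' \<tau>) \<theta>) \<le> e * norm (\<sigma> - \<tau>)"
      by (simp add: segment_curve_apply[OF h f] segment_curve_apply[OF h f'] mult.commute)
  qed
  then show "\<exists>d>0. \<forall>y\<in>UNIV. norm (y - \<tau>) < d \<longrightarrow> norm (segment_curve h f y
      - segment_curve h f \<tau> - (y - \<tau>) *\<^sub>R segment_curve h f' \<tau>) \<le> e * norm (y - \<tau>)"
    using d(1) by blast
qed

lemma periodic_representative:
  fixes f :: "real \<Rightarrow> 'a"
  assumes T: "0 < T" and per: "\<And>t. f (t + T) = f t"
  obtains s where "s \<in> {0..T}" "f t = f s"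
proof -
  interpret periodic_fun_simple f T by standard (rule per)
  have "f (t - of_int \<lfloor>t / T\<rfloor> * T) = f t" by (rule minus_of_int)
  moreover have "of_int \<lfloor>t / T\<rfloor> * T \<le> t"
    by (subst pos_le_divide_eq[OF T, symmetric]) linarith
  moreover have "t \<le> (of_int \<lfloor>t / T\<rfloor> + 1) * T"
    by (subst pos_divide_le_eq[OF T, symmetric]) linarith
  ultimately have "f (t - of_int \<lfloor>t / T\<rfloor> * T) = f t" "t - of_int \<lfloor>t / T\<rfloor> * T \<in> {0..T}"
    by (simp_all add: distrib_right)
  then show ?thesis using that by metis
qed

lemma periodic_bounded:
  fixes f :: "real \<Rightarrow> 'a::metric_space"
  assumes T: "0 < T" and per: "\<And>t. f (t + T) = f t" and f: "continuous_on UNIV f"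
  shows "bounded (range f)"
proof (rule bounded_subset)
  show "bounded (f ` {0..T})"
    by (intro compact_imp_bounded compact_continuous_image continuous_on_subset[OF f]) auto
  show "range f \<subseteq> f ` {0..T}"
    using periodic_representative[of T f, OF T per] by blast
qed

section \<open>The linearization along the periodic solution\<close>

lemma subspace_Xspace: "subspace (Xspace h :: (real \<Rightarrow>\<^sub>C 'b::real_normed_vector) set)"
  unfolding subspace_def Xspace_def by (auto; metis)

text \<open>The projection of all bounded continuous functions onto \<^term>\<open>Xspace h\<close>. Derivatives given only
  in directions within \<^term>\<open>Xspace h\<close> are composed with it to become operators on the ambient
  space.\<close>

definition restrict_segment :: "real \<Rightarrow> (real \<Rightarrow>\<^sub>C 'b::real_normed_vector) \<Rightarrow> (real \<Rightarrow>\<^sub>C 'b)"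
  where "restrict_segment h u = segment_curve h (\<lambda>_. u) 0"

lemma restrict_segment_apply:
  assumes "0 < h" shows "apply_bcontfun (restrict_segment h u) \<theta> = u (clamp (- h) 0 \<theta>)"
proof -
  have "continuous_on UNIV (\<lambda>(\<tau>::real, \<theta>). apply_bcontfun u \<theta>)"
    unfolding split_beta
    by (rule continuous_on_compose2[OF continuous_on_apply_bcontfun[where T = UNIV] continuous_on_snd[OF continuous_on_id]]) simp
  from segment_curve_apply[OF assms this] show ?thesis by (simp add: restrict_segment_def)
qed

lemma restrict_segment:
  assumes h: "0 < h"
  shows "bounded_linear (restrict_segment h :: (real \<Rightarrow>\<^sub>C 'b::real_normed_vector) \<Rightarrow> _)"
    and "restrict_segment h u \<in> Xspace h"
    and "u \<in> Xspace h \<Longrightarrow> restrict_segment h u = u"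
    and "norm (restrict_segment h u) \<le> norm (u :: real \<Rightarrow>\<^sub>C 'b)"
proof -
  show n: "norm (restrict_segment h u) \<le> norm u" for u :: "real \<Rightarrow>\<^sub>C 'b"
    by (rule norm_bound) (simp add: restrict_segment_apply[OF h] norm_bounded)
  show "bounded_linear (restrict_segment h :: (real \<Rightarrow>\<^sub>C 'b) \<Rightarrow> _)"
    by (rule bounded_linear_intro[where K = 1])
       (auto intro!: bcontfun_eqI simp: restrict_segment_apply[OF h] n)
  show "restrict_segment h u \<in> Xspace h"
    using h by (simp add: Xspace_def restrict_segment_apply[OF h] clamp_real)
  show "restrict_segment h u = u" if "u \<in> Xspace h"
    using that by (intro bcontfun_eqI) (simp add: restrict_segment_apply[OF h] Xspace_def)
qed

text \<open>The derivative of \<open>f\<close> along the line through \<open>x\<close> in direction \<open>v\<close>, which stays in \<open>S\<close>, is both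
  \<open>f' v\<close> and \<open>f'' v\<close>.\<close>

lemma derivative_within_subspace_unique:
  assumes S: "subspace S" and x: "x \<in> S" and v: "v \<in> S"
    and f': "(f has_derivative f') (at x within S)" and f'': "(f has_derivative f'') (at x within S)"
  shows "f' v = f'' v"
proof -
  have *: "((\<lambda>t::real. f (x + t *\<^sub>R v)) has_vector_derivative g v) (at 0)"
    if g: "(f has_derivative g) (at x within S)" for g
  proof -
    have "range (\<lambda>t::real. x + t *\<^sub>R v) \<subseteq> S"
      using S x v by (auto intro: subspace_add subspace_scale)
    then have g': "(f has_derivative g) (at (x + 0 *\<^sub>R v) within range (\<lambda>t::real. x + t *\<^sub>R v))"
      using has_derivative_subset[OF g] by simp
    have "((\<lambda>t::real. x + t *\<^sub>R v) has_derivative (\<lambda>t. t *\<^sub>R v)) (at 0)"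
      by (auto intro!: derivative_eq_intros)
    from has_derivative_in_compose[OF this g']
    show ?thesis
      using linear_scale[OF has_derivative_linear[OF g]] by (simp add: has_vector_derivative_def)
  qed
  show ?thesis by (rule vector_derivative_unique_at[OF *[OF f'] *[OF f'']])
qed

text \<open>The first derivative is itself differentiable, with a bounded bilinear derivative, and hence
  continuous in operator norm.\<close>

lemma C_smooth_on_continuous_derivative:
  fixes F :: "'a::real_normed_vector \<Rightarrow> 'b::real_normed_vector"
  assumes F: "C_smooth_on m S F" and m: "2 \<le> m" and S: "subspace S"
    and p: "bounded_linear p" "\<And>x. p x \<in> S" "\<And>x. x \<in> S \<Longrightarrow> p x = x" "\<And>x. norm (p x) \<le> norm x"
  obtains N :: "'a \<Rightarrow> 'a \<Rightarrow>\<^sub>L 'b"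
  where "\<And>x. x \<in> S \<Longrightarrow> (F has_derivative blinfun_apply (N x)) (at x within S)" "continuous_on S N"
proof -
  obtain D :: "nat \<Rightarrow> 'a \<Rightarrow> 'a list \<Rightarrow> 'b" where
    D0: "\<And>x. x \<in> S \<Longrightarrow> D 0 x [] = F x"
    and mult: "\<And>j x. j \<le> m \<Longrightarrow> x \<in> S \<Longrightarrow> bounded_multilinear_on S j (D j x)"
    and der: "\<And>j x \<epsilon>. j < m \<Longrightarrow> x \<in> S \<Longrightarrow> 0 < \<epsilon> \<Longrightarrow> \<exists>\<delta>>0. \<forall>y\<in>S. norm (y - x) < \<delta> \<longrightarrow>
      (\<forall>vs\<in>lists S. length vs = j \<longrightarrow>
        norm (D j y vs - D j x vs - D (Suc j) x ((y - x) # vs))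
          \<le> \<epsilon> * norm (y - x) * prod_list (map norm vs))"
    using F unfolding C_smooth_on_def by metis
  have bl: "bounded_linear (\<lambda>v. D 1 x [p v])" if x: "x \<in> S" for x
  proof -
    have M: "bounded_multilinear_on S 1 (D 1 x)" using mult[of 1 x] m x by simp
    then obtain C where C: "\<And>vs. vs \<in> lists S \<Longrightarrow> length vs = 1 \<Longrightarrow>
        norm (D 1 x vs) \<le> C * prod_list (map norm vs)"
      unfolding bounded_multilinear_on_def by blast
    have C': "norm (D 1 x [p v]) \<le> norm v * max C 0" for v
    proof -
      have "norm (D 1 x [p v]) \<le> C * norm (p v)" using C[of "[p v]"] p(2) by simp
      also have "\<dots> \<le> max C 0 * norm (p v)" by (intro mult_right_mono) auto
      also have "\<dots> \<le> max C 0 * norm v" by (intro mult_left_mono p(4)) auto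
      finally show ?thesis by (simp add: mult.commute)
    qed
    have comb: "D 1 x [a *\<^sub>R v + b *\<^sub>R w] = a *\<^sub>R D 1 x [v] + b *\<^sub>R D 1 x [w]"
      if "v \<in> S" "w \<in> S" for a b v w
    proof -
      have "D 1 x ([v][0 := a *\<^sub>R v + b *\<^sub>R w]) = a *\<^sub>R D 1 x ([v][0 := v]) + b *\<^sub>R D 1 x ([v][0 := w])"
        using M that unfolding bounded_multilinear_on_def
        by (metis length_Cons list.size(3) One_nat_def Cons_in_lists_iff lists.Nil zero_less_one)
      then show ?thesis by simp
    qed
    show ?thesis
    proof (rule bounded_linear_intro[OF _ _ C'])
      fix v w and r :: real
      show "D 1 x [p (v + w)] = D 1 x [p v] + D 1 x [p w]"
        using comb[OF p(2) p(2), of 1 v 1 w] by (simp add: linear_add[OF bounded_linear.linear[OF p(1)]])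
      show "D 1 x [p (r *\<^sub>R v)] = r *\<^sub>R D 1 x [p v]"
        using comb[OF p(2) p(2), of r v 0 v] by (simp add: linear_scale[OF bounded_linear.linear[OF p(1)]])
    qed
  qed
  define N where "N x = Blinfun (\<lambda>v. D 1 x [p v])" for x
  have N: "blinfun_apply (N x) v = D 1 x [p v]" if "x \<in> S" for x v
    unfolding N_def bounded_linear_Blinfun_apply[OF bl[OF that]] ..
  have "(F has_derivative blinfun_apply (N x)) (at x within S)" if x: "x \<in> S" for x
    unfolding has_derivative_within_alt
  proof (intro conjI allI impI blinfun.bounded_linear_right)
    fix e :: real assume "0 < e"
    with der[of 0 x e] m x obtain d where d: "d > 0"
      "\<And>y. y \<in> S \<Longrightarrow> norm (y - x) < d \<Longrightarrow> norm (D 0 y [] - D 0 x [] - D 1 x [y - x]) \<le> e * norm (y - x)"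
      by auto
    have "p (y - x) = y - x" if "y \<in> S" for y using p(3) subspace_diff[OF S that x] .
    then show "\<exists>d>0. \<forall>y\<in>S. norm (y - x) < d \<longrightarrow>
        norm (F y - F x - blinfun_apply (N x) (y - x)) \<le> e * norm (y - x)"
      using d x by (intro exI[of _ d]) (auto simp: D0 N)
  qed
  moreover have "continuous_on S N"
    unfolding continuous_on_iff
  proof (intro ballI allI impI)
    fix x and e :: real assume x: "x \<in> S" and e: "0 < e"
    have "bounded_multilinear_on S 2 (D 2 x)" using mult[of 2 x] m x by simp
    then have "\<exists>C. \<forall>vs\<in>lists S. length vs = 2 \<longrightarrow> norm (D 2 x vs) \<le> C * prod_list (map norm vs)"
      unfolding bounded_multilinear_on_def by (rule conjunct2)
    then obtain C where C2: "\<And>vs. vs \<in> lists S \<Longrightarrow> length vs = 2 \<Longrightarrow>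
        norm (D 2 x vs) \<le> C * prod_list (map norm vs)"
      by blast
    have C: "norm (D 2 x [v, w]) \<le> max C 0 * (norm v * norm w)" if "v \<in> S" "w \<in> S" for v w
    proof -
      have "norm (D 2 x [v, w]) \<le> C * (norm v * norm w)" using C2[of "[v, w]"] that by simp
      also have "\<dots> \<le> max C 0 * (norm v * norm w)" by (intro mult_right_mono) auto
      finally show ?thesis .
    qed
    obtain d where d: "d > 0" "\<And>y vs. y \<in> S \<Longrightarrow> norm (y - x) < d \<Longrightarrow> vs \<in> lists S \<Longrightarrow> length vs = 1 \<Longrightarrow>
        norm (D 1 y vs - D 1 x vs - D 2 x ((y - x) # vs)) \<le> 1 * norm (y - x) * prod_list (map norm vs)"
      using der[of 1 x 1] m x by (auto simp: numeral_2_eq_2)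
    \<comment> \<open>The expansion of the first derivative with error constant 1, plus the bound \<open>C\<close> of the second one.\<close>
    have N_diff: "norm (N y - N x) \<le> (1 + max C 0) * norm (y - x)"
      if y: "y \<in> S" "norm (y - x) < d" for y
    proof (rule norm_blinfun_bound)
      fix v
      have yx: "y - x \<in> S" by (rule subspace_diff[OF S y(1) x])
      have "norm (D 1 y [p v] - D 1 x [p v]) \<le>
          norm (D 1 y [p v] - D 1 x [p v] - D 2 x [y - x, p v]) + norm (D 2 x [y - x, p v])"
        by (metis diff_add_cancel norm_triangle_ineq)
      also have "\<dots> \<le> norm (y - x) * norm (p v) + max C 0 * (norm (y - x) * norm (p v))"
        using d(2)[OF y, of "[p v]"] C[OF yx p(2), of v] p(2) by (intro add_mono) auto
      also have "\<dots> = (1 + max C 0) * norm (y - x) * norm (p v)" by (simp add: algebra_simps)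
      also have "\<dots> \<le> (1 + max C 0) * norm (y - x) * norm v"
        by (intro mult_left_mono p(4)) auto
      finally show "norm (blinfun_apply (N y - N x) v) \<le> (1 + max C 0) * norm (y - x) * norm v"
        by (simp add: blinfun.diff_left N x y)
    qed auto
    show "\<exists>d>0. \<forall>y\<in>S. dist y x < d \<longrightarrow> dist (N y) (N x) < e"
    proof (intro exI[of _ "min d (e / (1 + max C 0))"] conjI ballI impI)
      show "0 < min d (e / (1 + max C 0))" using d(1) e by simp
      fix y assume y: "y \<in> S" "dist y x < min d (e / (1 + max C 0))"
      then have "(1 + max C 0) * norm (y - x) < e"
        by (simp add: dist_norm pos_less_divide_eq mult.commute)
      with N_diff[of y] y show "dist (N y) (N x) < e" by (simp add: dist_norm)
    qed
  qed
  ultimately show ?thesis by (rule that)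
qed

definition Re_vec :: "complex^'n \<Rightarrow> real^'n" where "Re_vec z = (\<chi> j. Re (z $ j))"
definition Im_vec :: "complex^'n \<Rightarrow> real^'n" where "Im_vec z = (\<chi> j. Im (z $ j))"
definition Complex_vec :: "(real^'n) \<times> (real^'n) \<Rightarrow> complex^'n"
  where "Complex_vec p = (\<chi> i. Complex (fst p $ i) (snd p $ i))"

lemma bounded_linear_vec:
  "bounded_linear (Re_vec :: complex^'n \<Rightarrow> _)" "bounded_linear (Im_vec :: complex^'n \<Rightarrow> _)"
  "bounded_linear (Complex_vec :: (real^'n) \<times> _ \<Rightarrow> _)"
  unfolding linear_conv_bounded_linear[symmetric]
  by (auto intro!: linearI simp: Re_vec_def Im_vec_def Complex_vec_def vec_eq_iff complex_eq_iff)

text \<open>Complexification is sandwiched between bounded real-linear maps, so bounds and continuity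
  carry over from \<open>M\<close>.\<close>

lemma complexification_eq:
  "complexification M u = Complex_vec (M (map_bcontfun Re_vec u), M (map_bcontfun Im_vec u))"
  by (simp add: complexification_def map_bcontfun_def Re_vec_def Im_vec_def Complex_vec_def)

lemma map_bcontfun_in_Xspace: "bounded_linear f \<Longrightarrow> u \<in> Xspace h \<Longrightarrow> map_bcontfun f u \<in> Xspace h"
  by (simp add: Xspace_def map_bcontfun_apply)

lemma complexification_add:
  assumes "linear M" shows "complexification M (u + v) = complexification M u + complexification M v"
  by (simp add: complexification_eq linear_add[OF assms]
      linear_add[OF bounded_linear.linear[OF bounded_linear_map_bcontfun[OF bounded_linear_vec(1)]]]
      linear_add[OF bounded_linear.linear[OF bounded_linear_map_bcontfun[OF bounded_linear_vec(2)]]]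
      linear_add[OF bounded_linear.linear[OF bounded_linear_vec(3)], symmetric])

lemma complexification_scale:
  fixes M :: "(real \<Rightarrow>\<^sub>C (real^'n)) \<Rightarrow> real^'n"
  assumes "linear M" shows "complexification M (c *\<^sub>C u) = c *\<^sub>C complexification M u"
proof -
  have re: "map_bcontfun Re_vec (c *\<^sub>C u) = Re c *\<^sub>R map_bcontfun Re_vec u - Im c *\<^sub>R map_bcontfun Im_vec u"
    and im: "map_bcontfun Im_vec (c *\<^sub>C u) = Re c *\<^sub>R map_bcontfun Im_vec u + Im c *\<^sub>R map_bcontfun Re_vec u"
    by (rule bcontfun_eqI, simp add: map_bcontfun_apply[OF bounded_linear_vec(1)] map_bcontfun_apply[OF bounded_linear_vec(2)]
        Re_vec_def Im_vec_def vec_eq_iff scaleC_vec_def scaleC_complex_def)+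
  show ?thesis
    unfolding complexification_eq re im linear_add[OF assms] linear_diff[OF assms] linear_scale[OF assms]
    by (simp add: Complex_vec_def vec_eq_iff scaleC_vec_def scaleC_complex_def complex_eq_iff)
qed

lemma history_eq_segment_curve: "history h x = segment_curve h (\<lambda>\<tau> \<theta>. x (\<tau> + \<theta>))"
  by (rule ext) (simp add: history_def segment_curve_def)

text \<open>On \<^term>\<open>Xspace h\<close> the chosen derivative agrees with \<open>N (\<gamma>\<^sub>\<tau>)\<close> for a map \<open>N\<close> that is
  continuous in operator norm. Being continuous and periodic in \<open>\<tau>\<close>, it is bounded.\<close>

lemma delay_family_linearization:
  fixes F :: "(real \<Rightarrow>\<^sub>C (real^'n)) \<Rightarrow> real^'n" and \<gamma> :: "real \<Rightarrow> real^'n"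
  assumes h: "0 < h" and F: "C_smooth_on m (Xspace h) F" and m: "2 \<le> m"
    and \<gamma>: "continuous_on UNIV \<gamma>" and T: "0 < T" and per: "\<And>t. \<gamma> (t + T) = \<gamma> t"
  shows "delay_family h T (linearization h F \<gamma>)"
proof -
  let ?X = "Xspace h :: (real \<Rightarrow>\<^sub>C (real^'n)) set"
  obtain N :: "(real \<Rightarrow>\<^sub>C (real^'n)) \<Rightarrow> (real \<Rightarrow>\<^sub>C (real^'n)) \<Rightarrow>\<^sub>L (real^'n)" where
    N: "\<And>x. x \<in> ?X \<Longrightarrow> (F has_derivative blinfun_apply (N x)) (at x within ?X)" "continuous_on ?X N"
    by (rule C_smooth_on_continuous_derivative[OF F m subspace_Xspace restrict_segment(1)[OF h]
        restrict_segment(2)[OF h] restrict_segment(3)[OF h] restrict_segment(4)[OF h]]) (assumption, rule that)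
  have \<gamma>2: "continuous_on UNIV (\<lambda>(\<tau>, \<theta>). \<gamma> (\<tau> + \<theta>))"
    unfolding split_beta
    by (rule continuous_on_compose2[OF \<gamma>]) (auto intro!: continuous_intros)
  have hist: "history h \<gamma> \<tau> \<in> ?X" for \<tau>
    unfolding history_eq_segment_curve by (rule segment_curve_in_Xspace[OF h \<gamma>2])
  have hist_cont: "continuous_on UNIV (history h \<gamma>)"
    unfolding history_eq_segment_curve by (rule segment_curve_continuous[OF h \<gamma>2])
  have hist_per: "history h \<gamma> (\<tau> + T) = history h \<gamma> \<tau>" for \<tau>
    using per[of "\<tau> + clamp (- h) 0 \<theta>" for \<theta>] by (simp add: history_def add_ac)
  define N\<gamma> where "N\<gamma> \<tau> = N (history h \<gamma> \<tau>)" for \<tau>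
  have N\<gamma>_cont: "continuous_on UNIV N\<gamma>"
    unfolding N\<gamma>_def by (rule continuous_on_compose2[OF N(2) hist_cont]) (use hist in auto)
  have "bounded (range N\<gamma>)"
    by (rule periodic_bounded[OF T _ N\<gamma>_cont]) (simp add: N\<gamma>_def hist_per)
  then obtain B where B: "\<And>\<tau>. norm (N\<gamma> \<tau>) \<le> B" by (auto simp: bounded_iff)
  define M where "M \<tau> = frechet_derivative F (at (history h \<gamma> \<tau>) within ?X)" for \<tau>
  have M: "(F has_derivative M \<tau>) (at (history h \<gamma> \<tau>) within ?X)" for \<tau>
    unfolding M_def frechet_derivative_works[symmetric] using N(1)[OF hist] by (rule differentiableI)
  have lin: "linear (M \<tau>)" for \<tau> by (rule has_derivative_linear[OF M])
  have MN: "M \<tau> u = N\<gamma> \<tau> u" if "u \<in> ?X" for \<tau> u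
    unfolding N\<gamma>_def
    by (rule derivative_within_subspace_unique[OF subspace_Xspace hist that M N(1)[OF hist]])
  have L: "linearization h F \<gamma> \<tau> = complexification (M \<tau>)" for \<tau>
    by (simp add: linearization_def M_def)
  have L_eq: "linearization h F \<gamma> \<tau> u = Complex_vec (N\<gamma> \<tau> (map_bcontfun Re_vec u), N\<gamma> \<tau> (map_bcontfun Im_vec u))"
    if "u \<in> Xspace h" for \<tau> u
    unfolding L complexification_eq using that by (simp add: MN map_bcontfun_in_Xspace bounded_linear_vec)
  note blR = bounded_linear_map_bcontfun[OF bounded_linear_vec(1), where 'c = real]
  note blI = bounded_linear_map_bcontfun[OF bounded_linear_vec(2), where 'c = real]
  show ?thesis
  proof
    show "0 < h" "0 < T" by fact+
    show "linearization h F \<gamma> \<tau> (u + v) = linearization h F \<gamma> \<tau> u + linearization h F \<gamma> \<tau> v"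
      for \<tau> u v unfolding L by (rule complexification_add[OF lin])
    show "linearization h F \<gamma> \<tau> (c *\<^sub>C u) = c *\<^sub>C linearization h F \<gamma> \<tau> u" for \<tau> u c
      unfolding L by (rule complexification_scale[OF lin])
    show "linearization h F \<gamma> (\<tau> + T) u = linearization h F \<gamma> \<tau> u" for \<tau> u
      by (simp add: linearization_def hist_per)
    obtain K where K: "0 < K" "\<And>p :: (real^'n) \<times> (real^'n). norm (Complex_vec p) \<le> norm p * K"
      using bounded_linear.pos_bounded[OF bounded_linear_vec(3)] by blast
    obtain KR where KR: "0 < KR" "\<And>u :: real \<Rightarrow>\<^sub>C (complex^'n). norm (map_bcontfun Re_vec u) \<le> norm u * KR"
      using bounded_linear.pos_bounded[OF blR] by blast
    obtain KI where KI: "0 < KI" "\<And>u :: real \<Rightarrow>\<^sub>C (complex^'n). norm (map_bcontfun Im_vec u) \<le> norm u * KI"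
      using bounded_linear.pos_bounded[OF blI] by blast
    have "norm (linearization h F \<gamma> \<tau> u) \<le> ((B * KR + B * KI) * K) * norm u"
      if u: "u \<in> Xspace h" for \<tau> u
    proof -
      have B0: "0 \<le> B" using B[of 0] norm_ge_zero order_trans by blast
      have "norm (N\<gamma> \<tau> v) \<le> B * norm v" for v
        using norm_blinfun[of "N\<gamma> \<tau>" v] mult_right_mono[OF B norm_ge_zero] order_trans by blast
      then have "norm (N\<gamma> \<tau> (map_bcontfun Re_vec u)) \<le> B * (norm u * KR)"
        "norm (N\<gamma> \<tau> (map_bcontfun Im_vec u)) \<le> B * (norm u * KI)"
        using mult_left_mono[OF KR(2) B0, of u] mult_left_mono[OF KI(2) B0, of u] order_trans by blast+
      then have "norm (N\<gamma> \<tau> (map_bcontfun Re_vec u), N\<gamma> \<tau> (map_bcontfun Im_vec u)) \<le> B * (norm u * KR) + B * (norm u * KI)"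
        using norm_Pair_le[of "N\<gamma> \<tau> (map_bcontfun Re_vec u)" "N\<gamma> \<tau> (map_bcontfun Im_vec u)"] by linarith
      then have "norm (N\<gamma> \<tau> (map_bcontfun Re_vec u), N\<gamma> \<tau> (map_bcontfun Im_vec u)) * K
          \<le> (B * (norm u * KR) + B * (norm u * KI)) * K"
        using K(1) by (intro mult_right_mono) auto
      with K(2) show ?thesis
        unfolding L_eq[OF u] by (rule order_trans[THEN order_trans]) (simp add: algebra_simps)
    qed
    then show "\<exists>C. \<forall>\<tau>. \<forall>u\<in>Xspace h. norm (linearization h F \<gamma> \<tau> u) \<le> C * norm u" by blast
    show "continuous_on UNIV (\<lambda>\<tau>. linearization h F \<gamma> \<tau> (\<phi> \<tau>))"
      if \<phi>: "\<phi> \<in> C_per T (Xspace h)" for \<phi>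
    proof -
      have "\<phi> \<tau> \<in> Xspace h" for \<tau> using \<phi> by (simp add: C_per_def)
      then have "(\<lambda>\<tau>. linearization h F \<gamma> \<tau> (\<phi> \<tau>)) =
          (\<lambda>\<tau>. Complex_vec (N\<gamma> \<tau> (map_bcontfun Re_vec (\<phi> \<tau>)), N\<gamma> \<tau> (map_bcontfun Im_vec (\<phi> \<tau>))))"
        by (simp add: L_eq)
      then show ?thesis
        by (simp only:) (intro bounded_linear.continuous_on[OF bounded_linear_vec(3)] continuous_on_Pair
            bounded_bilinear.continuous_on[OF bounded_bilinear_blinfun_apply] N\<gamma>_cont bounded_linear.continuous_on[OF blR]
            bounded_linear.continuous_on[OF blI] continuous_on_apply_bcontfun)
    qed
  qed
qed

section \<open>Waves\<close>

text \<open>Only differences of values of the primitive enter, so its additive constant is immaterial.\<close>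

definition primitive :: "(real \<Rightarrow>\<^sub>C 'v::euclidean_space) \<Rightarrow> real \<Rightarrow> 'v"
  where "primitive r = (SOME Q. \<forall>t. (Q has_vector_derivative r t) (at t))"

lemma primitive_derivative: "(primitive r has_vector_derivative r t) (at t)"
proof -
  obtain U where "\<And>t. (U has_vector_derivative r t) (at t)"
    by (rule continuous_antiderivative[OF continuous_on_apply_bcontfun[of UNIV r]]) (rule that)
  then have "\<exists>U. \<forall>t. (U has_vector_derivative r t) (at t)" by blast
  from someI_ex[OF this] have "\<forall>t. (primitive r has_vector_derivative r t) (at t)"
    unfolding primitive_def .
  then show ?thesis ..
qed

lemma primitive_continuous: "continuous_on A (primitive r)"
  by (intro continuous_at_imp_continuous_on ballI has_vector_derivative_continuous[OF primitive_derivative])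

lemma primitive_dist:
  "norm ((primitive r (\<tau> + \<theta>) - primitive r \<tau>) - (primitive s (\<tau> + \<theta>) - primitive s \<tau>))
    \<le> \<bar>\<theta>\<bar> * dist r s"
proof -
  let ?f = "\<lambda>t. primitive r t - primitive s t"
  have der: "(?f has_vector_derivative (r t - s t)) (at t)" for t
    by (intro has_vector_derivative_diff primitive_derivative)
  have "norm (?f (\<tau> + \<theta>) - ?f \<tau>) \<le> dist r s * norm (\<tau> + \<theta> - \<tau>)"
  proof (rule differentiable_bound[of UNIV ?f "\<lambda>t x. x *\<^sub>R (r t - s t)"])
    show "(?f has_derivative (\<lambda>x. x *\<^sub>R (r t - s t))) (at t within UNIV)" for t
      using der by (simp add: has_vector_derivative_def)
    show "onorm (\<lambda>x. x *\<^sub>R (r t - s t)) \<le> dist r s" for t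
      using dist_bounded[of r t s]
      by (intro onorm_scaleR_left_le) (simp add: dist_norm)
  qed auto
  then show ?thesis by (simp add: algebra_simps)
qed

lemma primitive_periodic:
  assumes "r \<in> C_per T E"
  shows "primitive r (t + T) - primitive r (s + T) = primitive r t - primitive r s"
proof -
  let ?f = "\<lambda>t. primitive r (t + T) - primitive r t"
  have shift: "((\<lambda>t. primitive r (t + T)) has_vector_derivative r (t + T)) (at t)" for t
  proof -
    have "((\<lambda>t. t + T) has_vector_derivative 1) (at t)"
      by (auto intro!: derivative_eq_intros simp: has_vector_derivative_def)
    from vector_diff_chain_at[OF this primitive_derivative] show ?thesis by (simp add: o_def)
  qed
  have "(?f has_vector_derivative 0) (at t)" for t
    using has_vector_derivative_diff[OF shift[of t] primitive_derivative[of r t]] assms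
    by (simp add: C_per_def)
  then have "(?f has_derivative (\<lambda>_. 0)) (at t within UNIV)" for t
    by (simp add: has_vector_derivative_def)
  from has_derivative_zero_unique[OF convex_UNIV this UNIV_I UNIV_I, of t s]
  show ?thesis by (simp add: algebra_simps)
qed

text \<open>The second summand of the wave is \<open>exp (\<rho> * \<theta>)\<close> times the integral of \<open>r\<close> from \<open>\<tau>\<close> to \<open>\<tau> + \<theta>\<close>. It is
  continuously differentiable in \<open>\<tau>\<close> and \<open>\<theta>\<close> even when \<open>r\<close> is merely continuous, it vanishes at \<open>\<theta> = 0\<close>
  with derivative \<open>r \<tau>\<close> there, and its supremum over \<open>\<theta> \<le> 0\<close> is at most \<open>1 / \<rho>\<close> times that of
  \<open>r\<close>. It serves to correct the boundary condition at \<open>\<theta> = 0\<close>.\<close>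

definition wave :: "real \<Rightarrow> (real \<Rightarrow>\<^sub>C 'v) \<Rightarrow> (real \<Rightarrow>\<^sub>C 'v) \<Rightarrow> real \<Rightarrow> real \<Rightarrow> 'v::euclidean_space"
  where "wave \<rho> g r \<tau> \<theta> =
    \<theta> *\<^sub>R g (\<tau> + \<theta>) + exp (\<rho> * \<theta>) *\<^sub>R (primitive r (\<tau> + \<theta>) - primitive r \<tau>)"

text \<open>This is the \<open>\<theta>\<close>-derivative minus the \<open>\<tau>\<close>-derivative of \<^const>\<open>wave\<close> for differentiable \<open>g\<close>; the terms
  with the derivative of \<open>g\<close> cancel, which is what makes sense of it for continuous \<open>g\<close>.\<close>

definition wave_image :: "real \<Rightarrow> (real \<Rightarrow>\<^sub>C 'v) \<Rightarrow> (real \<Rightarrow>\<^sub>C 'v) \<Rightarrow> real \<Rightarrow> real \<Rightarrow> 'v::euclidean_space"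
  where "wave_image \<rho> g r \<tau> \<theta> =
    g (\<tau> + \<theta>) + exp (\<rho> * \<theta>) *\<^sub>R (\<rho> *\<^sub>R (primitive r (\<tau> + \<theta>) - primitive r \<tau>) + r \<tau>)"

lemma continuous_on_add_args:
  assumes "continuous_on UNIV f"
  shows "continuous_on UNIV (\<lambda>p::real \<times> real. f (fst p + snd p))"
    and "continuous_on UNIV (\<lambda>p::real \<times> real. f (fst p))"
  by (rule continuous_on_compose2[OF assms]; auto intro!: continuous_intros)+

lemma wave_continuous:
  "continuous_on UNIV (\<lambda>(\<tau>, \<theta>). wave \<rho> g r \<tau> \<theta>)"
  "continuous_on UNIV (\<lambda>(\<tau>, \<theta>). wave_image \<rho> g r \<tau> \<theta>)"
  unfolding wave_def wave_image_def split_beta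
  by (intro continuous_intros continuous_on_add_args primitive_continuous continuous_on_apply_bcontfun)+

lemma wave_periodic:
  assumes "g \<in> C_per T UNIV" "r \<in> C_per T UNIV"
  shows "wave \<rho> g r (\<tau> + T) \<theta> = wave \<rho> g r \<tau> \<theta>"
    and "wave_image \<rho> g r (\<tau> + T) \<theta> = wave_image \<rho> g r \<tau> \<theta>"
proof -
  have eq: "\<tau> + T + \<theta> = (\<tau> + \<theta>) + T" by simp
  show "wave \<rho> g r (\<tau> + T) \<theta> = wave \<rho> g r \<tau> \<theta>"
    "wave_image \<rho> g r (\<tau> + T) \<theta> = wave_image \<rho> g r \<tau> \<theta>"
    using assms unfolding wave_def wave_image_def eq primitive_periodic[OF assms(2)]
    by (simp_all add: C_per_def)
qed

lemma mult_exp_le_one: "0 \<le> x \<Longrightarrow> x * exp (- x) \<le> 1" for x :: real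
proof -
  have "x \<le> exp x" using exp_ge_add_one_self[of x] by linarith
  then show ?thesis by (simp add: exp_minus field_simps)
qed

text \<open>The weight \<open>exp (\<rho> * \<theta>)\<close> gains the factor \<open>1 / \<rho>\<close> in the first estimate because
  \<open>\<rho> * \<bar>\<theta>\<bar> * exp (\<rho> * \<theta>) \<le> 1\<close>. In the image that factor is lost again to the \<open>\<rho>\<close> produced by
  differentiating the weight, but a bound independent of \<open>\<rho>\<close> remains.\<close>

lemma wave_dist:
  assumes \<rho>: "0 < \<rho>" and \<theta>: "\<theta> \<in> {-h..0}"
  shows "norm (wave \<rho> g r \<tau> \<theta> - wave \<rho> g' r' \<tau> \<theta>) \<le> h * dist g g' + dist r r' / \<rho>"
    and "norm (wave_image \<rho> g r \<tau> \<theta> - wave_image \<rho> g' r' \<tau> \<theta>) \<le> dist g g' + 2 * dist r r'"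
proof -
  define P where "P = (primitive r (\<tau> + \<theta>) - primitive r \<tau>) - (primitive r' (\<tau> + \<theta>) - primitive r' \<tau>)"
  have P: "norm P \<le> \<bar>\<theta>\<bar> * dist r r'" unfolding P_def by (rule primitive_dist)
  have g: "norm (g t - g' t) \<le> dist g g'" for t using dist_bounded[of g t g'] by (simp add: dist_norm)
  have r: "norm (r t - r' t) \<le> dist r r'" for t using dist_bounded[of r t r'] by (simp add: dist_norm)
  have e: "\<rho> * \<bar>\<theta>\<bar> * exp (\<rho> * \<theta>) \<le> 1"
    using mult_exp_le_one[of "\<rho> * \<bar>\<theta>\<bar>"] \<rho> \<theta> by simp
  have "\<rho> * norm (exp (\<rho> * \<theta>) *\<^sub>R P) = \<rho> * exp (\<rho> * \<theta>) * norm P" by simp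
  also have "\<dots> \<le> \<rho> * exp (\<rho> * \<theta>) * (\<bar>\<theta>\<bar> * dist r r')"
    using \<rho> by (intro mult_left_mono P) auto
  also have "\<dots> = (\<rho> * \<bar>\<theta>\<bar> * exp (\<rho> * \<theta>)) * dist r r'" by (simp add: mult_ac)
  also have "\<dots> \<le> 1 * dist r r'" by (intro mult_right_mono e) auto
  finally have P': "\<rho> * norm (exp (\<rho> * \<theta>) *\<^sub>R P) \<le> dist r r'" by simp
  have "wave \<rho> g r \<tau> \<theta> - wave \<rho> g' r' \<tau> \<theta> = \<theta> *\<^sub>R (g (\<tau> + \<theta>) - g' (\<tau> + \<theta>)) + exp (\<rho> * \<theta>) *\<^sub>R P"
    by (simp add: wave_def P_def algebra_simps)
  also have "norm \<dots> \<le> \<bar>\<theta>\<bar> * norm (g (\<tau> + \<theta>) - g' (\<tau> + \<theta>)) + norm (exp (\<rho> * \<theta>) *\<^sub>R P)"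
    by (metis norm_scaleR norm_triangle_ineq)
  also have "\<dots> \<le> h * dist g g' + dist r r' / \<rho>"
    using \<theta> P' \<rho> by (intro add_mono mult_mono g) (auto simp: pos_le_divide_eq mult.commute)
  finally show "norm (wave \<rho> g r \<tau> \<theta> - wave \<rho> g' r' \<tau> \<theta>) \<le> h * dist g g' + dist r r' / \<rho>" .
  have "wave_image \<rho> g r \<tau> \<theta> - wave_image \<rho> g' r' \<tau> \<theta> = (g (\<tau> + \<theta>) - g' (\<tau> + \<theta>))
      + (\<rho> *\<^sub>R (exp (\<rho> * \<theta>) *\<^sub>R P) + exp (\<rho> * \<theta>) *\<^sub>R (r \<tau> - r' \<tau>))"
    by (simp add: wave_image_def P_def algebra_simps)
  also have "norm \<dots> \<le> norm (g (\<tau> + \<theta>) - g' (\<tau> + \<theta>))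
      + (norm (\<rho> *\<^sub>R (exp (\<rho> * \<theta>) *\<^sub>R P)) + norm (exp (\<rho> * \<theta>) *\<^sub>R (r \<tau> - r' \<tau>)))"
    by (intro norm_triangle_le add_left_mono norm_triangle_ineq)
  also have "\<dots> \<le> dist g g' + (dist r r' + dist r r')"
  proof (intro add_mono g)
    show "norm (\<rho> *\<^sub>R (exp (\<rho> * \<theta>) *\<^sub>R P)) \<le> dist r r'"
      using P' \<rho> by simp
    have "exp (\<rho> * \<theta>) \<le> 1" using \<rho> \<theta> by (simp add: mult_nonneg_nonpos)
    then have "exp (\<rho> * \<theta>) * norm (r \<tau> - r' \<tau>) \<le> 1 * dist r r'"
      by (intro mult_mono r) auto
    then show "norm (exp (\<rho> * \<theta>) *\<^sub>R (r \<tau> - r' \<tau>)) \<le> dist r r'" by simp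
  qed
  finally show "norm (wave_image \<rho> g r \<tau> \<theta> - wave_image \<rho> g' r' \<tau> \<theta>) \<le> dist g g' + 2 * dist r r'"
    by simp
qed

definition periodic_curve :: "real \<Rightarrow> (real \<Rightarrow> real \<Rightarrow> 'v::real_normed_vector) \<Rightarrow> real \<Rightarrow>\<^sub>C real \<Rightarrow>\<^sub>C 'v"
  where "periodic_curve h f = Bcontfun (segment_curve h f)"

lemma periodic_curve:
  assumes h: "0 < h" and T: "0 < T" and f: "continuous_on UNIV (\<lambda>(\<tau>, \<theta>). f \<tau> \<theta>)"
    and per: "\<And>\<tau> \<theta>. f (\<tau> + T) \<theta> = f \<tau> \<theta>"
  shows "apply_bcontfun (periodic_curve h f) = segment_curve h f"
    and "periodic_curve h f \<in> C_per T (Xspace h)"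
proof -
  have p: "segment_curve h f (\<tau> + T) = segment_curve h f \<tau>" for \<tau>
    by (simp add: segment_curve_def per)
  have "segment_curve h f \<in> bcontfun"
    using periodic_bounded[OF T p segment_curve_continuous[OF h f]] segment_curve_continuous[OF h f]
    by (simp add: bcontfun_def)
  then show eq: "apply_bcontfun (periodic_curve h f) = segment_curve h f"
    by (simp add: periodic_curve_def Bcontfun_inverse)
  show "periodic_curve h f \<in> C_per T (Xspace h)"
    using p segment_curve_in_Xspace[OF h f] by (simp add: C_per_def eq)
qed

lemma segment_curve_dist:
  assumes h: "0 < h" and f: "continuous_on UNIV (\<lambda>(\<tau>, \<theta>). f \<tau> \<theta>)"
    and g: "continuous_on UNIV (\<lambda>(\<tau>, \<theta>). g \<tau> \<theta>)"
    and le: "\<And>\<theta>. \<theta> \<in> {-h..0} \<Longrightarrow> norm (f \<tau> \<theta> - g \<tau> \<theta>) \<le> B"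
  shows "norm (segment_curve h f \<tau> - segment_curve h g \<tau>) \<le> B"
proof (rule norm_bound)
  fix \<theta>
  have "clamp (- h) 0 \<theta> \<in> {-h..0}" using h by (auto simp: clamp_real)
  then show "norm (apply_bcontfun (segment_curve h f \<tau> - segment_curve h g \<tau>) \<theta>) \<le> B"
    using le by (simp add: segment_curve_apply[OF h f] segment_curve_apply[OF h g])
qed

lemma bounded_linear_eval: "bounded_linear (\<lambda>\<phi>. apply_bcontfun \<phi> x)"
  by (rule bounded_linear_intro[where K = 1]) (auto simp: norm_bounded)

lemma complete_C_per: "complete (C_per T UNIV :: (real \<Rightarrow>\<^sub>C 'v::{complex_normed_vector, complete_space}) set)"
proof -
  have "C_per T UNIV = (\<Inter>\<tau>. {\<phi> :: real \<Rightarrow>\<^sub>C 'v. \<phi> (\<tau> + T) = \<phi> \<tau>})" by (auto simp: C_per_def)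
  also have "closed \<dots>"
    by (intro closed_INT ballI closed_Collect_eq linear_continuous_on bounded_linear_eval)
  finally show ?thesis by (simp add: complete_eq_closed)
qed

section \<open>Waves that satisfy the boundary condition\<close>

context delay_family
begin

lemma L_diff:
  assumes "u \<in> Xspace h" "v \<in> Xspace h" shows "L \<tau> u - L \<tau> v = L \<tau> (u - v)"
proof -
  have v: "(-1) *\<^sub>C v \<in> Xspace h"
    by (rule cvec.subspace_scale[OF csubspace_Xspace assms(2)])
  have "u - v = u + (-1) *\<^sub>C v" by simp
  then show ?thesis using L_add[OF assms(1) v] L_scale[OF assms(2), of \<tau> "-1"] by simp
qed

text \<open>The bound is taken to be at least 1, so that \<open>rate\<close> below is positive and can be divided by.\<close>

definition L_bound :: real
  where "L_bound = (SOME C. 1 \<le> C \<and> (\<forall>\<tau>. \<forall>u\<in>Xspace h. norm (L \<tau> u) \<le> C * norm u))"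

lemma L_bound: "1 \<le> L_bound" "u \<in> Xspace h \<Longrightarrow> norm (L \<tau> u) \<le> L_bound * norm u"
proof -
  obtain C where C: "\<And>\<tau> u. u \<in> Xspace h \<Longrightarrow> norm (L \<tau> u) \<le> C * norm u"
    using L_bounded by blast
  have "norm (L \<tau> u) \<le> max C 1 * norm u" if "u \<in> Xspace h" for \<tau> u
    using C[OF that, of \<tau>] mult_right_mono[of C "max C 1" "norm u"] by simp
  then have "1 \<le> max C 1 \<and> (\<forall>\<tau>. \<forall>u\<in>Xspace h. norm (L \<tau> u) \<le> max C 1 * norm u)" by simp
  then have "1 \<le> L_bound \<and> (\<forall>\<tau>. \<forall>u\<in>Xspace h. norm (L \<tau> u) \<le> L_bound * norm u)"
    unfolding L_bound_def by (rule someI)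
  then show "1 \<le> L_bound" "u \<in> Xspace h \<Longrightarrow> norm (L \<tau> u) \<le> L_bound * norm u" by auto
qed

definition rate :: real where "rate = 2 * L_bound"

lemma rate: "0 < rate" using L_bound(1) by (simp add: rate_def)

abbreviation W where "W g r \<equiv> segment_curve h (wave rate g r)"

lemma W_in_Xspace: "W g r \<tau> \<in> Xspace h"
  by (rule segment_curve_in_Xspace[OF h wave_continuous(1)])

text \<open>The choice of \<^const>\<open>rate\<close> makes the coefficient of \<open>dist r r'\<close> equal to \<open>1 / 2\<close>.\<close>

lemma L_W_dist:
  "norm (L \<tau> (W g r \<tau>) - L \<tau> (W g' r' \<tau>)) \<le> L_bound * h * dist g g' + dist r r' / 2"
proof -
  have "norm (L \<tau> (W g r \<tau>) - L \<tau> (W g' r' \<tau>)) \<le> L_bound * norm (W g r \<tau> - W g' r' \<tau>)"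
    unfolding L_diff[OF W_in_Xspace W_in_Xspace]
    by (intro L_bound cvec.subspace_diff[OF csubspace_Xspace] W_in_Xspace)
  also have "\<dots> \<le> L_bound * (h * dist g g' + dist r r' / rate)"
    using L_bound(1)
    by (intro mult_left_mono segment_curve_dist[OF h] wave_continuous wave_dist[OF rate]) auto
  also have "\<dots> = L_bound * h * dist g g' + dist r r' / 2"
    using L_bound(1) by (simp add: rate_def field_simps)
  finally show ?thesis .
qed

text \<open>The \<open>\<theta>\<close>-derivative of the wave at \<open>\<theta> = 0\<close> is \<open>g \<tau> + r \<tau>\<close>, so the equation for \<open>r\<close> is the boundary
  condition in the domain of \<open>A(\<tau>)\<close>. It is a fixed point equation for a contraction on the
  continuous periodic functions; no derivative of \<open>g\<close> or of \<open>L\<close> is involved.\<close>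

lemma boundary_solution_exists:
  assumes g: "g \<in> C_per T UNIV"
  obtains r where "r \<in> C_per T UNIV" "\<And>\<tau>. L \<tau> (W g r \<tau>) = g \<tau> + r \<tau>"
proof -
  define \<Phi> where "\<Phi> r = Bcontfun (\<lambda>\<tau>. L \<tau> (W g r \<tau>) - g \<tau>)" for r
  have \<Phi>: "apply_bcontfun (\<Phi> r) \<tau> = L \<tau> (W g r \<tau>) - g \<tau>" "\<Phi> r \<in> C_per T UNIV"
    if r: "r \<in> C_per T UNIV" for r \<tau>
  proof -
    note curve = periodic_curve[OF h T wave_continuous(1)[of rate g r] wave_periodic(1)[OF g r]]
    have cont: "continuous_on UNIV (\<lambda>\<tau>. L \<tau> (W g r \<tau>) - g \<tau>)"
      using L_continuous[OF curve(2)] unfolding curve(1)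
      by (intro continuous_on_diff continuous_on_apply_bcontfun)
    have W_per: "W g r (\<tau> + T) = W g r \<tau>" for \<tau>
      using curve(2) by (simp add: C_per_def curve(1))
    have per: "L (\<tau> + T) (W g r (\<tau> + T)) - g (\<tau> + T) = L \<tau> (W g r \<tau>) - g \<tau>" for \<tau>
      using g by (simp add: W_per L_periodic W_in_Xspace C_per_def)
    have "(\<lambda>\<tau>. L \<tau> (W g r \<tau>) - g \<tau>) \<in> bcontfun"
      using periodic_bounded[OF T per cont] cont by (simp add: bcontfun_def)
    then have eq: "apply_bcontfun (\<Phi> r) = (\<lambda>\<tau>. L \<tau> (W g r \<tau>) - g \<tau>)"
      by (simp add: \<Phi>_def Bcontfun_inverse)
    show "apply_bcontfun (\<Phi> r) \<tau> = L \<tau> (W g r \<tau>) - g \<tau>" by (simp add: eq)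
    show "\<Phi> r \<in> C_per T UNIV" using per by (simp add: C_per_def eq)
  qed
  have "\<exists>!r. r \<in> C_per T UNIV \<and> \<Phi> r = r"
  proof (rule Banach_fix[OF complete_C_per, of _ "1 / 2"])
    show "C_per T UNIV \<noteq> ({} :: (real \<Rightarrow>\<^sub>C (complex^'n)) set)" using g by blast
    show "\<Phi> ` C_per T UNIV \<subseteq> C_per T UNIV" using \<Phi>(2) by blast
    show "dist (\<Phi> r) (\<Phi> r') \<le> 1 / 2 * dist r r'"
      if "r \<in> C_per T UNIV" "r' \<in> C_per T UNIV" for r r'
      using L_W_dist[of _ g r g r']
      by (intro dist_bound) (simp add: \<Phi>(1)[OF that(1)] \<Phi>(1)[OF that(2)] dist_norm)
  qed auto
  then obtain r where r: "r \<in> C_per T UNIV" "\<Phi> r = r" by blast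
  have "L \<tau> (W g r \<tau>) = g \<tau> + r \<tau>" for \<tau> using \<Phi>(1)[OF r(1), of \<tau>] r(2) by simp
  with r(1) show ?thesis by (rule that)
qed

lemma boundary_solution_stable:
  assumes "\<And>\<tau>. L \<tau> (W g r \<tau>) = g \<tau> + r \<tau>" "\<And>\<tau>. L \<tau> (W g' r' \<tau>) = g' \<tau> + r' \<tau>"
  shows "dist r r' \<le> 2 * (L_bound * h + 1) * dist g g'"
proof -
  have "dist r r' \<le> (L_bound * h * dist g g' + dist r r' / 2) + dist g g'"
  proof (rule dist_bound)
    fix \<tau>
    have "r \<tau> - r' \<tau> = (L \<tau> (W g r \<tau>) - L \<tau> (W g' r' \<tau>)) - (g \<tau> - g' \<tau>)" by (simp add: assms)
    also have "norm \<dots> \<le> norm (L \<tau> (W g r \<tau>) - L \<tau> (W g' r' \<tau>)) + norm (g \<tau> - g' \<tau>)"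
      by (rule norm_triangle_ineq4)
    also have "\<dots> \<le> (L_bound * h * dist g g' + dist r r' / 2) + dist g g'"
      using dist_bounded[of g \<tau> g'] by (intro add_mono L_W_dist) (simp add: dist_norm)
    finally show "dist (r \<tau>) (r' \<tau>) \<le> (L_bound * h * dist g g' + dist r r' / 2) + dist g g'"
      by (simp add: dist_norm)
  qed
  then show ?thesis by (simp add: algebra_simps)
qed

text \<open>For continuously differentiable \<open>g\<close> the wave is differentiable in both variables, whatever the
  smoothness of \<open>r\<close>.\<close>

lemma smooth_wave_in_A_per:
  assumes g: "g \<in> C_per T UNIV" and r: "r \<in> C_per T UNIV"
    and bdry: "\<And>\<tau>. L \<tau> (W g r \<tau>) = g \<tau> + r \<tau>"
    and g': "\<And>t. (apply_bcontfun g has_vector_derivative g' t) (at t)" "continuous_on UNIV g'"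
  shows "(periodic_curve h (wave rate g r), periodic_curve h (wave_image rate g r)) \<in> A_per"
proof -
  note c = wave_continuous[of rate g r]
  note W = periodic_curve[OF h T c(1) wave_periodic(1)[OF g r]]
  note I = periodic_curve[OF h T c(2) wave_periodic(2)[OF g r]]
  \<comment> \<open>The derivative of the wave in \<open>\<tau>\<close>.\<close>
  define f where "f \<tau> \<theta> = \<theta> *\<^sub>R g' (\<tau> + \<theta>) + exp (rate * \<theta>) *\<^sub>R (r (\<tau> + \<theta>) - r \<tau>)" for \<tau> \<theta>
  have f: "continuous_on UNIV (\<lambda>(\<tau>, \<theta>). f \<tau> \<theta>)"
    unfolding f_def split_beta
    by (intro continuous_intros continuous_on_add_args g' continuous_on_apply_bcontfun)
  have shift: "((\<lambda>\<sigma>. F (\<sigma> + c)) has_vector_derivative F' (\<sigma> + c)) (at \<sigma> within A)"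
      "((\<lambda>\<sigma>. F (c + \<sigma>)) has_vector_derivative F' (c + \<sigma>)) (at \<sigma> within A)"
    if F: "\<And>t. (F has_vector_derivative F' t) (at t)" for F F' :: "real \<Rightarrow> complex^'n" and c \<sigma> A
  proof -
    have "((\<lambda>t. t + c) has_vector_derivative 1) (at \<sigma>)"
      by (auto intro!: derivative_eq_intros simp: has_vector_derivative_def)
    from has_vector_derivative_at_within[OF vector_diff_chain_at[OF this F]]
    show "((\<lambda>\<sigma>. F (\<sigma> + c)) has_vector_derivative F' (\<sigma> + c)) (at \<sigma> within A)"
      by (simp add: o_def)
    then show "((\<lambda>\<sigma>. F (c + \<sigma>)) has_vector_derivative F' (c + \<sigma>)) (at \<sigma> within A)"
      by (simp add: add.commute)
  qed
  have der_\<tau>: "((\<lambda>\<tau>. wave rate g r \<tau> \<theta>) has_vector_derivative f \<tau> \<theta>) (at \<tau>)" for \<tau> \<theta>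
    unfolding wave_def f_def
    by (intro has_vector_derivative_add has_vector_derivative_diff
        bounded_linear.has_vector_derivative[OF bounded_linear_scaleR_right]
        shift(1)[OF g'(1)] shift(1)[OF primitive_derivative] primitive_derivative)
  have der_\<theta>: "(wave rate g r \<tau> has_vector_derivative wave_image rate g r \<tau> \<theta> + f \<tau> \<theta>) (at \<theta> within A)"
    for \<tau> \<theta> A
  proof -
    have e: "((\<lambda>\<theta>. exp (rate * \<theta>)) has_real_derivative rate * exp (rate * \<theta>)) (at \<theta> within A)"
      by (auto intro!: derivative_eq_intros)
    have p: "((\<lambda>\<theta>. primitive r (\<tau> + \<theta>) - primitive r \<tau>) has_vector_derivative r (\<tau> + \<theta>) - 0) (at \<theta> within A)"
      by (intro has_vector_derivative_diff shift(2)[OF primitive_derivative] has_vector_derivative_const)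
    have "((\<lambda>\<theta>. wave rate g r \<tau> \<theta>) has_vector_derivative
        (\<theta> *\<^sub>R g' (\<tau> + \<theta>) + 1 *\<^sub>R g (\<tau> + \<theta>))
        + (exp (rate * \<theta>) *\<^sub>R (r (\<tau> + \<theta>) - 0) + (rate * exp (rate * \<theta>)) *\<^sub>R (primitive r (\<tau> + \<theta>) - primitive r \<tau>)))
        (at \<theta> within A)"
      unfolding wave_def
      by (intro has_vector_derivative_add has_vector_derivative_scaleR shift(2)[OF g'(1)] e p DERIV_ident)
    then show ?thesis by (simp add: wave_image_def f_def algebra_simps)
  qed
  show ?thesis
    unfolding periodic_op_iff
  proof (intro conjI exI[of _ "segment_curve h f"] allI)
    show "periodic_curve h (wave rate g r) \<in> C_per T (Xspace h)"
      "periodic_curve h (wave_image rate g r) \<in> C_per T (Xspace h)" by (rule W I)+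
    show "continuous_on UNIV (segment_curve h f)" by (rule segment_curve_continuous[OF h f])
    fix \<tau>
    show "(apply_bcontfun (periodic_curve h (wave rate g r)) has_vector_derivative segment_curve h f \<tau>) (at \<tau>)"
      unfolding W by (rule segment_curve_derivative[OF h c(1) f der_\<tau>])
    let ?y = "segment_curve h (wave_image rate g r) \<tau> + segment_curve h f \<tau>"
    have y: "?y \<theta> = wave_image rate g r \<tau> \<theta> + f \<tau> \<theta>" if "\<theta> \<in> {-h..0}" for \<theta>
      using that by (simp add: segment_curve_apply[OF h c(2)] segment_curve_apply[OF h f] clamp_real)
    have "(apply_bcontfun (W g r \<tau>) has_vector_derivative ?y \<theta>) (at \<theta> within {-h..0})"
      if \<theta>: "\<theta> \<in> {-h..0}" for \<theta>
      unfolding y[OF \<theta>]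
      by (rule has_vector_derivative_transform[OF \<theta> _ der_\<theta>])
         (simp add: segment_curve_apply[OF h c(1)] clamp_real)
    moreover have "?y 0 = L \<tau> (W g r \<tau>)"
      using y[of 0] h by (simp add: bdry wave_image_def f_def)
    moreover have "?y \<in> Xspace h"
      by (intro cvec.subspace_add[OF csubspace_Xspace] segment_curve_in_Xspace h c f)
    ultimately show "(periodic_curve h (wave rate g r) \<tau>,
        periodic_curve h (wave_image rate g r) \<tau> + segment_curve h f \<tau>) \<in> A_op h (L \<tau>)"
      unfolding W I A_op_def using W_in_Xspace by auto
  qed
qed

text \<open>Continuity of \<open>\<phi> \<tau>\<close> identifies it with the Lipschitz representative that membership in the domain
  provides.\<close>

lemma A_per_sunstar_lipschitz:
  assumes \<phi>: "\<phi> \<in> C_per T (Xspace h)" and mem: "(map_bcontfun (emb h) \<phi>, \<psi>) \<in> A_per_sunstar"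
  obtains C where "C-lipschitz_on {-h..0} (apply_bcontfun (\<phi> \<tau>))"
proof -
  obtain q where "(emb h (\<phi> \<tau>), q) \<in> A_sunstar_op h (L \<tau>)"
    using mem unfolding periodic_op_iff map_bcontfun_apply[OF bounded_linear_emb] by blast
  then obtain u C where u: "u \<in> Xspace h" "C-lipschitz_on {-h..0} (apply_bcontfun u)"
    and ae: "AE \<theta> in lebesgue. \<theta> \<in> {-h..0} \<longrightarrow> rep_linf (snd (emb h (\<phi> \<tau>))) \<theta> = u \<theta>"
    unfolding A_sunstar_op_def by (auto simp: case_prod_beta)
  have "AE \<theta> in lebesgue. \<theta> \<in> {-h..0} \<longrightarrow> u \<theta> = \<phi> \<tau> \<theta>"
    using ae rep_emb[of h "\<phi> \<tau>"] by eventually_elim auto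
  moreover have "\<phi> \<tau> \<in> Xspace h" using \<phi> by (simp add: C_per_def)
  ultimately have "u = \<phi> \<tau>" by (intro Xspace_AE_eqI[OF h u(1)])
  with u(2) that show ?thesis by blast
qed

section \<open>A wave outside the domains\<close>

text \<open>For \<open>\<epsilon> = 0\<close> this is the square root of \<open>\<bar>sin (\<pi> s / T)\<bar>\<close>, which is \<open>T\<close>-periodic and not Lipschitz near \<open>0\<close>;
  a positive \<open>\<epsilon>\<close> keeps the argument of the roots away from zero and makes it smooth.\<close>

definition rough :: "real \<Rightarrow> real \<Rightarrow> real"
  where "rough \<epsilon> s = sqrt (sqrt ((sin (pi * s / T))\<^sup>2 + \<epsilon>))"

lemma rough_periodic: "rough \<epsilon> (s + T) = rough \<epsilon> s"
proof -
  have "pi * (s + T) / T = pi * s / T + pi" using T by (simp add: field_simps)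
  then show ?thesis by (simp add: rough_def)
qed

lemma rough_continuous: "continuous_on A (rough \<epsilon>)"
  unfolding rough_def using T by (intro continuous_intros) auto

lemma rough_derivative:
  assumes "0 < \<epsilon>"
  obtains D where "\<And>s. (rough \<epsilon> has_real_derivative D s) (at s)" "continuous_on UNIV D"
proof -
  define D where "D s = (2 * sin (pi * s / T) * (cos (pi * s / T) * (pi / T)))
      / (2 * sqrt ((sin (pi * s / T))\<^sup>2 + \<epsilon>)) / (2 * sqrt (sqrt ((sin (pi * s / T))\<^sup>2 + \<epsilon>)))" for s
  have pos: "0 < (sin (pi * s / T))\<^sup>2 + \<epsilon>" for s using assms by (intro add_nonneg_pos) auto
  have "(rough \<epsilon> has_real_derivative D s) (at s)" for s
    unfolding rough_def D_def using pos[of s] T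
    by (auto intro!: derivative_eq_intros simp: field_simps)
  moreover have "continuous_on UNIV D"
    unfolding D_def using pos T by (intro continuous_intros) (auto simp: less_imp_neq[symmetric])
  ultimately show ?thesis by (rule that)
qed

lemma rough_dist:
  assumes "0 \<le> \<epsilon>" shows "\<bar>rough \<epsilon> s - rough 0 s\<bar> \<le> sqrt (sqrt \<epsilon>)"
proof -
  let ?a = "(sin (pi * s / T))\<^sup>2"
  have "sqrt (sqrt (?a + \<epsilon>)) \<le> sqrt (sqrt ?a + sqrt \<epsilon>)"
    using assms by (intro real_sqrt_le_mono sqrt_add_le_add_sqrt) auto
  also have "\<dots> \<le> sqrt (sqrt ?a) + sqrt (sqrt \<epsilon>)"
    using assms by (intro sqrt_add_le_add_sqrt) auto
  finally have "sqrt (sqrt (?a + \<epsilon>)) \<le> sqrt (sqrt ?a) + sqrt (sqrt \<epsilon>)" .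
  moreover have "sqrt (sqrt ?a) \<le> sqrt (sqrt (?a + \<epsilon>))"
    using assms by (intro real_sqrt_le_mono) auto
  ultimately show ?thesis unfolding rough_def add_0_right by linarith
qed

definition rough_function :: "real \<Rightarrow> (complex^'n) \<Rightarrow> (real \<Rightarrow>\<^sub>C (complex^'n))"
  where "rough_function \<epsilon> v = Bcontfun (\<lambda>s. rough \<epsilon> s *\<^sub>R v)"

lemma rough_function:
  "apply_bcontfun (rough_function \<epsilon> v) s = rough \<epsilon> s *\<^sub>R v" "rough_function \<epsilon> v \<in> C_per T UNIV"
proof -
  have cont: "continuous_on UNIV (\<lambda>s. rough \<epsilon> s *\<^sub>R v)"
    by (intro continuous_on_scaleR rough_continuous continuous_on_const)
  have per: "rough \<epsilon> (s + T) *\<^sub>R v = rough \<epsilon> s *\<^sub>R v" for s by (simp add: rough_periodic)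
  have "(\<lambda>s. rough \<epsilon> s *\<^sub>R v) \<in> bcontfun"
    using periodic_bounded[OF T per cont] cont by (simp add: bcontfun_def)
  then have eq: "apply_bcontfun (rough_function \<epsilon> v) = (\<lambda>s. rough \<epsilon> s *\<^sub>R v)"
    by (simp add: rough_function_def Bcontfun_inverse)
  show "apply_bcontfun (rough_function \<epsilon> v) s = rough \<epsilon> s *\<^sub>R v" by (simp add: eq)
  show "rough_function \<epsilon> v \<in> C_per T UNIV" by (simp add: C_per_def eq per)
qed

lemma rough_function_tendsto:
  "(\<lambda>k. rough_function (inverse (real (Suc k))) v) \<longlonglongrightarrow> rough_function 0 v"
proof (rule metric_tendsto_imp_tendsto)
  have "(\<lambda>k. sqrt (sqrt (inverse (real (Suc k)))) * norm v) \<longlonglongrightarrow> sqrt (sqrt 0) * norm v"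
    by (intro tendsto_intros LIMSEQ_inverse_real_of_nat)
  then show "(\<lambda>k. sqrt (sqrt (inverse (real (Suc k)))) * norm v) \<longlonglongrightarrow> 0" by simp
  have "dist (rough_function (inverse (real (Suc k))) v) (rough_function 0 v)
      \<le> sqrt (sqrt (inverse (real (Suc k)))) * norm v" for k
  proof (rule dist_bound)
    fix s
    have "dist (rough_function (inverse (real (Suc k))) v s) (rough_function 0 v s)
        = \<bar>rough (inverse (real (Suc k))) s - rough 0 s\<bar> * norm v"
      by (simp add: rough_function dist_norm scaleR_diff_left[symmetric])
    also have "\<dots> \<le> sqrt (sqrt (inverse (real (Suc k)))) * norm v"
      by (intro mult_right_mono rough_dist) auto
    finally show "dist (rough_function (inverse (real (Suc k))) v s) (rough_function 0 v s)
        \<le> sqrt (sqrt (inverse (real (Suc k)))) * norm v" .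
  qed
  then show "\<forall>\<^sub>F k in sequentially. dist (rough_function (inverse (real (Suc k))) v) (rough_function 0 v)
      \<le> dist (sqrt (sqrt (inverse (real (Suc k)))) * norm v) 0"
    by simp
qed

text \<open>At \<open>\<tau> = h\<close> the first summand of the wave is \<open>\<theta>\<close> times the rough function of \<open>h + \<theta>\<close>, whose zero is met at
  the end point \<open>\<theta> = -h\<close>, where the factor \<open>\<theta>\<close> is not zero. The second summand \<open>E\<close> is differentiable and
  cannot compensate for the infinite slope.\<close>

lemma wave_not_lipschitz:
  assumes v: "norm v = 1"
  shows "\<not> C-lipschitz_on {-h..0} (apply_bcontfun (W (rough_function 0 v) r h))"
proof
  assume lip: "C-lipschitz_on {-h..0} (apply_bcontfun (W (rough_function 0 v) r h))"
  define E where "E \<theta> = exp (rate * \<theta>) *\<^sub>R (primitive r (h + \<theta>) - primitive r h)" for \<theta>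
  let ?d = "\<lambda>k. inverse (real (Suc k))"
  define a where "a k = real (Suc k) * (h - ?d k) * sqrt (sqrt ((sin (pi * ?d k / T))\<^sup>2))" for k
  have W: "W (rough_function 0 v) r h \<theta> = (\<theta> * rough 0 (h + \<theta>)) *\<^sub>R v + E \<theta>" if "\<theta> \<in> {-h..0}" for \<theta>
    using that by (simp add: segment_curve_apply[OF h wave_continuous(1)] clamp_real wave_def E_def
        rough_function)
  have "((\<lambda>t. h + t) has_vector_derivative 1) (at (-h))"
    by (auto intro!: derivative_eq_intros simp: has_vector_derivative_def)
  from vector_diff_chain_at[OF this primitive_derivative]
  have "((\<lambda>\<theta>. primitive r (h + \<theta>) - primitive r h) has_vector_derivative r 0 - 0) (at (-h))"
    by (intro has_vector_derivative_diff has_vector_derivative_const) (simp add: o_def)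
  moreover have "((\<lambda>\<theta>. exp (rate * \<theta>)) has_real_derivative rate * exp (rate * - h)) (at (-h))"
    by (auto intro!: derivative_eq_intros)
  ultimately obtain E' where "(E has_vector_derivative E') (at (-h))"
    unfolding E_def using has_vector_derivative_scaleR by blast
  from has_vector_derivative_sequentially[OF this]
  have "Bseq (\<lambda>k. real (Suc k) *\<^sub>R (E (- h + ?d k) - E (- h)))"
    by (intro convergent_imp_Bseq) (auto simp: convergent_def)
  then obtain B where B: "\<And>k. norm (real (Suc k) *\<^sub>R (E (- h + ?d k) - E (- h))) \<le> B"
    by (auto simp: Bseq_def)
  have a_le: "a k \<le> C + B" if k: "?d k < h" for k
  proof -
    have mem: "- h + ?d k \<in> {-h..0}" "- h \<in> {-h..0}" using k h by auto
    have scale: "real (Suc k) * x \<le> C" if "x \<le> C * ?d k" for x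
      using that by (simp add: field_simps)
    have "norm (W (rough_function 0 v) r h (- h + ?d k) - W (rough_function 0 v) r h (- h)) \<le> C * ?d k"
      using lipschitz_onD[OF lip mem] by (simp add: dist_norm)
    then have 1: "real (Suc k) * norm (W (rough_function 0 v) r h (- h + ?d k) - W (rough_function 0 v) r h (- h)) \<le> C"
      by (rule scale)
    have "((h - ?d k) * rough 0 (?d k)) *\<^sub>R v =
        (E (- h + ?d k) - E (- h)) - (W (rough_function 0 v) r h (- h + ?d k) - W (rough_function 0 v) r h (- h))"
      unfolding W[OF mem(1)] W[OF mem(2)] by (simp add: rough_def algebra_simps)
    then have "norm (((h - ?d k) * rough 0 (?d k)) *\<^sub>R v) \<le> norm (E (- h + ?d k) - E (- h))
        + norm (W (rough_function 0 v) r h (- h + ?d k) - W (rough_function 0 v) r h (- h))"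
      by (simp only: norm_triangle_ineq4)
    then have "real (Suc k) * norm (((h - ?d k) * rough 0 (?d k)) *\<^sub>R v)
        \<le> real (Suc k) * norm (E (- h + ?d k) - E (- h))
        + real (Suc k) * norm (W (rough_function 0 v) r h (- h + ?d k) - W (rough_function 0 v) r h (- h))"
      by (simp only: distrib_left[symmetric]) (rule mult_left_mono, auto)
    also have "\<dots> \<le> B + C" using 1 B[of k] by (intro add_mono) simp_all
    finally have "real (Suc k) * norm (((h - ?d k) * rough 0 (?d k)) *\<^sub>R v) \<le> B + C" .
    moreover have "real (Suc k) * norm (((h - ?d k) * rough 0 (?d k)) *\<^sub>R v) = a k"
      using k v by (simp add: a_def rough_def abs_mult)
    ultimately show ?thesis by simp
  qed
  have "filterlim a at_top sequentially"
    unfolding a_def using h T by real_asymp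
  then have "\<forall>\<^sub>F k in sequentially. C + B < a k" by (simp add: filterlim_at_top_dense)
  moreover have "\<forall>\<^sub>F k in sequentially. ?d k < h"
    using LIMSEQ_inverse_real_of_nat h by (rule order_tendstoD(2))
  ultimately have "\<forall>\<^sub>F k in sequentially. False"
    by eventually_elim (use a_le in force)
  then show False by simp
qed

text \<open>The solution \<open>r\<close> of the boundary condition depends Lipschitz continuously on \<open>g\<close>, so the waves of
  the smooth approximations converge together with their images.\<close>

lemma A_per_limit:
  obtains p \<phi> \<psi> where "\<And>k. p k \<in> A_per" "p \<longlonglongrightarrow> (\<phi>, \<psi>)"
    "\<phi> \<in> C_per T (Xspace h)" "\<psi> \<in> C_per T (Xspace h)" "(map_bcontfun (emb h) \<phi>, map_bcontfun (emb h) \<psi>) \<notin> A_per_sunstar"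
proof -
  obtain v :: "complex^'n" where v: "norm v = 1" using vector_choose_size[of 1] by auto
  define g where "g k = rough_function (inverse (real (Suc k))) v" for k
  define g0 where "g0 = rough_function 0 v"
  have g: "g k \<in> C_per T UNIV" "g0 \<in> C_per T UNIV" for k by (simp_all add: g_def g0_def rough_function)
  obtain r0 where r0: "r0 \<in> C_per T UNIV" "\<And>\<tau>. L \<tau> (W g0 r0 \<tau>) = g0 \<tau> + r0 \<tau>"
    by (rule boundary_solution_exists[OF g(2)]) (rule that)
  have "\<forall>k. \<exists>r. r \<in> C_per T UNIV \<and> (\<forall>\<tau>. L \<tau> (W (g k) r \<tau>) = g k \<tau> + r \<tau>)"
    using boundary_solution_exists[OF g(1)] by metis
  then obtain r where r: "\<And>k. r k \<in> C_per T UNIV" "\<And>k \<tau>. L \<tau> (W (g k) (r k) \<tau>) = g k \<tau> + r k \<tau>"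
    by metis
  have g_lim: "(\<lambda>k. dist (g k) g0) \<longlonglongrightarrow> 0"
    using rough_function_tendsto[of v] unfolding g_def g0_def by (rule tendsto_dist_iff[THEN iffD1])
  have r_lim: "(\<lambda>k. dist (r k) r0) \<longlonglongrightarrow> 0"
  proof (rule tendsto_sandwich[OF _ _ tendsto_const])
    show "(\<lambda>k. 2 * (L_bound * h + 1) * dist (g k) g0) \<longlonglongrightarrow> 0"
      using tendsto_mult_right_zero[OF g_lim] .
    show "\<forall>\<^sub>F k in sequentially. dist (r k) r0 \<le> 2 * (L_bound * h + 1) * dist (g k) g0"
      using boundary_solution_stable[OF r(2) r0(2)] by simp
  qed simp
  define \<phi> where "\<phi> g r = periodic_curve h (wave rate g r)" for g r :: "real \<Rightarrow>\<^sub>C (complex^'n)"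
  define \<psi> where "\<psi> g r = periodic_curve h (wave_image rate g r)" for g r :: "real \<Rightarrow>\<^sub>C (complex^'n)"
  have \<phi>: "apply_bcontfun (\<phi> g r) = segment_curve h (wave rate g r)" "\<phi> g r \<in> C_per T (Xspace h)"
    and \<psi>: "apply_bcontfun (\<psi> g r) = segment_curve h (wave_image rate g r)" "\<psi> g r \<in> C_per T (Xspace h)"
    if "g \<in> C_per T UNIV" "r \<in> C_per T UNIV" for g r :: "real \<Rightarrow>\<^sub>C (complex^'n)"
    using periodic_curve[OF h T wave_continuous(1)[of rate g r] wave_periodic(1)[OF that]]
      periodic_curve[OF h T wave_continuous(2)[of rate g r] wave_periodic(2)[OF that]]
    unfolding \<phi>_def \<psi>_def by simp_all
  have \<phi>_dist: "dist (\<phi> (g k) (r k)) (\<phi> g0 r0) \<le> h * dist (g k) g0 + dist (r k) r0 / rate" for k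
  proof (rule dist_bound)
    fix \<tau>
    show "dist (\<phi> (g k) (r k) \<tau>) (\<phi> g0 r0 \<tau>) \<le> h * dist (g k) g0 + dist (r k) r0 / rate"
      unfolding \<phi>(1)[OF g(1) r(1)] \<phi>(1)[OF g(2) r0(1)]
      unfolding dist_norm[of "segment_curve _ _ _"]
      by (intro segment_curve_dist h wave_continuous wave_dist rate)
  qed
  have \<psi>_dist: "dist (\<psi> (g k) (r k)) (\<psi> g0 r0) \<le> dist (g k) g0 + 2 * dist (r k) r0" for k
  proof (rule dist_bound)
    fix \<tau>
    show "dist (\<psi> (g k) (r k) \<tau>) (\<psi> g0 r0 \<tau>) \<le> dist (g k) g0 + 2 * dist (r k) r0"
      unfolding \<psi>(1)[OF g(1) r(1)] \<psi>(1)[OF g(2) r0(1)]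
      unfolding dist_norm[of "segment_curve _ _ _"]
      by (intro segment_curve_dist h wave_continuous wave_dist rate)
  qed
  have \<phi>_lim: "(\<lambda>k. \<phi> (g k) (r k)) \<longlonglongrightarrow> \<phi> g0 r0"
  proof (rule metric_tendsto_imp_tendsto)
    show "(\<lambda>k. h * dist (g k) g0 + dist (r k) r0 / rate) \<longlonglongrightarrow> 0"
      using tendsto_add[OF tendsto_mult[OF tendsto_const[of h] g_lim] tendsto_mult[OF r_lim tendsto_const[of "1 / rate"]]]
      by simp
    show "\<forall>\<^sub>F k in sequentially. dist (\<phi> (g k) (r k)) (\<phi> g0 r0) \<le> dist (h * dist (g k) g0 + dist (r k) r0 / rate) 0"
      using \<phi>_dist h rate by (auto simp: abs_of_nonneg)
  qed
  have \<psi>_lim: "(\<lambda>k. \<psi> (g k) (r k)) \<longlonglongrightarrow> \<psi> g0 r0"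
  proof (rule metric_tendsto_imp_tendsto)
    show "(\<lambda>k. dist (g k) g0 + 2 * dist (r k) r0) \<longlonglongrightarrow> 0"
      using tendsto_add[OF g_lim tendsto_mult[OF tendsto_const[of 2] r_lim]] by simp
    show "\<forall>\<^sub>F k in sequentially. dist (\<psi> (g k) (r k)) (\<psi> g0 r0) \<le> dist (dist (g k) g0 + 2 * dist (r k) r0) 0"
      using \<psi>_dist by auto
  qed
  have in_A: "(\<phi> (g k) (r k), \<psi> (g k) (r k)) \<in> A_per" for k
  proof -
    obtain D where D: "\<And>s. (rough (inverse (real (Suc k))) has_real_derivative D s) (at s)" "continuous_on UNIV D"
      using rough_derivative[of "inverse (real (Suc k))"] by auto
    have ap: "apply_bcontfun (g k) = (\<lambda>s. rough (inverse (real (Suc k))) s *\<^sub>R v)"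
      by (rule ext) (simp add: g_def rough_function)
    have "(apply_bcontfun (g k) has_vector_derivative D s *\<^sub>R v) (at s)" for s
      unfolding ap
      using has_vector_derivative_scaleR[OF D(1) has_vector_derivative_const[of v]] by simp
    moreover have "continuous_on UNIV (\<lambda>s. D s *\<^sub>R v)" by (intro continuous_intros D(2))
    ultimately show ?thesis
      unfolding \<phi>_def \<psi>_def by (intro smooth_wave_in_A_per g r)
  qed
  have not_in: "(map_bcontfun (emb h) (\<phi> g0 r0), map_bcontfun (emb h) (\<psi> g0 r0)) \<notin> A_per_sunstar"
  proof
    assume mem: "(map_bcontfun (emb h) (\<phi> g0 r0), map_bcontfun (emb h) (\<psi> g0 r0)) \<in> A_per_sunstar"
    obtain C where C: "C-lipschitz_on {-h..0} (apply_bcontfun (\<phi> g0 r0 h))"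
      by (rule A_per_sunstar_lipschitz[OF \<phi>(2)[OF g(2) r0(1)] mem, of h]) (rule that)
    show False
      using C[unfolded \<phi>(1)[OF g(2) r0(1)]] wave_not_lipschitz[OF v] unfolding g0_def by blast
  qed
  show ?thesis
    by (rule that[OF in_A tendsto_Pair[OF \<phi>_lim \<psi>_lim] \<phi>(2)[OF g(2) r0(1)] \<psi>(2)[OF g(2) r0(1)] not_in])
qed

lemma A_per_not_closed: "\<not> closed_operator_in (C_per T (Xspace h)) A_per"
proof
  assume "closed_operator_in (C_per T (Xspace h)) A_per"
  then obtain S where S: "closed S" "A_per = (C_per T (Xspace h) \<times> C_per T (Xspace h)) \<inter> S"
    unfolding closed_operator_in_def closedin_closed by blast
  obtain p \<phi> \<psi> where p: "\<And>k. p k \<in> A_per" "p \<longlonglongrightarrow> (\<phi>, \<psi>)"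
    "\<phi> \<in> C_per T (Xspace h)" "\<psi> \<in> C_per T (Xspace h)" "(map_bcontfun (emb h) \<phi>, map_bcontfun (emb h) \<psi>) \<notin> A_per_sunstar"
    by (rule A_per_limit) (rule that)
  have "p k \<in> S" for k using p(1)[of k] S(2) by blast
  then have "(\<phi>, \<psi>) \<in> S" using closed_sequentially[OF S(1)] p(2) by blast
  then have "(\<phi>, \<psi>) \<in> A_per" using S(2) p(3,4) by blast
  then show False using emb_periodic_op[OF h] p(5) by blast
qed

lemma A_per_sunstar_not_closed: "\<not> closed_operator_in (C_per T (Xsunstar h)) A_per_sunstar"
proof
  assume "closed_operator_in (C_per T (Xsunstar h)) A_per_sunstar"
  then obtain S where S: "closed S" "A_per_sunstar = (C_per T (Xsunstar h) \<times> C_per T (Xsunstar h)) \<inter> S"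
    unfolding closed_operator_in_def closedin_closed by blast
  obtain p \<phi> \<psi> where p: "\<And>k. p k \<in> A_per" "p \<longlonglongrightarrow> (\<phi>, \<psi>)"
    "\<phi> \<in> C_per T (Xspace h)" "\<psi> \<in> C_per T (Xspace h)" "(map_bcontfun (emb h) \<phi>, map_bcontfun (emb h) \<psi>) \<notin> A_per_sunstar"
    by (rule A_per_limit) (rule that)
  define J :: "(real \<Rightarrow>\<^sub>C real \<Rightarrow>\<^sub>C (complex^'n)) \<Rightarrow> (real \<Rightarrow>\<^sub>C ((complex^'n) \<times> (complex^'n) linf))"
    where "J = map_bcontfun (emb h)"
  have J: "bounded_linear J"
    unfolding J_def by (intro bounded_linear_map_bcontfun bounded_linear_emb)
  have "(J (fst (p k)), J (snd (p k))) \<in> A_per_sunstar" for k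
    unfolding J_def using p(1)[of k] by (intro emb_periodic_op h) simp
  then have "(J (fst (p k)), J (snd (p k))) \<in> S" for k using S(2) by blast
  moreover have "(\<lambda>k. (J (fst (p k)), J (snd (p k)))) \<longlonglongrightarrow> (J (fst (\<phi>, \<psi>)), J (snd (\<phi>, \<psi>)))"
    by (intro tendsto_Pair bounded_linear.tendsto[OF J] tendsto_fst tendsto_snd p(2))
  ultimately have "(J \<phi>, J \<psi>) \<in> S" using closed_sequentially[OF S(1)] by fastforce
  moreover have "(J \<phi>, J \<psi>) \<in> C_per T (Xsunstar h) \<times> C_per T (Xsunstar h)"
    unfolding J_def using p(3,4) by (blast intro: emb_C_per)
  ultimately have "(J \<phi>, J \<psi>) \<in> A_per_sunstar" using S(2) by blast
  then show False using p(5) unfolding J_def by contradiction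
qed

end

section \<open>The operators along a periodic solution\<close>

theorem proposition3p7:
  fixes h T :: real and k :: nat
    and F :: "(real \<Rightarrow>\<^sub>C (real^'n)) \<Rightarrow> real^'n" and \<gamma> :: "real \<Rightarrow> real^'n"
    and calA :: "((real \<Rightarrow>\<^sub>C (real \<Rightarrow>\<^sub>C (complex^'n))) \<times> (real \<Rightarrow>\<^sub>C (real \<Rightarrow>\<^sub>C (complex^'n)))) set"
    and calAsunstar :: "((real \<Rightarrow>\<^sub>C ((complex^'n) \<times> (complex^'n) linf))
      \<times> (real \<Rightarrow>\<^sub>C ((complex^'n) \<times> (complex^'n) linf))) set"
  assumes h: "0 < h"
    and k: "1 \<le> k"
    and F: "C_smooth_on (k + 1) (Xspace h) F"
    and solution: "solves_delay_eq h F \<gamma>"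
    and period: "minimal_period \<gamma> T"
    and calA: "calA = periodic_op T (Xspace h) (\<lambda>\<tau>. A_op h (linearization h F \<gamma> \<tau>))"
    and calAsunstar: "calAsunstar =
      periodic_op T (Xsunstar h) (\<lambda>\<tau>. A_sunstar_op h (linearization h F \<gamma> \<tau>))"
  shows "linear_operator_in (C_per T (Xspace h)) calA
      \<and> \<not> closed_operator_in (C_per T (Xspace h)) calA
      \<and> closable_operator_in (C_per T (Xspace h)) calA
      \<and> linear_operator_in (C_per T (Xsunstar h)) calAsunstar
      \<and> \<not> closed_operator_in (C_per T (Xsunstar h)) calAsunstar
      \<and> closable_operator_in (C_per T (Xsunstar h)) calAsunstar"
proof -
  have "continuous_on UNIV \<gamma>"
    using solution unfolding solves_delay_eq_def
    by (auto intro!: continuous_at_imp_continuous_on has_vector_derivative_continuous)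
  then interpret delay_family h T "linearization h F \<gamma>"
    using h F k period by (intro delay_family_linearization[where m = "k + 1"]) (auto simp: minimal_period_def)
  show ?thesis
    unfolding calA calAsunstar
    using A_per_linear A_per_not_closed A_per_closable
      A_per_sunstar_linear A_per_sunstar_not_closed A_per_sunstar_closable by blast
qed

end
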